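(* Let $p\in(0,1)$ be fixed, $\sigma=\sqrt{p(1-p)}$, and let $G_n(p)$ be the Erdős–Rényi random graph on $\{1,\dots,n\}$ (each edge present independently with probability $p$), with adjacency matrix $\mathbf{A}=(a_{ij})$, degree matrix $\mathbf{D}$ and Laplacian $\mathbf{L}=\mathbf{D}-\mathbf{A}$. Define $$\mathbf{L}_1=\mathbf{L}-\frac{2\sum_{i<j}a_{ij}}{n}\mathbf{I}_n+p(\mathbf{J}_n-\mathbf{I}_n),$$ where $\mathbf{J}_n$ is the all-ones $n\times n$ matrix. Then, with probability $1$, the empirical spectral distribution $\Phi_{(\sigma\sqrt n)^{-1}\mathbf{L}_1}$ converges weakly to $\Psi$ as $n\to\infty$, where $\Psi=\Phi_{0,1}\boxplus N(0,1)$ is the free convolution of the standard semicircle distribution and the standard normal distribution.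
   Context: For a real symmetric $n\times n$ matrix $\mathbf{M}$ with eigenvalues $\lambda_1,\dots,\lambda_n$, its empirical spectral distribution is $\Phi_{\mathbf{M}}(x)=\frac1n\#\{i:\lambda_i\le x\}$. The standard semicircle distribution $\Phi_{0,1}$ has density $\frac{1}{2\pi}\sqrt{4-x^2}\,\mathbf{1}_{|x|\le 2}$. Free convolution (Voiculescu): for a probability measure $\mu$ let $G_\mu(z)=\int\frac{\mu(dx)}{z-x}$ be its Cauchy–Stieltjes transform on the upper half plane, $K_\mu$ its inverse function on a suitable domain near $0$, and $R_\mu(z)=K_\mu(z)-1/z$; then $\mu\boxplus\nu$ is the unique probability measure with $R_{\mu\boxplus\nu}=R_\mu+R_\nu$. *)

theory Defs
  imports "HOL-Probability.Probability" "Jordan_Normal_Form.Char_Poly"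
begin

hide_const (open) Finite_Cartesian_Product.mat
hide_type (open) Finite_Cartesian_Product.vec

definition graph_edges :: "nat \<Rightarrow> nat set set" where
  "graph_edges n = {e. e \<subseteq> {1..n} \<and> card e = 2}"

text \<open>A random graph on the vertex set \<open>{1..n}\<close> is given by its random edge set.\<close>

definition erdos_renyi :: "'w measure \<Rightarrow> nat \<Rightarrow> real \<Rightarrow> ('w \<Rightarrow> nat set set) \<Rightarrow> bool" where
  "erdos_renyi M n p G \<longleftrightarrow>
     (\<forall>\<omega>\<in>space M. G \<omega> \<subseteq> graph_edges n) \<and>
     prob_space.indep_events M (\<lambda>e. {\<omega> \<in> space M. e \<in> G \<omega>}) (graph_edges n) \<and>
     (\<forall>e\<in>graph_edges n. measure M {\<omega> \<in> space M. e \<in> G \<omega>} = p)"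

text \<open>Matrix rows and columns are counted from \<open>0\<close>, so index \<open>i\<close> belongs to vertex \<open>Suc i\<close>.
  The diagonal of \<open>adj_mat\<close> vanishes because edges have two elements.\<close>

definition adj_mat :: "nat \<Rightarrow> nat set set \<Rightarrow> real mat" where
  "adj_mat n E = mat n n (\<lambda>(i, j). if {Suc i, Suc j} \<in> E then 1 else 0)"

definition degree_mat :: "nat \<Rightarrow> nat set set \<Rightarrow> real mat" where
  "degree_mat n E = mat n n (\<lambda>(i, j). if i = j then real (card {e \<in> E. Suc i \<in> e}) else 0)"

definition laplacian_mat :: "nat \<Rightarrow> nat set set \<Rightarrow> real mat" where
  "laplacian_mat n E = degree_mat n E - adj_mat n E"

definition ones_mat :: "nat \<Rightarrow> real mat" where
  "ones_mat n = mat n n (\<lambda>_. 1)"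

definition L1_mat :: "nat \<Rightarrow> real \<Rightarrow> nat set set \<Rightarrow> real mat" where
  "L1_mat n p E =
     laplacian_mat n E
     - (2 * (\<Sum>j<n. \<Sum>i<j. adj_mat n E $$ (i, j)) / real n) \<cdot>\<^sub>m 1\<^sub>m n
     + p \<cdot>\<^sub>m (ones_mat n - 1\<^sub>m n)"

text \<open>Eigenvalues are counted with multiplicity. For a real symmetric matrix the characteristic
  polynomial splits over the reals, so the multiset of its real roots has size \<open>dim_row A\<close>.\<close>

definition esd :: "real mat \<Rightarrow> real \<Rightarrow> real" where
  "esd A x = real (size {#l \<in># proots (char_poly A). l \<le> x#}) / real (dim_row A)"

definition semicircle_distribution :: "real measure" where
  "semicircle_distribution =
     density lborel (\<lambda>x. ennreal (1 / (2 * pi) * sqrt (4 - x\<^sup>2) * indicator {-2..2} x))"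

definition cauchy_transform :: "real measure \<Rightarrow> complex \<Rightarrow> complex" where
  "cauchy_transform \<mu> z = (LINT x|\<mu>. 1 / (z - complex_of_real x))"

text \<open>For measures of unbounded support, the Cauchy transform is inverted on truncated cones
  in the upper half plane (Bercovici and Voiculescu): for every \<open>0 < c < a\<close>, if \<open>b\<close> and then \<open>d\<close>
  are large enough, the transform is injective on \<open>trunc_cone a b\<close> and the image of this cone
  contains \<open>stolz_angle c d\<close>, a region of the lower half plane with vertex \<open>0\<close>.\<close>

definition trunc_cone :: "real \<Rightarrow> real \<Rightarrow> complex set" where
  "trunc_cone a b = {z. Im z > b \<and> \<bar>Re z\<bar> < a * Im z}"

definition stolz_angle :: "real \<Rightarrow> real \<Rightarrow> complex set" where
  "stolz_angle c d = (\<lambda>w. 1 / w) ` trunc_cone c d"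

definition cauchy_invertible :: "real measure \<Rightarrow> complex set \<Rightarrow> complex set \<Rightarrow> bool" where
  "cauchy_invertible \<mu> U D \<longleftrightarrow>
     inj_on (cauchy_transform \<mu>) U \<and> D \<subseteq> cauchy_transform \<mu> ` U"

definition K_transform :: "real measure \<Rightarrow> complex set \<Rightarrow> complex \<Rightarrow> complex" where
  "K_transform \<mu> U = the_inv_into U (cauchy_transform \<mu>)"

definition R_transform :: "real measure \<Rightarrow> complex set \<Rightarrow> complex \<Rightarrow> complex" where
  "R_transform \<mu> U z = K_transform \<mu> U z - 1 / z"

text \<open>Any two admissible choices of the parameters below give transforms that agree near \<open>0\<close> on a
  smaller angle, so the relation does not depend on the choice and determines \<open>\<rho>\<close>.\<close>

definition is_free_convolution :: "real measure \<Rightarrow> real measure \<Rightarrow> real measure \<Rightarrow> bool" where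
  "is_free_convolution \<mu> \<nu> \<rho> \<longleftrightarrow>
     real_distribution \<rho> \<and>
     (\<exists>a>0. \<exists>b>0. \<exists>c>0. \<exists>d>0.
        (\<forall>\<tau>\<in>{\<mu>, \<nu>, \<rho>}. cauchy_invertible \<tau> (trunc_cone a b) (stolz_angle c d)) \<and>
        (\<forall>z\<in>stolz_angle c d.
           R_transform \<rho> (trunc_cone a b) z
             = R_transform \<mu> (trunc_cone a b) z + R_transform \<nu> (trunc_cone a b) z))"

definition free_convolution :: "real measure \<Rightarrow> real measure \<Rightarrow> real measure" (infixl "\<boxplus>" 65) where
  "\<mu> \<boxplus> \<nu> = (THE \<rho>. is_free_convolution \<mu> \<nu> \<rho>)"

end

theory Submission
  imports Defs "Jordan_Normal_Form.Schur_Decomposition"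
begin

text \<open>
  With \<open>t = 1 / (\<sigma> \<surd>n)\<close>, the matrix \<open>t \<cdot> L\<^sub>1\<close> equals \<open>A - \<epsilon> I\<close>, where \<open>A\<close> is the Laplacian of the
  centered edge weights \<open>t (a\<^sub>i\<^sub>j - p)\<close> and \<open>\<epsilon> = tr A / n\<close> tends to \<open>0\<close> almost surely.
  Adding an edge changes \<open>A\<close> by a rank one matrix of norm \<open>2 t\<close>. Hence the normalized resolvent trace
  \<open>S(z)\<close> has bounded differences of order \<open>n\<^sup>-\<^sup>3\<^sup>/\<^sup>2\<close> in \<open>O(n\<^sup>2)\<close> independent edges, and it
  concentrates exponentially around its mean \<open>s\<close>. Expanding \<open>(z - A) R = I\<close> along row \<open>i\<close>,
  multiplying by \<open>1 / (z - s - A\<^sub>i\<^sub>i)\<close> and integrating by parts in each edge gives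
  \<open>E R\<^sub>i\<^sub>i = E (1 / (z - s - A\<^sub>i\<^sub>i)) + O(n\<^sup>-\<^sup>1\<^sup>/\<^sup>2)\<close>. The diagonal entry \<open>A\<^sub>i\<^sub>i\<close> is asymptotically standard
  normal, so almost surely every weak limit point \<open>\<rho>\<close> of the spectral distributions satisfies the
  Pastur equation \<open>G\<^sub>\<rho>(z) = G\<^sub>N(z - G\<^sub>\<rho>(z))\<close>, which also yields tightness. Since the semicircle
  distribution has R-transform \<open>R(u) = u\<close>, the equation says \<open>K\<^sub>\<rho>(u) = u + K\<^sub>N(u)\<close>, that is,
  \<open>\<rho>\<close> is the free convolution. A limit point exists by Helly's theorem, and it is unique because the values of
  a Cauchy transform far up on the imaginary axis are Laplace transforms of the characteristic function.
\<close>

subsection \<open>Expectations over independent edges\<close>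

text \<open>The obstacle: the diagonal entry of row \<open>i\<close> is of order one and is built
  from the same edges as the row, so independence cannot decouple the two. The factor
  \<open>\<phi> i\<close> resolves this. In an edge \<open>ij\<close> the difference of
  \<open>\<phi> i * R j i\<close> has leading part \<open>- t * \<phi> i * R j j * R i i\<close>;
  since \<open>\<sigma>^2 t^2 = 1/n\<close>, the sum over \<open>j\<close> rebuilds
  \<open>S * \<phi> i * R i i\<close>, which the shift \<open>s\<close> in the denominator is there
  to cancel. The shift is the mean \<open>s\<close> and not \<open>S\<close>, so that
  \<open>\<phi> i\<close> depends on the edges at \<open>i\<close> alone; the price is the deviation
  \<open>S - s\<close>. What remains carries an off-diagonal entry or a further small factor, and
  since the columns of \<open>R\<close> are bounded in norm, Cauchy-Schwarz makes it
  \<open>O(1/sqrt n)\<close>. Nothing links the graphs for different \<open>n\<close>, so almost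
  sure convergence rests on Borel-Cantelli with tails \<open>exp (- \<epsilon> sqrt n)\<close>.
  Graph expectations are finite sums over edge sets until events of \<open>G n\<close> are
  translated. The operator \<open>\<boxplus>\<close> is a definite description, so existence and
  uniqueness are both proved; existence comes from a limit point.\<close>

definition bern_exp :: "real \<Rightarrow> 'e set \<Rightarrow> ('e set \<Rightarrow> 'a::real_vector) \<Rightarrow> 'a" where
  "bern_exp p F f = (\<Sum>E\<in>Pow F. (\<Prod>e\<in>F. if e \<in> E then p else 1 - p) *\<^sub>R f E)"

lemma bern_exp_empty [simp]: "bern_exp p {} f = f {}"
  by (simp add: bern_exp_def)

text \<open>Conditioning on the single edge \<open>e\<close>; this recursion carries the inductions
  over the edge set.\<close>

lemma bern_exp_insert:
  assumes "finite F" "e \<notin> F"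
  shows "bern_exp p (insert e F) f
    = p *\<^sub>R bern_exp p F (\<lambda>E. f (insert e E)) + (1 - p) *\<^sub>R bern_exp p F f"
proof -
  let ?w = "\<lambda>F E. \<Prod>x\<in>F. if x \<in> E then p else 1 - p"
  have w1: "?w (insert e F) (insert e E) = p * ?w F E" if "E \<in> Pow F" for E
    using assms that by (auto intro!: prod.cong)
  have w0: "?w (insert e F) E = (1 - p) * ?w F E" if "E \<in> Pow F" for E
    using assms that by auto
  have inj: "inj_on (insert e) (Pow F)"
    using assms by (auto simp: inj_on_def)
  have "bern_exp p (insert e F) f
    = (\<Sum>E\<in>Pow F. ?w (insert e F) E *\<^sub>R f E)
      + (\<Sum>E\<in>insert e ` Pow F. ?w (insert e F) E *\<^sub>R f E)"
    unfolding bern_exp_def Pow_insert using assms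
    by (subst sum.union_disjoint) auto
  also have "(\<Sum>E\<in>insert e ` Pow F. ?w (insert e F) E *\<^sub>R f E)
      = (\<Sum>E\<in>Pow F. ?w (insert e F) (insert e E) *\<^sub>R f (insert e E))"
    by (simp add: sum.reindex[OF inj])
  also have "\<dots> = p *\<^sub>R bern_exp p F (\<lambda>E. f (insert e E))"
    unfolding bern_exp_def scaleR_sum_right by (intro sum.cong refl, subst w1) auto
  also have "(\<Sum>E\<in>Pow F. ?w (insert e F) E *\<^sub>R f E) = (1 - p) *\<^sub>R bern_exp p F f"
    unfolding bern_exp_def scaleR_sum_right by (intro sum.cong refl, subst w0) auto
  finally show ?thesis by simp
qed

lemma bern_exp_cong:
  "(\<And>E. E \<subseteq> F \<Longrightarrow> f E = g E) \<Longrightarrow> bern_exp p F f = bern_exp p F g"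
  by (auto simp: bern_exp_def intro!: sum.cong)

lemma bern_exp_add: "bern_exp p F (\<lambda>E. f E + g E) = bern_exp p F f + bern_exp p F g"
  by (simp add: bern_exp_def scaleR_add_right sum.distrib)

lemma bern_exp_diff: "bern_exp p F (\<lambda>E. f E - g E) = bern_exp p F f - bern_exp p F g"
  by (simp add: bern_exp_def scaleR_diff_right sum_subtractf)

lemma bern_exp_minus: "bern_exp p F (\<lambda>E. - f E) = - bern_exp p F f"
  by (simp add: bern_exp_def sum_negf)

lemma bern_exp_linear:
  assumes "linear h"
  shows "bern_exp p F (\<lambda>E. h (f E)) = h (bern_exp p F f)"
proof -
  interpret linear h by fact
  show ?thesis by (simp add: bern_exp_def sum scaleR)
qed

lemma bern_exp_mult_left:
  fixes c :: "'a::real_algebra"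
  shows "bern_exp p F (\<lambda>E. c * f E) = c * bern_exp p F f"
  by (simp add: bern_exp_def sum_distrib_left)

lemma bern_exp_mult_right:
  fixes c :: "'a::real_algebra"
  shows "bern_exp p F (\<lambda>E. f E * c) = bern_exp p F f * c"
  by (simp add: bern_exp_def sum_distrib_right)

lemma bern_exp_sum: "bern_exp p F (\<lambda>E. \<Sum>i\<in>I. f i E) = (\<Sum>i\<in>I. bern_exp p F (f i))"
  unfolding bern_exp_def scaleR_sum_right by (rule sum.swap)

text \<open>This is independence of the edges; it later factorizes the characteristic function of a
  degree.\<close>

lemma bern_exp_prod:
  fixes g :: "'e \<Rightarrow> bool \<Rightarrow> 'a::{real_algebra_1,comm_ring_1}"
  assumes "finite F"
  shows "bern_exp p F (\<lambda>E. \<Prod>e\<in>F. g e (e \<in> E))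
    = (\<Prod>e\<in>F. p *\<^sub>R g e True + (1 - p) *\<^sub>R g e False)"
  using assms
proof (induction F rule: finite_induct)
  case (insert e F)
  have 1: "bern_exp p F (\<lambda>E. \<Prod>x\<in>insert e F. g x (x \<in> insert e E))
      = bern_exp p F (\<lambda>E. g e True * (\<Prod>x\<in>F. g x (x \<in> E)))"
    using insert.hyps
    by (intro bern_exp_cong) (auto intro!: arg_cong2[where f="(*)"] prod.cong arg_cong2[where f=g])
  have 2: "bern_exp p F (\<lambda>E. \<Prod>x\<in>insert e F. g x (x \<in> E))
      = bern_exp p F (\<lambda>E. g e False * (\<Prod>x\<in>F. g x (x \<in> E)))"
    using insert.hyps
    by (intro bern_exp_cong) (auto intro!: arg_cong2[where f="(*)"] arg_cong2[where f=g])
  show ?case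
    unfolding bern_exp_insert[OF insert.hyps] 1 2 bern_exp_mult_left insert.IH
    using insert.hyps by (simp add: algebra_simps)
qed simp

lemma bern_exp_const: "finite F \<Longrightarrow> bern_exp p F (\<lambda>_. c) = c"
  by (induction F rule: finite_induct) (auto simp: bern_exp_insert simp flip: scaleR_left_distrib)

context
  fixes p :: real
  assumes p: "0 \<le> p" "p \<le> 1"
begin

lemma bern_exp_mono:
  fixes f g :: "'e set \<Rightarrow> real"
  assumes "\<And>E. E \<subseteq> F \<Longrightarrow> f E \<le> g E"
  shows "bern_exp p F f \<le> bern_exp p F g"
  unfolding bern_exp_def using p assms
  by (auto intro!: sum_mono mult_left_mono prod_nonneg)

lemma norm_bern_exp_le:
  fixes f :: "'e set \<Rightarrow> 'a::real_normed_vector"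
  shows "norm (bern_exp p F f) \<le> bern_exp p F (\<lambda>E. norm (f E))"
  unfolding bern_exp_def
proof (rule order_trans[OF norm_sum], rule sum_mono)
  fix E assume "E \<in> Pow F"
  have "0 \<le> (\<Prod>e\<in>F. if e \<in> E then p else 1 - p)" using p by (auto intro!: prod_nonneg)
  then show "norm ((\<Prod>e\<in>F. if e \<in> E then p else 1 - p) *\<^sub>R f E)
      \<le> (\<Prod>e\<in>F. if e \<in> E then p else 1 - p) *\<^sub>R norm (f E)"
    by simp
qed

end

text \<open>For a two-valued variable, Stein's integration by parts is exact, with the difference
  quotient in place of the derivative.\<close>

lemma bern_exp_by_parts:
  assumes "finite F" "e \<in> F"
  shows "bern_exp p F (\<lambda>E. (of_bool (e \<in> E) - p) *\<^sub>R f E)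
    = (p * (1 - p)) *\<^sub>R bern_exp p F (\<lambda>E. f (insert e E) - f (E - {e}))"
proof -
  define F' where "F' = F - {e}"
  have F: "F = insert e F'" "finite F'" "e \<notin> F'" using assms by (auto simp: F'_def)
  have a: "bern_exp p F' (\<lambda>E. (of_bool (e \<in> insert e E) - p) *\<^sub>R f (insert e E))
      = (1 - p) *\<^sub>R bern_exp p F' (\<lambda>E. f (insert e E))"
    by (simp add: bern_exp_def scaleR_sum_right mult.commute)
  have b: "bern_exp p F' (\<lambda>E. (of_bool (e \<in> E) - p) *\<^sub>R f E)
      = bern_exp p F' (\<lambda>E. - p *\<^sub>R f E)"
    using F by (intro bern_exp_cong) auto
  have b': "\<dots> = - p *\<^sub>R bern_exp p F' f"
    by (simp add: bern_exp_def scaleR_sum_right mult.commute sum_negf)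
  have c: "bern_exp p F' (\<lambda>E. f (insert e E) - f (E - {e}))
      = bern_exp p F' (\<lambda>E. f (insert e E)) - bern_exp p F' f"
    unfolding bern_exp_diff[symmetric] using F
    by (intro bern_exp_cong) (metis Diff_empty Diff_insert0 subset_iff)
  have d: "bern_exp p F' (\<lambda>E. f (insert e (insert e E)) - f (insert e E - {e}))
      = bern_exp p F' (\<lambda>E. f (insert e E)) - bern_exp p F' f"
    unfolding bern_exp_diff[symmetric] using F
    by (intro bern_exp_cong) (metis Diff_insert_absorb insert_absorb2 subset_iff)
  show ?thesis
    unfolding F(1) bern_exp_insert[OF F(2,3)] a b b' c d
    by (simp add: algebra_simps)
qed

section \<open>Exponential concentration by bounded differences\<close>

lemma exp_le_add_exp_square: "exp x \<le> x + exp (x\<^sup>2)" for x :: real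
proof (cases "x \<ge> 0 \<and> x \<le> 1")
  case True
  then show ?thesis
    using exp_bound[of x] exp_ge_add_one_self[of "x\<^sup>2"] by linarith
next
  case False
  show ?thesis
  proof (cases "x > 1")
    case True
    then have "x \<le> x\<^sup>2" by (simp add: power2_eq_square)
    then have "exp x \<le> exp (x\<^sup>2)" by simp
    with True show ?thesis by linarith
  next
    case False
    with \<open>\<not> (0 \<le> x \<and> x \<le> 1)\<close> have x: "x < 0" by auto
    have "1 + x\<^sup>2 \<le> exp (x\<^sup>2)" by simp
    moreover have "exp x \<le> 1 + x + x\<^sup>2"
    proof (cases "x \<le> -1")
      case True
      then have "0 \<le> x + x\<^sup>2" using x by (simp add: power2_eq_square, sos)
      moreover have "exp x \<le> 1" using x by simp
      ultimately show ?thesis by linarith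
    next
      case False
      define y where "y = -x"
      have y: "0 < y" "y < 1" using False x by (auto simp: y_def)
      \<comment> \<open>The product equals \<open>1 + y^3\<close>. Combined with
        \<open>1 + y <= exp y\<close> it bounds \<open>exp (- y)\<close> from above.\<close>
      have "1 \<le> (1 - y + y\<^sup>2) * (1 + y)" using y by (simp add: power2_eq_square algebra_simps)
      also have "\<dots> \<le> (1 - y + y\<^sup>2) * exp y"
        using y by (intro mult_left_mono) (auto simp: power2_eq_square algebra_simps, sos?)
      finally have "exp (-y) \<le> 1 - y + y\<^sup>2" by (simp add: exp_minus field_simps)
      then show ?thesis by (simp add: y_def)
    qed
    ultimately show ?thesis by linarith
  qed
qed

text \<open>Induction on the edges: averaging over \<open>e\<close> yields \<open>g\<close>, which
  keeps the difference bound \<open>c\<close>, and given the other edges the fluctuation of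
  \<open>f\<close> around \<open>g\<close> is a centered two-valued variable bounded by
  \<open>c\<close>. For such a variable \<open>exp x <= x + exp (x^2)\<close> is enough, because the
  linear part averages out. Each edge contributes a factor \<open>exp (l^2 c^2)\<close>.\<close>

lemma bern_exp_exp_le:
  fixes f :: "'e set \<Rightarrow> real"
  assumes p: "0 \<le> p" "p \<le> 1" and "finite F"
    and "\<And>e E. e \<in> F \<Longrightarrow> E \<subseteq> F \<Longrightarrow> e \<notin> E \<Longrightarrow> \<bar>f (insert e E) - f E\<bar> \<le> c"
  shows "bern_exp p F (\<lambda>E. exp (l * (f E - bern_exp p F f))) \<le> exp (l\<^sup>2 * (real (card F) * c\<^sup>2))"
  using assms(3,4)
proof (induction F arbitrary: f rule: finite_induct)
  case (insert e F)
  define g where "g E = p * f (insert e E) + (1 - p) * f E" for E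
  define m where "m = bern_exp p F g"
  have m: "bern_exp p (insert e F) f = m"
    unfolding m_def g_def bern_exp_insert[OF insert.hyps] bern_exp_add bern_exp_mult_left by simp
  have g_diff: "\<bar>g (insert x E) - g E\<bar> \<le> c" if "x \<in> F" "E \<subseteq> F" "x \<notin> E" for x E
  proof -
    have 1: "\<bar>f (insert x (insert e E)) - f (insert e E)\<bar> \<le> c"
      using that insert.hyps by (intro insert.prems) auto
    have 2: "\<bar>f (insert x E) - f E\<bar> \<le> c" using that by (intro insert.prems) auto
    have "g (insert x E) - g E = p * (f (insert x (insert e E)) - f (insert e E))
        + (1 - p) * (f (insert x E) - f E)"
      by (simp add: g_def algebra_simps insert_commute)
    also have "\<bar>\<dots>\<bar> \<le> p * c + (1 - p) * c"
      using p 1 2 by (intro order_trans[OF abs_triangle_ineq] add_mono) (auto simp: abs_mult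
          intro!: mult_left_mono)
    finally show ?thesis by (simp add: algebra_simps)
  qed
  have c: "0 \<le> c" using insert.prems[of e "{}"] insert.hyps by fastforce
  have step: "p * exp (l * (f (insert e E) - m)) + (1 - p) * exp (l * (f E - m))
      \<le> exp (l\<^sup>2 * c\<^sup>2) * exp (l * (g E - m))" if "E \<subseteq> F" for E
  proof -
    define a where "a = l * (f (insert e E) - g E)"
    define b where "b = l * (f E - g E)"
    have d: "\<bar>f (insert e E) - f E\<bar> \<le> c" using that insert.hyps by (intro insert.prems) auto
    have a': "a = l * ((1 - p) * (f (insert e E) - f E))" and b': "b
        = l * (- p * (f (insert e E) - f E))"
      by (simp_all add: a_def b_def g_def algebra_simps)
    have sq: "(l * (q * (f (insert e E) - f E)))\<^sup>2 \<le> l\<^sup>2 * c\<^sup>2" if "\<bar>q\<bar> \<le> 1" for q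
    proof -
      have "\<bar>q * (f (insert e E) - f E)\<bar> \<le> 1 * c"
        unfolding abs_mult using that d c by (intro mult_mono) auto
      then have "(q * (f (insert e E) - f E))\<^sup>2 \<le> c\<^sup>2" using c
          by (simp add: abs_le_square_iff[symmetric])
      then show ?thesis by (simp add: power_mult_distrib mult_left_mono)
    qed
    have ea: "exp a \<le> a + exp (l\<^sup>2 * c\<^sup>2)"
      using exp_le_add_exp_square[of a] sq[of "1 - p"] p unfolding a'
          by (smt (verit) exp_le_cancel_iff)
    have eb: "exp b \<le> b + exp (l\<^sup>2 * c\<^sup>2)"
      using exp_le_add_exp_square[of b] sq[of "- p"] p unfolding b'
          by (smt (verit) exp_le_cancel_iff)
    have "p * exp a + (1 - p) * exp b \<le> p * (a + exp (l\<^sup>2 * c\<^sup>2)) + (1 - p) * (b + exp (l\<^sup>2 * c\<^sup>2))"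
      using p ea eb by (intro add_mono mult_left_mono) auto
    \<comment> \<open>The linear terms cancel: \<open>p * a + (1 - p) * b = 0\<close>.\<close>
    also have "\<dots> = exp (l\<^sup>2 * c\<^sup>2)" by (simp add: a' b' algebra_simps)
    finally have "(p * exp a + (1 - p) * exp b) * exp (l * (g E - m))
        \<le> exp (l\<^sup>2 * c\<^sup>2) * exp (l * (g E - m))"
      by simp
    then show ?thesis by (simp add: a_def b_def algebra_simps flip: exp_add)
  qed
  have "bern_exp p (insert e F) (\<lambda>E. exp (l * (f E - m)))
    = bern_exp p F (\<lambda>E. p * exp (l * (f (insert e E) - m)) + (1 - p) * exp (l * (f E - m)))"
    unfolding bern_exp_insert[OF insert.hyps] bern_exp_add bern_exp_mult_left by simp
  also have "\<dots> \<le> bern_exp p F (\<lambda>E. exp (l\<^sup>2 * c\<^sup>2) * exp (l * (g E - m)))"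
    using p step by (intro bern_exp_mono)
  also have "\<dots> \<le> exp (l\<^sup>2 * c\<^sup>2) * exp (l\<^sup>2 * (real (card F) * c\<^sup>2))"
    unfolding bern_exp_mult_left m_def by (intro mult_left_mono insert.IH g_diff) auto
  also have "\<dots> = exp (l\<^sup>2 * (real (card (insert e F)) * c\<^sup>2))"
    using insert.hyps by (simp add: algebra_simps flip: exp_add)
  finally show ?case unfolding m .
qed simp

lemma bern_exp_exp_abs_le:
  fixes f :: "'e set \<Rightarrow> real"
  assumes p: "0 \<le> p" "p \<le> 1" and "finite F"
    and diff: "\<And>e E. e \<in> F \<Longrightarrow> E \<subseteq> F \<Longrightarrow> e \<notin> E \<Longrightarrow> \<bar>f (insert e E) - f E\<bar> \<le> c"
  shows "bern_exp p F (\<lambda>E. exp (l * \<bar>f E - bern_exp p F f\<bar>))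
      \<le> 2 * exp (l\<^sup>2 * (real (card F) * c\<^sup>2))"
proof -
  define m where "m = bern_exp p F f"
  have "bern_exp p F (\<lambda>E. exp (l * \<bar>f E - m\<bar>))
      \<le> bern_exp p F (\<lambda>E. exp (l * (f E - m)) + exp ((- l) * (f E - m)))"
    using p by (intro bern_exp_mono) (auto simp: abs_if algebra_simps)
  also have "\<dots> \<le> exp (l\<^sup>2 * (real (card F) * c\<^sup>2)) + exp ((- l)\<^sup>2 * (real (card F) * c\<^sup>2))"
    unfolding bern_exp_add m_def using assms by (intro add_mono bern_exp_exp_le) auto
  finally show ?thesis by (simp add: m_def)
qed

text \<open>From \<open>x <= exp x\<close>. The parameter \<open>l\<close> is left free; for the
  functions used later the exponent stays bounded with \<open>l = sqrt n\<close>, which gives a mean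
  deviation of order \<open>1 / sqrt n\<close>.\<close>

lemma bern_exp_abs_dev_le:
  fixes f :: "'e set \<Rightarrow> real"
  assumes p: "0 \<le> p" "p \<le> 1" and "finite F"
    and diff: "\<And>e E. e \<in> F \<Longrightarrow> E \<subseteq> F \<Longrightarrow> e \<notin> E \<Longrightarrow> \<bar>f (insert e E) - f E\<bar> \<le> c" and "l > 0"
  shows "bern_exp p F (\<lambda>E. \<bar>f E - bern_exp p F f\<bar>) \<le> 2 * exp (l\<^sup>2 * (real (card F) * c\<^sup>2)) / l"
proof -
  have "l * bern_exp p F (\<lambda>E. \<bar>f E - bern_exp p F f\<bar>)
      = bern_exp p F (\<lambda>E. l * \<bar>f E - bern_exp p F f\<bar>)"
    by (rule bern_exp_mult_left[symmetric])
  also have "\<dots> \<le> bern_exp p F (\<lambda>E. exp (l * \<bar>f E - bern_exp p F f\<bar>))"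
  proof (rule bern_exp_mono[OF p])
    show "l * \<bar>f E - bern_exp p F f\<bar> \<le> exp (l * \<bar>f E - bern_exp p F f\<bar>)" for E
      using exp_ge_add_one_self[of "l * \<bar>f E - bern_exp p F f\<bar>"] by linarith
  qed
  also have "\<dots> \<le> 2 * exp (l\<^sup>2 * (real (card F) * c\<^sup>2))"
    using assms by (intro bern_exp_exp_abs_le) auto
  finally show ?thesis using \<open>l > 0\<close> by (simp add: field_simps)
qed

text \<open>Chernoff's bound. The choice \<open>l = sqrt n\<close> will give tails
  \<open>exp (- \<epsilon> * sqrt n)\<close>, which are summable.\<close>

lemma bern_exp_tail_le:
  fixes f :: "'e set \<Rightarrow> real"
  assumes p: "0 \<le> p" "p \<le> 1" and "finite F"
    and diff: "\<And>e E. e \<in> F \<Longrightarrow> E \<subseteq> F \<Longrightarrow> e \<notin> E \<Longrightarrow> \<bar>f (insert e E) - f E\<bar> \<le> c" and "l > 0"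
  shows "bern_exp p F (\<lambda>E. of_bool (\<epsilon> \<le> \<bar>f E - bern_exp p F f\<bar>))
    \<le> 2 * exp (l\<^sup>2 * (real (card F) * c\<^sup>2)) * exp (- (l * \<epsilon>))"
proof -
  have "bern_exp p F (\<lambda>E. of_bool (\<epsilon> \<le> \<bar>f E - bern_exp p F f\<bar>))
      \<le> bern_exp p F (\<lambda>E. exp (l * \<bar>f E - bern_exp p F f\<bar>) * exp (- (l * \<epsilon>)))"
    using \<open>l > 0\<close> by (intro bern_exp_mono[OF p]) (auto simp flip: exp_add)
  also have "\<dots> \<le> 2 * exp (l\<^sup>2 * (real (card F) * c\<^sup>2)) * exp (- (l * \<epsilon>))"
    unfolding bern_exp_mult_right using assms by (intro mult_right_mono bern_exp_exp_abs_le) auto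
  finally show ?thesis .
qed

lemma bern_exp_set_integral:
  fixes f :: "'e set \<Rightarrow> real \<Rightarrow> 'a::{banach, second_countable_topology}"
  assumes "\<And>E. set_integrable M A (f E)"
  shows "bern_exp p F (\<lambda>E. (LINT x:A|M. f E x)) = (LINT x:A|M. bern_exp p F (\<lambda>E. f E x))"
proof -
  have i: "integrable M (\<lambda>x. indicator A x *\<^sub>R f E x)" for E using assms
      by (simp add: set_integrable_def)
  have "(LINT x:A|M. bern_exp p F (\<lambda>E. f E x))
      = (LINT x|M. (\<Sum>E\<in>Pow F. (\<Prod>e\<in>F. if e \<in> E then p else 1 - p) *\<^sub>R indicator A x *\<^sub>R f E x))"
    unfolding set_lebesgue_integral_def bern_exp_def scaleR_sum_right
    by (intro Bochner_Integration.integral_cong sum.cong refl) (simp add: mult.commute)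
  also have "\<dots> = (\<Sum>E\<in>Pow F. (LINT x|M. (\<Prod>e\<in>F.
      if e \<in> E then p else 1 - p) *\<^sub>R indicator A x *\<^sub>R f E x))"
    by (intro Bochner_Integration.integral_sum integrable_scaleR_right i)
  also have "\<dots> = bern_exp p F (\<lambda>E. (LINT x:A|M. f E x))"
    unfolding bern_exp_def set_lebesgue_integral_def by (simp only: integral_scaleR_right)
  finally show ?thesis by simp
qed

subsection \<open>Resolvents of real symmetric matrices\<close>

text \<open>The matrix \<open>(z - A)^-1\<close> in index form, with both one-sided equations:
  \<open>(z - A) R = 1\<close> controls columns, \<open>R (z - A) = 1\<close> controls rows, and the
  resolvent identity takes one of each. Values at indices from \<open>n\<close> on are
  arbitrary.\<close>

definition is_resolvent :: "nat \<Rightarrow> (nat \<Rightarrow> nat \<Rightarrow> real) \<Rightarrow> complex \<Rightarrow> (nat \<Rightarrow> nat \<Rightarrow> complex) \<Rightarrow> bool"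
  where "is_resolvent n A z R \<longleftrightarrow>
    (\<forall>i<n. \<forall>j<n. z * R i j - (\<Sum>k<n. of_real (A i k) * R k j) = of_bool (i = j)) \<and>
    (\<forall>i<n. \<forall>j<n. z * R i j - (\<Sum>k<n. R i k * of_real (A k j)) = of_bool (i = j))"

text \<open>A real symmetric form takes real values on complex vectors, so only \<open>z\<close>
  contributes an imaginary part.\<close>

lemma Im_symmetric_form:
  fixes A :: "nat \<Rightarrow> nat \<Rightarrow> real" and g :: "nat \<Rightarrow> complex"
  assumes "\<And>i j. i < n \<Longrightarrow> j < n \<Longrightarrow> A i j = A j i"
  shows "Im (\<Sum>j<n. cnj (g j) * (z * g j - (\<Sum>k<n. of_real (A j k) * g k)))
    = Im z * (\<Sum>j<n. (cmod (g j))\<^sup>2)"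
proof -
  define q where "q = (\<Sum>j<n. \<Sum>k<n. cnj (g j) * (of_real (A j k) * g k))"
  have "cnj q = (\<Sum>j<n. \<Sum>k<n. cnj (g k) * (of_real (A j k) * g j))"
    by (simp add: q_def mult_ac)
  also have "\<dots> = (\<Sum>j<n. \<Sum>k<n. cnj (g j) * (of_real (A k j) * g k))"
    by (rule sum.swap)
  also have "\<dots> = q"
    unfolding q_def by (intro sum.cong refl) (use assms in auto)
  finally have q: "Im q = 0" by (simp add: complex_eq_iff)
  have "(\<Sum>j<n. cnj (g j) * (z * g j - (\<Sum>k<n. of_real (A j k) * g k)))
      = z * (\<Sum>j<n. cnj (g j) * g j) - q"
    by (simp add: q_def algebra_simps sum_subtractf sum_distrib_left)
  also have "(\<Sum>j<n. cnj (g j) * g j) = of_real (\<Sum>j<n. (cmod (g j))\<^sup>2)"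
    by (simp add: complex_norm_square mult.commute del: of_real_power)
  finally show ?thesis using q by simp
qed

text \<open>Serves twice: \<open>z - A\<close> is invertible off the real axis, and every eigenvalue
  of a real symmetric matrix is real.\<close>

lemma symmetric_form_kernel:
  fixes A :: "nat \<Rightarrow> nat \<Rightarrow> real" and g :: "nat \<Rightarrow> complex"
  assumes sym: "\<And>i j. i < n \<Longrightarrow> j < n \<Longrightarrow> A i j = A j i" and z: "Im z \<noteq> 0"
    and g: "\<And>j. j < n \<Longrightarrow> z * g j - (\<Sum>k<n. of_real (A j k) * g k) = 0" and "j < n"
  shows "g j = 0"
proof -
  have "Im (\<Sum>j<n. cnj (g j) * (z * g j - (\<Sum>k<n. of_real (A j k) * g k)))
      = Im z * (\<Sum>j<n. (cmod (g j))\<^sup>2)"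
    by (rule Im_symmetric_form) (rule sym)
  moreover have "(\<Sum>j<n. cnj (g j) * (z * g j - (\<Sum>k<n. of_real (A j k) * g k))) = 0"
    using g by (intro sum.neutral) auto
  ultimately have "(\<Sum>j<n. (cmod (g j))\<^sup>2) = 0" using z by simp
  then show ?thesis using assms(4) by (simp add: sum_nonneg_eq_0_iff)
qed

context
  fixes n :: nat and A :: "nat \<Rightarrow> nat \<Rightarrow> real"
  assumes sym: "\<And>i j. i < n \<Longrightarrow> j < n \<Longrightarrow> A i j = A j i"
begin

text \<open>Here \<open>g\<close> is a column of the resolvent, \<open>(z - A) g = e_i\<close>;
  pairing this equation with \<open>g\<close> leaves only the entry
  \<open>cnj (g i)\<close>.\<close>

lemma ward_identity:
  assumes "i < n" and "\<And>j. j < n \<Longrightarrow> z * g j - (\<Sum>k<n. of_real (A j k) * g k) = of_bool (i = j)"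
  shows "Im z * (\<Sum>j<n. (cmod (g j))\<^sup>2) = - Im (g i)"
proof -
  have "(\<Sum>j<n. cnj (g j) * (z * g j - (\<Sum>k<n. of_real (A j k) * g k)))
      = (\<Sum>j<n. if j = i then cnj (g j) else 0)"
    by (intro sum.cong) (auto simp: assms(2))
  also have "\<dots> = cnj (g i)" using assms(1) by (subst sum.delta) auto
  finally have "(\<Sum>j<n. cnj (g j) * (z * g j - (\<Sum>k<n. of_real (A j k) * g k))) = cnj (g i)" .
  moreover have "Im (\<Sum>j<n. cnj (g j) * (z * g j - (\<Sum>k<n. of_real (A j k) * g k)))
    = Im z * (\<Sum>j<n. (cmod (g j))\<^sup>2)"
    by (rule Im_symmetric_form) (rule sym)
  ultimately show ?thesis by (metis cnj.sel(2))
qed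

text \<open>The Ward identity is used against itself: \<open>Im z * |g|^2 <= |g_i|\<close> and
  \<open>|g_i| <= |g|\<close> give \<open>|g_i| <= 1 / Im z\<close>, and inserting this back bounds
  the whole column.\<close>

lemma resolvent_vector_bounds:
  assumes "i < n" and "\<And>j. j < n \<Longrightarrow> z * g j - (\<Sum>k<n. of_real (A j k) * g k) = of_bool (i = j)"
    and z: "Im z > 0"
  shows "(\<Sum>j<n. (cmod (g j))\<^sup>2) \<le> 1 / (Im z)\<^sup>2" and "\<And>k. k < n \<Longrightarrow> cmod (g k) \<le> 1 / Im z"
    and "Im (g i) \<le> 0"
proof -
  let ?s = "\<Sum>j<n. (cmod (g j))\<^sup>2"
  have w: "Im z * ?s = - Im (g i)" by (rule ward_identity) fact+
  have le: "(cmod (g k))\<^sup>2 \<le> ?s" if "k < n" for k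
    using that by (intro member_le_sum) auto
  have "Im z * ?s \<le> cmod (g i)" using w abs_Im_le_cmod[of "g i"] by linarith
  then have 1: "Im z * (cmod (g i))\<^sup>2 \<le> cmod (g i)"
    using mult_left_mono[OF le[OF assms(1)], of "Im z"] z by linarith
  have gi: "cmod (g i) \<le> 1 / Im z"
  proof (cases "g i = 0")
    case False
    then have "Im z * cmod (g i) \<le> 1" using 1 by (simp add: power2_eq_square)
    then show ?thesis using z by (simp add: field_simps)
  qed (use z in auto)
  have "?s \<le> (1 / Im z) * cmod (g i)"
    using \<open>Im z * ?s \<le> cmod (g i)\<close> z by (simp add: field_simps)
  also have "\<dots> \<le> (1 / Im z) * (1 / Im z)" using z gi by (intro mult_left_mono) auto
  finally show s: "?s \<le> 1 / (Im z)\<^sup>2" by (simp add: power2_eq_square)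
  show "cmod (g k) \<le> 1 / Im z" if "k < n" for k
  proof -
    have "(cmod (g k))\<^sup>2 \<le> (1 / Im z)\<^sup>2" using le[OF that] s by (simp add: power_divide)
    then show ?thesis by (rule power2_le_imp_le) (use z in simp)
  qed
  have "0 \<le> Im z * ?s" using z by (intro mult_nonneg_nonneg sum_nonneg) auto
  then show "Im (g i) \<le> 0" using w by linarith
qed

lemma
  assumes R: "is_resolvent n A z R" and z: "Im z > 0" and i: "i < n"
  shows resolvent_col_sq: "(\<Sum>k<n. (cmod (R k i))\<^sup>2) \<le> 1 / (Im z)\<^sup>2"
    and resolvent_row_sq: "(\<Sum>k<n. (cmod (R i k))\<^sup>2) \<le> 1 / (Im z)\<^sup>2"
    and resolvent_entry: "\<And>k. k < n \<Longrightarrow> cmod (R k i) \<le> 1 / Im z"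
    and resolvent_diag_Im: "Im (R i i) \<le> 0"
proof -
  have c: "z * R j i - (\<Sum>k<n. of_real (A j k) * R k i) = of_bool (i = j)" if "j < n" for j
    using R i that unfolding is_resolvent_def by auto
  have "z * R i j - (\<Sum>k<n. of_real (A j k) * R i k) = of_bool (i = j)" if "j < n" for j
  proof -
    have "(\<Sum>k<n. of_real (A j k) * R i k) = (\<Sum>k<n. R i k * of_real (A k j))"
      by (intro sum.cong refl) (use sym that in auto)
    then show ?thesis using R i that unfolding is_resolvent_def by auto
  qed
  from resolvent_vector_bounds(1)[OF i this z]
  show "(\<Sum>k<n. (cmod (R i k))\<^sup>2) \<le> 1 / (Im z)\<^sup>2" by simp
  from resolvent_vector_bounds[where g="\<lambda>j. R j i", OF i c z]
  show "(\<Sum>k<n. (cmod (R k i))\<^sup>2) \<le> 1 / (Im z)\<^sup>2" "\<And>k. k < n \<Longrightarrow> cmod (R k i) \<le> 1 / Im z"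
    "Im (R i i) \<le> 0" by auto
qed

lemma ex_resolvent:
  assumes z: "Im z \<noteq> 0"
  shows "\<exists>R. is_resolvent n A z R"
proof -
  define Z where "Z = mat n n (\<lambda>(i,j). z * of_bool (i = j) - complex_of_real (A i j))"
  have Z: "Z \<in> carrier_mat n n" by (simp add: Z_def)
  have "det Z \<noteq> 0"
  proof
    assume "det Z = 0"
    then obtain v where v: "v \<in> carrier_vec n" "v \<noteq> 0\<^sub>v n" "Z *\<^sub>v v = 0\<^sub>v n"
      using det_0_iff_vec_prod_zero[OF Z] by auto
    have 0: "z * v $ j - (\<Sum>k<n. of_real (A j k) * v $ k) = 0" if "j < n" for j
    proof -
      have "0 = (Z *\<^sub>v v) $ j" using v that by simp
      also have "\<dots> = (\<Sum>k<n. (z * of_bool (j = k) - of_real (A j k)) * v $ k)"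
        using that v(1) Z by (simp add: scalar_prod_def Z_def atLeast0LessThan)
      also have "\<dots> = (\<Sum>k<n. (if j = k then z * v $ k else 0) - of_real (A j k) * v $ k)"
        by (intro sum.cong) (auto simp: algebra_simps)
      also have "\<dots> = z * v $ j - (\<Sum>k<n. of_real (A j k) * v $ k)"
        using that by (simp add: sum_subtractf)
      finally show ?thesis by simp
    qed
    have "v $ j = 0" if "j < n" for j
      by (rule symmetric_form_kernel[OF _ z 0 that]) (simp_all add: sym)
    then show False using v by (auto simp: vec_eq_iff)
  qed
  then obtain B where "B \<in> carrier_mat n n" and BZ: "B * Z = 1\<^sub>m n" "Z * B = 1\<^sub>m n"
    using det_non_zero_imp_unit[OF Z] unfolding Units_def ring_mat_def by auto
  have "z * B $$ (i,j) - (\<Sum>k<n. of_real (A i k) * B $$ (k,j)) = of_bool (i = j)"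
    if "i < n" "j < n" for i j
  proof -
    have "of_bool (i = j) = (Z * B) $$ (i,j)" using that BZ by simp
    also have "\<dots> = (\<Sum>k<n. (z * of_bool (i = k) - of_real (A i k)) * B $$ (k,j))"
      using that Z \<open>B \<in> _\<close> by (simp add: scalar_prod_def Z_def atLeast0LessThan)
    also have "\<dots> = (\<Sum>k<n. (if i = k then z * B $$ (k,j) else 0) - of_real (A i k) * B $$ (k,j))"
      by (intro sum.cong) (auto simp: algebra_simps)
    also have "\<dots> = z * B $$ (i,j) - (\<Sum>k<n. of_real (A i k) * B $$ (k,j))"
      using that by (simp add: sum_subtractf)
    finally show ?thesis by simp
  qed
  moreover have "z * B $$ (i,j) - (\<Sum>k<n. B $$ (i,k) * of_real (A k j)) = of_bool (i = j)"
    if "i < n" "j < n" for i j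
  proof -
    have "of_bool (i = j) = (B * Z) $$ (i,j)" using that BZ by simp
    also have "\<dots> = (\<Sum>k<n. B $$ (i,k) * (z * of_bool (k = j) - of_real (A k j)))"
      using that Z \<open>B \<in> _\<close> by (simp add: scalar_prod_def Z_def atLeast0LessThan)
    also have "\<dots> = (\<Sum>k<n. (if k = j then z * B $$ (i,k) else 0) - B $$ (i,k) * of_real (A k j))"
      by (intro sum.cong) (auto simp: algebra_simps)
    also have "\<dots> = z * B $$ (i,j) - (\<Sum>k<n. B $$ (i,k) * of_real (A k j))"
      using that by (simp add: sum_subtractf)
    finally show ?thesis by simp
  qed
  ultimately show ?thesis
    unfolding is_resolvent_def by (intro exI[of _ "\<lambda>i j. B $$ (i,j)"]) auto
qed

end

text \<open>Expand \<open>R' = (R (z - A)) R'\<close> and \<open>R = R ((z' - A') R')\<close>, then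
  subtract.\<close>

lemma resolvent_identity:
  assumes R: "is_resolvent n A z R" and R': "is_resolvent n A' z' R'" and kl: "k < n" "l < n"
  shows "R' k l - R k l
    = (\<Sum>i<n. \<Sum>j<n. R k i * of_real (A' i j - A i j) * R' j l) + (z - z') * (\<Sum>i<n. R k i * R' i l)"
proof -
  have 1: "R' k l = (\<Sum>i<n. (z * R k i - (\<Sum>j<n. R k j * of_real (A j i))) * R' i l)"
  proof -
    have "(\<Sum>i<n. (z * R k i - (\<Sum>j<n. R k j * of_real (A j i))) * R' i l)
        = (\<Sum>i<n. if k = i then R' i l else 0)"
      using R kl by (intro sum.cong) (auto simp: is_resolvent_def)
    then show ?thesis using kl by simp
  qed
  have 2: "R k l = (\<Sum>i<n. R k i * (z' * R' i l - (\<Sum>j<n. of_real (A' i j) * R' j l)))"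
  proof -
    have "(\<Sum>i<n. R k i * (z' * R' i l - (\<Sum>j<n. of_real (A' i j) * R' j l)))
        = (\<Sum>i<n. if i = l then R k i else 0)"
      using R' kl by (intro sum.cong) (auto simp: is_resolvent_def)
    then show ?thesis using kl by simp
  qed
  have 3: "(\<Sum>i<n. (\<Sum>j<n. R k j * of_real (A j i)) * R' i l)
      = (\<Sum>i<n. \<Sum>j<n. R k i * of_real (A i j) * R' j l)"
    unfolding sum_distrib_right by (rule sum.swap)
  have 4: "R' k l = z * (\<Sum>i<n. R k i * R' i l) - (\<Sum>i<n. \<Sum>j<n. R k i * of_real (A i j) * R' j l)"
    unfolding 3[symmetric] by (subst 1) (simp add: algebra_simps sum_subtractf sum_distrib_left)
  have 5: "R k l = z' * (\<Sum>i<n. R k i * R' i l) - (\<Sum>i<n. \<Sum>j<n. R k i * of_real (A' i j) * R' j l)"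
    by (subst 2) (simp add: algebra_simps sum_subtractf sum_distrib_left)
  show ?thesis
    by (subst 4, subst 5) (simp add: algebra_simps sum_subtractf)
qed

section \<open>Trace of the resolvent as a sum over eigenvalues\<close>

lemma upper_triangular_inverse_diag:
  fixes U V :: "'a::field mat"
  assumes U: "U \<in> carrier_mat n n" "upper_triangular U" and V: "V \<in> carrier_mat n n"
    and UV: "U * V = 1\<^sub>m n" and nz: "\<And>i. i < n \<Longrightarrow> U $$ (i,i) \<noteq> 0" and i: "i < n"
  shows "V $$ (i,i) = 1 / U $$ (i,i)"
proof -
  have entry: "(\<Sum>k<n. U $$ (i,k) * V $$ (k,j)) = of_bool (i = j)" if "i < n" "j < n" for i j
  proof -
    have "of_bool (i = j) = (U * V) $$ (i,j)" using that by (simp add: UV)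
    also have "\<dots> = (\<Sum>k<n. U $$ (i,k) * V $$ (k,j))"
      using that U V by (simp add: scalar_prod_def atLeast0LessThan)
    finally show ?thesis by simp
  qed
  have split: "U $$ (i,i) * V $$ (i,j) = of_bool (i = j)"
    if "i < n" "j < n" and above: "\<And>k. i < k \<Longrightarrow> k < n \<Longrightarrow> V $$ (k,j) = 0" for i j
  proof -
    have "(\<Sum>k<n. U $$ (i,k) * V $$ (k,j)) = (\<Sum>k<n. if k = i then U $$ (i,k) * V $$ (k,j) else 0)"
    proof (intro sum.cong refl)
      fix k assume "k \<in> {..<n}"
      then show "U $$ (i,k) * V $$ (k,j) = (if k = i then U $$ (i,k) * V $$ (k,j) else 0)"
        using above[of k] that U by (cases k i rule: linorder_cases) (auto simp:
            upper_triangular_def)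
    qed
    then show ?thesis using that entry[OF that(1,2)] by simp
  qed
  \<comment> \<open>The inverse is upper triangular too, by induction from the last row upwards:
    once the rows below are known to vanish in column \<open>j\<close>, \<open>split\<close>
    isolates the diagonal term.\<close>
  have low: "V $$ (i,j) = 0" if "j < i" "i < n" for i j
    using that
  proof (induction "n - i" arbitrary: i rule: less_induct)
    case less
    have "U $$ (i,i) * V $$ (i,j) = of_bool (i = j)"
      using less by (intro split) auto
    then show ?case using nz[of i] less.prems by auto
  qed
  have "U $$ (i,i) * V $$ (i,i) = 1" using split[of i i] i low by auto
  then show ?thesis using nz[OF i] by (simp add: field_simps)
qed

lemma proots_prod_linear: "proots (\<Prod>x\<leftarrow>xs. [:- x, 1 :: 'a::idom:]) = mset xs"
proof (induction xs)
  case (Cons x xs)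
  have "(\<Prod>x\<leftarrow>xs. [:- x, 1 :: 'a:]) \<noteq> 0" by (auto simp: prod_list_zero_iff)
  then have "proots ([:- x, 1:] * (\<Prod>x\<leftarrow>xs. [:- x, 1 :: 'a:])) = {#x#} + mset xs"
    by (subst proots_mult) (auto simp: Cons)
  then show ?case by simp
qed simp

lemma trace_similar:
  fixes P Q R :: "'a::comm_ring_1 mat"
  assumes "P \<in> carrier_mat n n" "Q \<in> carrier_mat n n" "R \<in> carrier_mat n n" "P * Q = 1\<^sub>m n"
  shows "(\<Sum>i<n. (Q * (R * P)) $$ (i,i)) = (\<Sum>i<n. R $$ (i,i))"
proof -
  have "(\<Sum>i<n. (Q * (R * P)) $$ (i,i)) = (\<Sum>i<n. \<Sum>k<n. Q $$ (i,k) * (R * P) $$ (k,i))"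
    using assms by (simp add: scalar_prod_def atLeast0LessThan)
  also have "\<dots> = (\<Sum>k<n. \<Sum>i<n. (R * P) $$ (k,i) * Q $$ (i,k))"
    by (subst sum.swap) (simp add: mult.commute)
  also have "\<dots> = (\<Sum>k<n. ((R * P) * Q) $$ (k,k))"
    using assms(1-3) by (simp add: scalar_prod_def atLeast0LessThan del: assoc_mult_mat)
  also have "(R * P) * Q = R" using assms by (simp add: assoc_mult_mat[of R n n P n Q n])
  finally show ?thesis .
qed

text \<open>Over the complex numbers the characteristic polynomial splits; its roots are real, so
  the factorization descends to the real polynomial. The trace is read off in a Schur basis, where
  \<open>z - A\<close> is upper triangular and its inverse has the reciprocals of the diagonal
  entries on the diagonal.\<close>

lemma symmetric_mat_spectrum:
  fixes A :: "real mat"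
  assumes A: "A \<in> carrier_mat n n" and sym: "\<And>i j. i < n \<Longrightarrow> j < n \<Longrightarrow> A $$ (i,j) = A $$ (j,i)"
  shows "\<exists>xs. length xs = n \<and> proots (char_poly A) = mset xs \<and>
    (\<forall>z R. Im z > 0 \<longrightarrow> is_resolvent n (\<lambda>i j. A $$ (i,j)) z R \<longrightarrow>
       (\<Sum>i<n. R i i) = (\<Sum>x\<leftarrow>xs. 1 / (z - of_real x)))"
proof -
  define C where "C = map_mat complex_of_real A"
  have C: "C \<in> carrier_mat n n" using A by (simp add: C_def)
  obtain es where es: "char_poly C = (\<Prod>e\<leftarrow>es. [:- e, 1:])" "length es = n"
    using char_poly_factorized[OF C] by auto
  have real: "Im e = 0" if "e \<in> set es" for e
  proof (rule ccontr)
    assume "Im e \<noteq> 0"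
    have "poly (char_poly C) e = 0"
      using that unfolding es(1) by (auto simp: poly_prod_list prod_list_zero_iff)
    then obtain v where v: "v \<in> carrier_vec n" "v \<noteq> 0\<^sub>v n" "C *\<^sub>v v = e \<cdot>\<^sub>v v"
      using eigenvalue_root_char_poly[OF C] C unfolding eigenvalue_def eigenvector_def by auto
    have 0: "e * v $ j - (\<Sum>k<n. of_real (A $$ (j,k)) * v $ k) = 0" if "j < n" for j
    proof -
      have "e * v $ j = (C *\<^sub>v v) $ j" using v that by simp
      also have "\<dots> = (\<Sum>k<n. of_real (A $$ (j,k)) * v $ k)"
        using that v(1) A by (simp add: scalar_prod_def C_def atLeast0LessThan)
      finally show ?thesis by simp
    qed
    have "v $ j = 0" if "j < n" for j
      by (rule symmetric_form_kernel[OF _ \<open>Im e \<noteq> 0\<close> 0 that]) (simp_all add: sym)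
    then show False using v by (auto simp: vec_eq_iff)
  qed
  define xs where "xs = map Re es"
  have es_xs: "es = map of_real xs"
    using real by (auto simp: xs_def complex_eq_iff intro!: nth_equalityI)
  have "map_poly complex_of_real (char_poly A) = map_poly complex_of_real (\<Prod>x\<leftarrow>xs. [:- x, 1:])"
  proof -
    have "map_poly complex_of_real (char_poly A) = char_poly C"
      unfolding C_def by (rule of_real_hom.char_poly_hom[OF A, symmetric])
    also have "\<dots> = map_poly complex_of_real (\<Prod>x\<leftarrow>xs. [:- x, 1:])"
    proof -
      interpret h: map_poly_comm_ring_hom complex_of_real ..
      have "(\<Prod>e\<leftarrow>map of_real xs. [:- e, 1:]) = map_poly complex_of_real (\<Prod>x\<leftarrow>xs. [:- x, 1:])" for xs
      proof (induction xs)
        case (Cons x xs)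
        have "map_poly complex_of_real ([:- x, 1:] * (\<Prod>x\<leftarrow>xs. [:- x, 1:]))
            = map_poly complex_of_real [:- x, 1:] * map_poly complex_of_real (\<Prod>x\<leftarrow>xs. [:- x, 1:])"
          by (rule h.hom_mult)
        then show ?case using Cons by (simp add: map_poly_pCons)
      qed simp
      then show ?thesis unfolding es(1) es_xs .
    qed
    finally show ?thesis .
  qed
  then have "coeff (map_poly complex_of_real (char_poly A)) k
      = coeff (map_poly complex_of_real (\<Prod>x\<leftarrow>xs. [:- x, 1:])) k" for k by simp
  then have "char_poly A = (\<Prod>x\<leftarrow>xs. [:- x, 1:])"
    by (intro poly_eqI) (simp add: coeff_map_poly)
  then have roots: "proots (char_poly A) = mset xs" by (simp add: proots_prod_linear)
  obtain B P Q where schur: "schur_decomposition C es = (B, P, Q)"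
    by (cases "schur_decomposition C es") auto
  have sim: "similar_mat_wit C B P Q" and B: "upper_triangular B" "diag_mat B = es"
    using schur_decomposition[OF C es(1) schur] by auto
  note wit = similar_mat_witD2[OF C sim]
  note carr = wit(4-7)
  have trace: "(\<Sum>i<n. R i i) = (\<Sum>x\<leftarrow>xs. 1 / (z - of_real x))"
    if z: "Im z > 0" and R: "is_resolvent n (\<lambda>i j. A $$ (i,j)) z R" for z R
  proof -
    define S where "S = mat n n (\<lambda>(i,j). R i j)"
    \<comment> \<open>\<open>U\<close> and \<open>V\<close> are \<open>z - C\<close> and its inverse
      \<open>S\<close>, written in the Schur basis.\<close>
    define U where "U = z \<cdot>\<^sub>m 1\<^sub>m n - B"
    define V where "V = Q * (S * P)"
    have S: "S \<in> carrier_mat n n" by (simp add: S_def)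
    have V: "V \<in> carrier_mat n n" using carr S by (auto simp: V_def)
    have U: "U \<in> carrier_mat n n" using carr by (auto simp: U_def)
    have zS: "(z \<cdot>\<^sub>m 1\<^sub>m n - C) * S = 1\<^sub>m n"
    proof (rule eq_matI)
      fix i j assume "i < dim_row (1\<^sub>m n :: complex mat)" "j < dim_col (1\<^sub>m n :: complex mat)"
      then have ij: "i < n" "j < n" by auto
      have "((z \<cdot>\<^sub>m 1\<^sub>m n - C) * S) $$ (i,j)
          = (\<Sum>k<n. ((if i = k then z else 0) - of_real (A $$ (i,k))) * R k j)"
        using ij A C S by (auto simp: scalar_prod_def S_def C_def atLeast0LessThan intro!: sum.cong)
      also have "\<dots> = (\<Sum>k<n. (if i = k then z * R k j else 0) - of_real (A $$ (i,k)) * R k j)"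
        by (intro sum.cong) (auto simp: algebra_simps)
      also have "\<dots> = z * R i j - (\<Sum>k<n. of_real (A $$ (i,k)) * R k j)"
        using ij by (simp add: sum_subtractf)
      also have "\<dots> = of_bool (i = j)" using R ij by (auto simp: is_resolvent_def)
      finally show "((z \<cdot>\<^sub>m 1\<^sub>m n - C) * S) $$ (i,j) = 1\<^sub>m n $$ (i,j)" using ij by simp
    qed (use C S in auto)
    have PU: "P * U = (z \<cdot>\<^sub>m 1\<^sub>m n - C) * P"
    proof -
      have "P * U = z \<cdot>\<^sub>m P - P * B"
        using carr by (simp add: U_def mult_minus_distrib_mat[of P n n _ n] mult_smult_distrib[of
            P n n _ n])
      also have "P * B = C * P"
      proof -
        have "C * P = P * B * (Q * P)"
          unfolding wit(3) by (rule assoc_mult_mat) (use wit in auto)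
        then show ?thesis using wit by simp
      qed
      also have "z \<cdot>\<^sub>m P - C * P = (z \<cdot>\<^sub>m 1\<^sub>m n - C) * P"
        using carr by (simp add: minus_mult_distrib_mat[of _ n n _ P n] mult_smult_assoc_mat[of _
            n n P n])
      finally show ?thesis .
    qed
    have "U = Q * ((z \<cdot>\<^sub>m 1\<^sub>m n - C) * P)"
    proof -
      have "Q * (P * U) = (Q * P) * U" by (rule assoc_mult_mat[OF wit(7,6) U, symmetric])
      then show ?thesis unfolding wit(2) left_mult_one_mat[OF U] PU by simp
    qed
    then have "U * V = Q * ((z \<cdot>\<^sub>m 1\<^sub>m n - C) * P) * (Q * (S * P))" by (simp add: V_def)
    also have "\<dots> = Q * (((z \<cdot>\<^sub>m 1\<^sub>m n - C) * (P * Q)) * (S * P))"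
    proof -
      have c: "z \<cdot>\<^sub>m 1\<^sub>m n - C \<in> carrier_mat n n" using C by auto
      note m = mult_carrier_mat
      show ?thesis
        unfolding assoc_mult_mat[OF wit(7) m[OF c wit(6)] m[OF wit(7) m[OF S wit(6)]]]
          assoc_mult_mat[OF c wit(6) m[OF wit(7) m[OF S wit(6)]]]
          assoc_mult_mat[OF c m[OF wit(6,7)] m[OF S wit(6)]]
          assoc_mult_mat[OF wit(6,7) m[OF S wit(6)]] ..
    qed
    also have "\<dots> = Q * (((z \<cdot>\<^sub>m 1\<^sub>m n - C) * S) * P)"
    proof -
      have c: "z \<cdot>\<^sub>m 1\<^sub>m n - C \<in> carrier_mat n n" using C by auto
      show ?thesis
        unfolding wit(1) right_mult_one_mat[OF c] assoc_mult_mat[OF c S wit(6)] ..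
    qed
    also have "\<dots> = 1\<^sub>m n" unfolding zS using wit by simp
    finally have UV: "U * V = 1\<^sub>m n" .
    have Bii: "B $$ (i,i) = of_real (xs ! i)" if "i < n" for i
    proof -
      have "B $$ (i,i) = diag_mat B ! i" using that wit(5) by (simp add: diag_mat_def)
      also have "\<dots> = of_real (xs ! i)" using that es(2) unfolding B(2) es_xs by simp
      finally show ?thesis .
    qed
    have Uii: "U $$ (i,i) = z - of_real (xs ! i)" if "i < n" for i
      using that carr Bii by (auto simp: U_def)
    have upper: "upper_triangular U"
      using B(1) carr unfolding upper_triangular_def U_def by auto
    have "(\<Sum>i<n. R i i) = (\<Sum>i<n. S $$ (i,i))" by (simp add: S_def)
    also have "\<dots> = (\<Sum>i<n. V $$ (i,i))"
      unfolding V_def using wit S by (intro trace_similar[symmetric]) auto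
    also have "\<dots> = (\<Sum>i<n. 1 / (z - of_real (xs ! i)))"
    proof (intro sum.cong refl)
      fix i assume "i \<in> {..<n}"
      moreover have "U $$ (j,j) \<noteq> 0" if "j < n" for j using Uii[OF that] z
          by (auto simp: complex_eq_iff)
      ultimately have "V $$ (i,i) = 1 / U $$ (i,i)"
        by (intro upper_triangular_inverse_diag[OF U upper V UV]) auto
      then show "V $$ (i,i) = 1 / (z - of_real (xs ! i))" using Uii \<open>i \<in> _\<close> by auto
    qed
    also have "\<dots> = (\<Sum>x\<leftarrow>xs. 1 / (z - of_real x))"
      using es unfolding es_xs by (simp add: sum_list_sum_nth atLeast0LessThan)
    finally show ?thesis .
  qed
  have "length xs = n" using es by (simp add: xs_def)
  with roots trace show ?thesis by blast
qed

subsection \<open>Resolvent of the centered Laplacian\<close>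

definition vedge :: "nat \<Rightarrow> nat \<Rightarrow> nat set" where
  "vedge i j = {Suc i, Suc j}"

definition centered_lap :: "real \<Rightarrow> real \<Rightarrow> nat \<Rightarrow> nat set set \<Rightarrow> nat \<Rightarrow> nat \<Rightarrow> real" where
  "centered_lap p t n E i j = t * (if i = j then \<Sum>k\<in>{..<n} - {i}. of_bool (vedge i k \<in> E) - p
                                   else p - of_bool (vedge i j \<in> E))"

lemma vedge_commute: "vedge i j = vedge j i"
  by (auto simp: vedge_def)

lemma vedge_eq_iff: "vedge i j = vedge a b \<longleftrightarrow> i = a \<and> j = b \<or> i = b \<and> j = a"
  by (auto simp: vedge_def doubleton_eq_iff)

lemma vedge_in_graph_edges: "a < n \<Longrightarrow> b < n \<Longrightarrow> a \<noteq> b \<Longrightarrow> vedge a b \<in> graph_edges n"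
  by (auto simp: vedge_def graph_edges_def)

lemma graph_edgesE:
  assumes "e \<in> graph_edges n"
  obtains a b where "a < n" "b < n" "a \<noteq> b" "e = vedge a b"
proof -
  obtain x y where xy: "e = {x, y}" "x \<noteq> y" using assms by (auto simp: graph_edges_def card_2_iff)
  with assms have "x \<in> {1..n}" "y \<in> {1..n}" by (auto simp: graph_edges_def)
  then show ?thesis using xy by (intro that[of "x - 1" "y - 1"]) (auto simp: vedge_def)
qed

lemma finite_graph_edges: "finite (graph_edges n)"
  by (rule finite_subset[of _ "Pow {1..n}"]) (auto simp: graph_edges_def)

lemma card_graph_edges_le: "card (graph_edges n) \<le> n\<^sup>2"
proof -
  have "card (graph_edges n) = n choose 2"
    unfolding graph_edges_def by (subst n_subsets) auto
  also have "\<dots> \<le> n\<^sup>2"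
      by (simp add: choose_two power2_eq_square) (metis diff_le_self div_le_dividend le_trans
      mult_le_mono2)
  finally show ?thesis .
qed

lemma centered_lap_sym: "centered_lap p t n E i j = centered_lap p t n E j i"
  by (simp add: centered_lap_def vedge_commute)

text \<open>Adding the edge \<open>ab\<close> adds \<open>t * (e_a - e_b) (e_a - e_b)^T\<close>.
  Comparing with \<open>E - {e}\<close> and not with \<open>E\<close> gives one formula whether or
  not the edge is present.\<close>

lemma centered_lap_insert:
  assumes ab: "a < n" "b < n" "a \<noteq> b" and ij: "i < n" "j < n"
  shows "centered_lap p t n (insert (vedge a b) E) i j - centered_lap p t n (E - {vedge a b}) i j
    = t * (of_bool (i = a) - of_bool (i = b)) * (of_bool (j = a) - of_bool (j = b))"
proof (cases "i = j")
  case True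
  have "centered_lap p t n (insert (vedge a b) E) i j - centered_lap p t n (E - {vedge a b}) i j
      = t * (\<Sum>k\<in>{..<n} - {i}. of_bool (vedge i k \<in> insert (vedge a b) E)
               - of_bool (vedge i k \<in> E - {vedge a b}))"
    using True by (simp add: centered_lap_def right_diff_distrib[symmetric]
        sum_subtractf[symmetric])
  also have "(\<Sum>k\<in>{..<n} - {i}. of_bool (vedge i k \<in> insert (vedge a b) E)
               - of_bool (vedge i k \<in> E - {vedge a b}) :: real)
     = (\<Sum>k\<in>{..<n} - {i}. of_bool (vedge i k = vedge a b))"
    by (intro sum.cong) auto
  \<comment> \<open>The only \<open>k\<close> that completes \<open>i\<close> to the edge
    \<open>ab\<close> is the other endpoint.\<close>
  also have "\<dots> = (\<Sum>k\<in>{..<n} - {i}. if k = (if i = a then b else a) then of_bool (i = a \<or> i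
      = b) else 0)"
  proof (intro sum.cong refl)
    fix k assume "k \<in> {..<n} - {i}"
    then show "(of_bool (vedge i k = vedge a b) :: real)
        = (if k = (if i = a then b else a) then of_bool (i = a \<or> i = b) else 0)"
      using ab by (cases "i = a"; cases "i = b") (simp_all add: vedge_eq_iff)
  qed
  also have "\<dots> = of_bool (i = a \<or> i = b)"
    using ab by (subst sum.delta) auto
  finally show ?thesis using True ab by auto
next
  case False
  have "centered_lap p t n (insert (vedge a b) E) i j - centered_lap p t n (E - {vedge a b}) i j
      = t * (- of_bool (vedge i j = vedge a b))"
    using False by (simp add: centered_lap_def algebra_simps)
  moreover have "- of_bool (vedge i j = vedge a b)
      = (of_bool (i = a) - of_bool (i = b)) * (of_bool (j = a) - of_bool (j = b) :: real)"
    unfolding vedge_eq_iff of_bool_def using ab(3) False by (simp split: if_split)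
  ultimately show ?thesis by (simp only: mult.assoc)
qed

definition resolvent :: "nat \<Rightarrow> (nat \<Rightarrow> nat \<Rightarrow> real) \<Rightarrow> complex \<Rightarrow> nat \<Rightarrow> nat \<Rightarrow> complex" where
  "resolvent n A z = (SOME R. is_resolvent n A z R)"

section \<open>Stability of the resolvent under a change of one edge\<close>

locale lap_resolvent =
  fixes p \<sigma> :: real and n :: nat and z :: complex
  assumes p: "0 < p" "p < 1" and \<sigma>: "\<sigma> = sqrt (p * (1 - p))" and n: "n \<ge> 1" and z: "Im z > 0"
begin

definition "t = 1 / (\<sigma> * sqrt (real n))"
definition "F = graph_edges n"
definition "\<eta> = Im z"
definition "D E i = centered_lap p t n E i i"
definition "R E = resolvent n (centered_lap p t n E) z"
definition "S E = (\<Sum>i<n. R E i i) / of_nat n"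

lemma finite_F: "finite F" by (simp add: F_def finite_graph_edges)

lemma \<sigma>_pos: "\<sigma> > 0" using p by (simp add: \<sigma>)

lemma \<sigma>_sq: "\<sigma>\<^sup>2 = p * (1 - p)" using p by (simp add: \<sigma>)

lemma t_pos: "t > 0" using \<sigma>_pos n by (simp add: t_def)

text \<open>Each centered weight \<open>t * (a - p)\<close> has variance \<open>1 / n\<close>; this
  scaling is behind both the semicircle part and the normal degrees.\<close>

lemma t_sq: "\<sigma>\<^sup>2 * t\<^sup>2 = 1 / real n"
  using \<sigma>_pos n by (simp add: t_def power_divide power_mult_distrib)

lemma eta_pos: "\<eta> > 0" using z by (simp add: \<eta>_def)

lemma resolvent_R: "is_resolvent n (centered_lap p t n E) z (R E)"
  unfolding R_def resolvent_def
  by (intro someI_ex[where P="is_resolvent n (centered_lap p t n E) z"] ex_resolvent)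
    (use z in \<open>auto intro: centered_lap_sym\<close>)

lemma R_le: "k < n \<Longrightarrow> l < n \<Longrightarrow> cmod (R E k l) \<le> 1 / \<eta>"
  unfolding \<eta>_def by (rule resolvent_entry[OF centered_lap_sym resolvent_R z]) auto

lemma R_col: "l < n \<Longrightarrow> (\<Sum>k<n. (cmod (R E k l))\<^sup>2) \<le> 1 / \<eta>\<^sup>2"
  unfolding \<eta>_def by (rule resolvent_col_sq[OF centered_lap_sym resolvent_R z]) auto

lemma R_row: "l < n \<Longrightarrow> (\<Sum>k<n. (cmod (R E l k))\<^sup>2) \<le> 1 / \<eta>\<^sup>2"
  unfolding \<eta>_def by (rule resolvent_row_sq[OF centered_lap_sym resolvent_R z]) auto

lemma Im_S_le: "Im (S E) \<le> 0"
proof -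
  have "Im (R E i i) \<le> 0" if "i < n" for i
    by (rule resolvent_diag_Im[OF centered_lap_sym resolvent_R z]) (use that in auto)
  then show ?thesis by (auto simp: S_def intro!: divide_nonpos_nonneg sum_nonpos)
qed

text \<open>Resolvent identity for a rank one perturbation, with the new resolvent on the right.
  This mixed form avoids the denominator of the Sherman-Morrison formula.\<close>

lemma R_diff:
  assumes ab: "a < n" "b < n" "a \<noteq> b" and kl: "k < n" "l < n"
  defines "e \<equiv> vedge a b"
  shows "R (insert e E) k l - R (E - {e}) k l
    = t * (R (E - {e}) k a - R (E - {e}) k b) * (R (insert e E) a l - R (insert e E) b l)"
proof -
  let ?P = "R (insert e E)" and ?M = "R (E - {e})"
  let ?\<beta> = "\<lambda>i. of_bool (i = a) - of_bool (i = b) :: complex"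
  have \<beta>1: "(\<Sum>i<n. f i * ?\<beta> i) = f a - f b" for f :: "nat \<Rightarrow> complex"
  proof -
    have "(\<Sum>i<n. f i * ?\<beta> i) = (\<Sum>i<n. (if i = a then f i else 0) - (if i = b then f i else 0))"
      by (intro sum.cong) auto
    then show ?thesis using ab by (simp add: sum_subtractf)
  qed
  have "?P k l - ?M k l
    = (\<Sum>i<n. \<Sum>j<n. ?M k i * of_real (centered_lap p t n (insert e E) i j - centered_lap p t n (E -
        {e}) i j) * ?P j l)"
    using resolvent_identity[OF resolvent_R[of "E - {e}"] resolvent_R[of "insert e E"] kl] by simp
  also have "\<dots> = (\<Sum>i<n. \<Sum>j<n. t * (?M k i * ?\<beta> i) * (?P j l * ?\<beta> j))"
    using ab unfolding e_def by (intro sum.cong refl, subst centered_lap_insert) auto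
  also have "\<dots> = t * (\<Sum>i<n. ?M k i * ?\<beta> i) * (\<Sum>j<n. ?P j l * ?\<beta> j)"
    by (simp add: sum_product sum_distrib_left sum_distrib_right mult_ac)
  finally show ?thesis unfolding \<beta>1 .
qed

lemma R_diff_le:
  assumes ab: "a < n" "b < n" "a \<noteq> b" and kl: "k < n" "l < n"
  shows "cmod (R (insert (vedge a b) E) k l - R (E - {vedge a b}) k l) \<le> 4 * t / \<eta>\<^sup>2"
proof -
  have 2: "cmod (R E k i - R E k j) \<le> 2 / \<eta>" "cmod (R E i k - R E j k) \<le> 2 / \<eta>"
    if "k < n" "i < n" "j < n" for E k i j
    using R_le[of k i E] R_le[of k j E] R_le[of i k E] R_le[of j k E] that
      norm_triangle_ineq4[of "R E k i" "R E k j"] norm_triangle_ineq4[of "R E i k" "R E j k"]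
          by auto
  have "cmod (R (insert (vedge a b) E) k l - R (E - {vedge a b}) k l) \<le> t * (2 / \<eta>) * (2 / \<eta>)"
    unfolding R_diff[OF ab kl] norm_mult using ab kl t_pos eta_pos
    by (intro mult_mono 2) (auto intro!: mult_nonneg_nonneg)
  then show ?thesis by (simp add: power2_eq_square)
qed

text \<open>Summing the entrywise bound over the diagonal would lose the factor
  \<open>1 / n\<close>. The trace of the rank one difference is instead a pairing of two vectors
  \<open>u\<close> and \<open>v\<close>, each of squared norm at most \<open>4 / \<eta>^2\<close> by
  the column and row bounds.\<close>

lemma S_diff_le:
  assumes "e \<in> F" "e \<notin> E"
  shows "cmod (S (insert e E) - S E) \<le> 4 * t / (real n * \<eta>\<^sup>2)"
proof -
  obtain a b where ab: "a < n" "b < n" "a \<noteq> b" and e: "e = vedge a b"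
    using assms graph_edgesE unfolding F_def by metis
  have E: "E - {e} = E" using assms by auto
  define u where "u k = R E k a - R E k b" for k
  define v where "v k = R (insert e E) a k - R (insert e E) b k" for k
  have sq: "(cmod (x - y))\<^sup>2 \<le> 2 * (cmod x)\<^sup>2 + 2 * (cmod y)\<^sup>2" for x y
  proof -
    have "(cmod (x - y))\<^sup>2 \<le> (cmod x + cmod y)\<^sup>2"
      by (intro power_mono norm_triangle_ineq4) auto
    also have "\<dots> \<le> 2 * (cmod x)\<^sup>2 + 2 * (cmod y)\<^sup>2"
      using sum_squares_bound[of "cmod x" "cmod y"] by (simp add: power2_sum)
    finally show ?thesis .
  qed
  have "(\<Sum>k<n. (cmod (u k))\<^sup>2) \<le> (\<Sum>k<n. 2 * (cmod (R E k a))\<^sup>2 + 2 * (cmod (R E k b))\<^sup>2)"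
    unfolding u_def by (intro sum_mono sq)
  also have "\<dots> \<le> 4 / \<eta>\<^sup>2"
    using R_col[OF ab(1), of E] R_col[OF ab(2), of E]
        by (simp add: sum.distrib sum_distrib_left[symmetric])
  finally have u: "(\<Sum>k<n. (cmod (u k))\<^sup>2) \<le> 4 / \<eta>\<^sup>2" .
  have "(\<Sum>k<n. (cmod (v k))\<^sup>2)
      \<le> (\<Sum>k<n. 2 * (cmod (R (insert e E) a k))\<^sup>2 + 2 * (cmod (R (insert e E) b k))\<^sup>2)"
    unfolding v_def by (intro sum_mono sq)
  also have "\<dots> \<le> 4 / \<eta>\<^sup>2"
    using R_row[OF ab(1), of "insert e E"] R_row[OF ab(2), of "insert e E"]
    by (simp add: sum.distrib sum_distrib_left[symmetric])
  finally have v: "(\<Sum>k<n. (cmod (v k))\<^sup>2) \<le> 4 / \<eta>\<^sup>2" .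
  have "S (insert e E) - S E = (\<Sum>k<n. R (insert e E) k k - R E k k) / of_nat n"
    by (simp add: S_def sum_subtractf diff_divide_distrib)
  also have "\<dots> = t * (\<Sum>k<n. u k * v k) / of_nat n"
    using R_diff[OF ab, of _ _ E] unfolding e[symmetric] E u_def v_def
        by (simp add: sum_distrib_left mult_ac)
  finally have "cmod (S (insert e E) - S E) = t / real n * cmod (\<Sum>k<n. u k * v k)"
    using t_pos by (simp add: norm_mult norm_divide)
  also have "\<dots> \<le> t / real n * (\<Sum>k<n. ((cmod (u k))\<^sup>2 + (cmod (v k))\<^sup>2) / 2)"
  proof (intro mult_left_mono order_trans[OF norm_sum] sum_mono)
    show "cmod (u k * v k) \<le> ((cmod (u k))\<^sup>2 + (cmod (v k))\<^sup>2) / 2" for k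
      using sum_squares_bound[of "cmod (u k)" "cmod (v k)"] by (simp add: norm_mult)
  qed (use t_pos in auto)
  also have "\<dots> \<le> t / real n * (4 / \<eta>\<^sup>2)"
    using u v t_pos by (intro mult_left_mono) (auto simp: sum_divide_distrib[symmetric] sum.distrib)
  finally show ?thesis by (simp add: mult.commute)
qed

abbreviation "EE \<equiv> bern_exp p F"

definition "s = EE S"

lemma Im_s_le: "Im s \<le> 0"
proof -
  have "Im s = EE (\<lambda>E. Im (S E))"
    unfolding s_def by (rule bern_exp_linear[symmetric]) (auto intro!: linearI)
  also have "\<dots> \<le> EE (\<lambda>_. 0)" using p Im_S_le by (intro bern_exp_mono) auto
  finally show ?thesis using finite_F by (simp add: bern_exp_const)
qed

text \<open>The deterministic \<open>s\<close> makes \<open>\<phi> i\<close> a function of the edges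
  at \<open>i\<close> alone, and \<open>Im s <= 0\<close> keeps its denominator at distance at least
  \<open>\<eta>\<close> from zero.\<close>

definition "\<phi> i E = 1 / (z - s - of_real (D E i))"

lemma denom_Im: "Im (z - s - of_real x) \<ge> \<eta>"
  using Im_s_le by (simp add: \<eta>_def)

lemma denom_norm: "cmod (z - s - of_real x) \<ge> \<eta>"
  using denom_Im[of x] abs_Im_le_cmod[of "z - s - of_real x"] by linarith

lemma denom_nz: "z - s - of_real x \<noteq> 0"
  using denom_norm[of x] eta_pos by auto

lemma \<phi>_le: "cmod (\<phi> i E) \<le> 1 / \<eta>"
  using denom_norm[of "D E i"] eta_pos by (simp add: \<phi>_def norm_divide frac_le)

lemma \<phi>_diff:
  assumes "i < n" "j < n" "i \<noteq> j"
  defines "e \<equiv> vedge i j"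
  shows "\<phi> i (insert e E) - \<phi> i (E - {e}) = t * \<phi> i (insert e E) * \<phi> i (E - {e})"
proof -
  have "D (insert e E) i - D (E - {e}) i = t"
    using centered_lap_insert[of i n j i i p t E] assms by (simp add: D_def)
  then have "of_real (D (insert e E) i) - of_real (D (E - {e}) i) = complex_of_real t"
    by (metis of_real_diff)
  then show ?thesis
    using denom_nz[of "D (insert e E) i"] denom_nz[of "D (E - {e}) i"]
    by (simp add: \<phi>_def divide_simps algebra_simps)
qed

text \<open>Discrete product rule. By \<open>R_diff\<close> the change of \<open>R j i\<close> is
  \<open>t * (r1 - q1) * (d2 - r2)\<close>, whose only part without an off-diagonal entry is
  \<open>- t * q1 * d2\<close>. In the constants, 4 counts the terms with an off-diagonal entry, and
  25 = 16 + 9: 16 from replacing those entries by \<open>R E j i\<close>, and 9 = 4 + 4 + 1 from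
  moving \<open>d2\<close>, \<open>q1\<close> and \<open>f1\<close> to \<open>E\<close>.\<close>

lemma edge_difference:
  assumes ij: "i < n" "j < n" "i \<noteq> j"
  defines "e \<equiv> vedge i j"
  shows "cmod ((\<phi> i (insert e E) * R (insert e E) j i - \<phi> i (E - {e}) * R (E - {e}) j i)
           + t * (\<phi> i E * R E j j * R E i i))
    \<le> t * (4 * (1/\<eta>)\<^sup>2 * cmod (R E j i) + 25 * t * (1/\<eta>)^4)"
proof -
  define c where "c = 1 / \<eta>"
  have c: "c \<ge> 0" using eta_pos by (simp add: c_def)
  define f1 where "f1 = \<phi> i (insert e E)"
  define f2 where "f2 = \<phi> i (E - {e})"
  define r1 where "r1 = R (E - {e}) j i"
  define r2 where "r2 = R (insert e E) j i"
  define q1 where "q1 = R (E - {e}) j j"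
  define d2 where "d2 = R (insert e E) i i"
  define f where "f = \<phi> i E"
  define r where "r = R E j i"
  define q where "q = R E j j"
  define d where "d = R E i i"
  have fd: "f1 - f2 = t * f1 * f2" unfolding f1_def f2_def e_def by (rule \<phi>_diff) fact+
  have bd: "cmod f1 \<le> c" "cmod f2 \<le> c" "cmod r1 \<le> c" "cmod r2 \<le> c" "cmod q1 \<le> c" "cmod d2 \<le> c"
     "cmod f \<le> c" "cmod q \<le> c" "cmod d \<le> c"
    unfolding f1_def f2_def r1_def r2_def q1_def d2_def f_def q_def d_def c_def
    using \<phi>_le R_le ij by auto
  have "cmod (f1 - f2) \<le> t * c * c"
    unfolding fd norm_mult using bd t_pos c by (intro mult_mono) auto
  then have df12: "cmod (f1 - f2) \<le> t * c\<^sup>2" by (simp add: power2_eq_square)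
  \<comment> \<open>\<open>E\<close> coincides with one of the two edge sets that are
    compared.\<close>
  have df: "cmod (f1 - f) \<le> t * c\<^sup>2"
  proof (cases "e \<in> E")
    case True
    then have "f1 = f" by (simp add: f1_def f_def insert_absorb)
    then show ?thesis using t_pos by simp
  next
    case False
    then have "f2 = f" by (simp add: f2_def f_def)
    then show ?thesis using df12 by simp
  qed
  have Rd: "cmod (R (insert e E) k l - R (E - {e}) k l) \<le> 4 * t * c\<^sup>2" if "k < n" "l < n" for k l
    using R_diff_le[OF ij that] unfolding e_def c_def by (simp add: power_divide)
  have pos: "0 \<le> 4 * t * c\<^sup>2" using t_pos c by auto
  have Rd1: "cmod (R (insert e E) k l - R E k l) \<le> 4 * t * c\<^sup>2"
    and Rd2: "cmod (R (E - {e}) k l - R E k l) \<le> 4 * t * c\<^sup>2" if "k < n" "l < n" for k l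
  proof -
    have "cmod (R (insert e E) k l - R E k l) \<le> 4 * t * c\<^sup>2 \<and> cmod (R (E - {e}) k l - R E k l)
        \<le> 4 * t * c\<^sup>2"
    proof (cases "e \<in> E")
      case True
      then have "insert e E = E" by auto
      then show ?thesis using Rd[OF that] pos by (simp add: norm_minus_commute)
    next
      case False
      then have "E - {e} = E" by auto
      then show ?thesis using Rd[OF that] pos by simp
    qed
    then show "cmod (R (insert e E) k l - R E k l) \<le> 4 * t * c\<^sup>2"
      "cmod (R (E - {e}) k l - R E k l) \<le> 4 * t * c\<^sup>2" by auto
  qed
  have dr1: "cmod (r1 - r) \<le> 4 * t * c\<^sup>2" and dr2: "cmod (r2 - r) \<le> 4 * t * c\<^sup>2"
    and dq: "cmod (q1 - q) \<le> 4 * t * c\<^sup>2" and dd: "cmod (d2 - d) \<le> 4 * t * c\<^sup>2"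
    unfolding r1_def r2_def r_def q1_def q_def d2_def d_def using Rd1 Rd2 ij by auto
  have lr1: "cmod r1 \<le> cmod r + 4 * t * c\<^sup>2" and lr2: "cmod r2 \<le> cmod r + 4 * t * c\<^sup>2"
    using dr1 dr2 norm_triangle_sub[of r1 r] norm_triangle_sub[of r2 r] by linarith+
  have rd: "r2 - r1 = t * (r1 - q1) * (d2 - r2)"
    using R_diff[OF ij ij(2,1), of E] unfolding r1_def r2_def q1_def d2_def e_def .
  have m3: "cmod (x * y * w) \<le> c\<^sup>2 * k" if "cmod x \<le> c" "cmod y \<le> c" "cmod w \<le> k" for x y w k
  proof -
    have "cmod (x * y * w) \<le> c * c * k"
      unfolding norm_mult using that c by (intro mult_mono) auto
    then show ?thesis by (simp add: power2_eq_square)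
  qed
  let ?k = "cmod r + 4 * t * c\<^sup>2"
  \<comment> \<open>\<open>X\<close> collects the terms with an off-diagonal entry; \<open>Y\<close>
    telescopes \<open>f1 * q1 * d2 - f * q * d\<close>.\<close>
  define X where "X = f1 * f2 * r1 + (f1 * d2 * r1 - f1 * r2 * r1 + f1 * q1 * r2)"
  define Y where "Y = f * q * (d2 - d) + f * d2 * (q1 - q) + q1 * d2 * (f1 - f)"
  have "f1 * r2 - f2 * r1 = (f1 - f2) * r1 + f1 * (r2 - r1)" by (simp add: algebra_simps)
  also have "\<dots> = t * (X - f1 * q1 * d2)" unfolding fd rd X_def by (simp add: algebra_simps)
  finally have "f1 * r2 - f2 * r1 = t * (X - f1 * q1 * d2)" .
  then have eq: "(f1 * r2 - f2 * r1) + t * (f * q * d) = t * (X - Y)"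
    unfolding Y_def by (simp add: algebra_simps)
  have "cmod X \<le> c\<^sup>2 * ?k + (c\<^sup>2 * ?k + c\<^sup>2 * ?k + c\<^sup>2 * ?k)"
    unfolding X_def
    by (intro order_trans[OF norm_triangle_ineq] order_trans[OF norm_triangle_ineq4] add_mono m3
        bd lr1 lr2)
  moreover have "cmod Y \<le> c\<^sup>2 * (4 * t * c\<^sup>2) + c\<^sup>2 * (4 * t * c\<^sup>2) + c\<^sup>2 * (t * c\<^sup>2)"
    unfolding Y_def
    by (intro order_trans[OF norm_triangle_ineq] add_mono m3 bd dd dq df)
  ultimately have "cmod (X - Y) \<le> 4 * c\<^sup>2 * cmod r + 25 * t * c^4"
    using norm_triangle_ineq4[of X Y] by (simp add: algebra_simps power2_eq_square power4_eq_xxxx)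
  then have "t * cmod (X - Y) \<le> t * (4 * c\<^sup>2 * cmod r + 25 * t * c^4)"
    using t_pos by (intro mult_left_mono) auto
  moreover have "cmod ((f1 * r2 - f2 * r1) + t * (f * q * d)) = t * cmod (X - Y)"
    unfolding eq norm_mult using t_pos by simp
  ultimately show ?thesis unfolding f1_def f2_def r1_def r2_def f_def r_def q_def d_def c_def
      by simp
qed

end

section \<open>Mean of a diagonal resolvent entry\<close>

context lap_resolvent
begin

text \<open>The error budget: \<open>cmod (S E - s)\<close> is the price of the deterministic shift,
  the off-diagonal terms give \<open>4 c^3\<close>, the second order terms
  \<open>25 c^4 / \<sigma>\<close>, and the index \<open>j = i\<close>, absent from the row sum, one
  more \<open>c^3\<close>, whence the 5.\<close>

lemma expectation_R_diag:
  assumes i: "i < n"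
  defines "c \<equiv> 1 / \<eta>"
  shows "cmod (EE (\<lambda>E. R E i i) - EE (\<phi> i))
    \<le> c\<^sup>2 * EE (\<lambda>E. cmod (S E - s)) + (5 * c^3 + 25 * c^4 / \<sigma>) / sqrt (real n)"
proof -
  define J where "J = {..<n} - {i}"
  have J: "{..<n} = insert i J" "finite J" "i \<notin> J" using i by (auto simp: J_def)
  have c: "c > 0" using eta_pos by (simp add: c_def)
  define Y where "Y j E = \<phi> i (insert (vedge i j) E) * R (insert (vedge i j) E) j i
      - \<phi> i (E - {vedge i j}) * R (E - {vedge i j}) j i" for j E
  have row: "R E i i + s * \<phi> i E * R E i i - \<phi> i E
      = - (\<Sum>j\<in>J. t * ((of_bool (vedge i j \<in> E) - p) *\<^sub>R (\<phi> i E * R E j i)))" for E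
  proof -
    have "1 = z * R E i i - (\<Sum>k<n. of_real (centered_lap p t n E i k) * R E k i)"
      using resolvent_R[of E] i unfolding is_resolvent_def by auto
    also have "(\<Sum>k<n. of_real (centered_lap p t n E i k) * R E k i)
        = D E i * R E i i + (\<Sum>k\<in>J. of_real (centered_lap p t n E i k) * R E k i)"
      unfolding J(1) using J by (simp add: D_def)
    also have "(\<Sum>k\<in>J. of_real (centered_lap p t n E i k) * R E k i)
        = - (\<Sum>k\<in>J. t * ((of_bool (vedge i k \<in> E) - p) *\<^sub>R R E k i))"
      unfolding sum_negf[symmetric] using J
          by (intro sum.cong) (auto simp: centered_lap_def scaleR_conv_of_real algebra_simps)
    finally have "z * R E i i = 1
        + (D E i * R E i i - (\<Sum>k\<in>J. t * ((of_bool (vedge i k \<in> E) - p) *\<^sub>R R E k i)))"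
      by (simp add: eq_diff_eq)
    then have 1: "(z - D E i) * R E i i
        = 1 - (\<Sum>k\<in>J. t * ((of_bool (vedge i k \<in> E) - p) *\<^sub>R R E k i))"
      by (simp add: left_diff_distrib)
    have 2: "\<phi> i E * (z - D E i) = 1 + s * \<phi> i E"
      using denom_nz[of "D E i"] by (simp add: \<phi>_def divide_simps)
    have "(1 + s * \<phi> i E) * R E i i = \<phi> i E * ((z - D E i) * R E i i)"
      unfolding 2[symmetric] by (simp add: algebra_simps)
    also have "\<dots> = \<phi> i E - (\<Sum>k\<in>J. t * ((of_bool (vedge i k \<in> E) - p) *\<^sub>R (\<phi> i E * R E k i)))"
      unfolding 1 by (simp add: algebra_simps sum_distrib_left)
    finally show ?thesis by (simp add: algebra_simps)
  qed
  \<comment> \<open>The integration by parts is in the edge \<open>ij\<close> only;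
    \<open>\<sigma>^2\<close> is the variance of its indicator.\<close>
  have parts: "EE (\<lambda>E. (of_bool (vedge i j \<in> E) - p) *\<^sub>R (\<phi> i E * R E j i)) = \<sigma>\<^sup>2 * EE (Y j)"
    if "j \<in> J" for j
    unfolding Y_def \<sigma>_sq
    by (subst bern_exp_by_parts[OF finite_F]) (use that i vedge_in_graph_edges in \<open>auto simp:
        F_def J_def scaleR_conv_of_real\<close>)
  have "EE (\<lambda>E. R E i i) + EE (\<lambda>E. s * \<phi> i E * R E i i) - EE (\<phi> i)
      = EE (\<lambda>E. - (\<Sum>j\<in>J. t * ((of_bool (vedge i j \<in> E) - p) *\<^sub>R (\<phi> i E * R E j i))))"
    unfolding bern_exp_add[symmetric] bern_exp_diff[symmetric] row ..
  also have "\<dots> = - (\<Sum>j\<in>J. t * (\<sigma>\<^sup>2 * EE (Y j)))"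
    unfolding bern_exp_minus bern_exp_sum bern_exp_mult_left by (simp add: parts)
  also have "\<dots> = EE (\<lambda>E. - (\<Sum>j\<in>J. t * (\<sigma>\<^sup>2 * Y j E)))"
    unfolding bern_exp_minus bern_exp_sum bern_exp_mult_left ..
  finally have "EE (\<lambda>E. R E i i) - EE (\<phi> i)
      = EE (\<lambda>E. - (\<Sum>j\<in>J. t * (\<sigma>\<^sup>2 * Y j E)) - s * \<phi> i E * R E i i)"
    unfolding bern_exp_diff by (simp add: algebra_simps)
  also have "cmod \<dots> \<le> EE (\<lambda>E. cmod (- (\<Sum>j\<in>J. t * (\<sigma>\<^sup>2 * Y j E)) - s * \<phi> i E * R E i i))"
    using p by (intro norm_bern_exp_le) auto
  also have "\<dots> \<le> EE (\<lambda>E. c\<^sup>2 * cmod (S E - s) + (5 * c^3 + 25 * c^4 / \<sigma>) / sqrt (real n))"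
  proof (rule bern_exp_mono)
    fix E
    define X where "X = (\<Sum>j\<in>J. Y j E + t * (\<phi> i E * R E j j * R E i i))"
    have "cmod X \<le> (\<Sum>j\<in>J. t * (4 * c\<^sup>2 * cmod (R E j i) + 25 * t * c^4))"
      unfolding X_def Y_def c_def using i
      by (intro order_trans[OF norm_sum] sum_mono edge_difference) (auto simp: J_def)
    also have "\<dots> \<le> (\<Sum>j<n. t * (4 * c\<^sup>2 * cmod (R E j i) + 25 * t * c^4))"
      using t_pos c unfolding J_def by (intro sum_mono2) auto
    also have "\<dots> = t * (4 * c\<^sup>2 * (\<Sum>j<n. cmod (R E j i)) + real n * (25 * t * c^4))"
      by (simp add: sum_distrib_left[symmetric] sum.distrib)
    \<comment> \<open>Cauchy-Schwarz: a column has norm at most \<open>c\<close>, so the moduli of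
      its \<open>n\<close> entries sum to at most \<open>c * sqrt n\<close>.\<close>
    also have "\<dots> \<le> t * (4 * c\<^sup>2 * (sqrt n * c) + real n * (25 * t * c^4))"
    proof -
      have "(\<Sum>j<n. cmod (R E j i))\<^sup>2 \<le> (\<Sum>j<n. (cmod (R E j i))\<^sup>2) * real (card {..<n})"
        by (rule sum_squared_le_sum_of_squares)
      also have "\<dots> \<le> c\<^sup>2 * real n"
        using mult_right_mono[OF R_col[OF i, of E], of "real n"] by (simp add: c_def power_divide)
      also have "\<dots> = (sqrt n * c)\<^sup>2" by (simp add: power_mult_distrib)
      finally have "(\<Sum>j<n. cmod (R E j i)) \<le> sqrt n * c"
        by (rule power2_le_imp_le) (use c in simp)
      then show ?thesis using t_pos c by (intro mult_left_mono add_mono) auto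
    qed
    finally have X: "cmod X \<le> t * (4 * c\<^sup>2 * (sqrt n * c) + real n * (25 * t * c^4))" .
    have nS: "(\<Sum>j\<in>J. R E j j) = of_nat n * S E - R E i i"
      using J n unfolding S_def by simp
    have hY: "(\<Sum>j\<in>J. Y j E) = X - t * \<phi> i E * R E i i * (\<Sum>j\<in>J. R E j j)"
      unfolding X_def by (simp add: sum.distrib sum_distrib_left sum_distrib_right mult_ac)
    have hS: "(\<Sum>j\<in>J. t * (\<sigma>\<^sup>2 * Y j E)) = t * \<sigma>\<^sup>2 * (\<Sum>j\<in>J. Y j E)"
      by (simp only: sum_distrib_left of_real_mult mult.assoc)
    \<comment> \<open>The scaling \<open>\<sigma>^2 t^2 = 1 / n\<close> turns the leading part into
      \<open>\<phi> i E * R E i i * S E\<close>, which meets the term with \<open>s\<close>; the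
      omitted index \<open>j = i\<close> leaves the summand divided by \<open>n\<close>.\<close>
    have "- (\<Sum>j\<in>J. t * (\<sigma>\<^sup>2 * Y j E)) - s * \<phi> i E * R E i i
        = - (t * \<sigma>\<^sup>2 * X)
            + complex_of_real (\<sigma>\<^sup>2 * t\<^sup>2) * \<phi> i E * R E i i * (of_nat n * S E - R E i i) - s * \<phi> i
            E * R E i i"
      unfolding nS[symmetric] hS hY by (simp add: algebra_simps power2_eq_square)
    also have "\<dots> = - (t * \<sigma>\<^sup>2 * X) - \<phi> i E * R E i i * R E i i / of_nat n
        + \<phi> i E * R E i i * (S E - s)"
    proof -
      have st: "complex_of_real (\<sigma>\<^sup>2 * t\<^sup>2) = 1 / of_nat n" unfolding t_sq by simp
      show ?thesis unfolding st using n by (simp add: field_simps)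
    qed
    also have "cmod \<dots> \<le> t * \<sigma>\<^sup>2 * cmod X + c^3 / real n + c\<^sup>2 * cmod (S E - s)"
    proof -
      have a: "cmod (\<phi> i E) \<le> c" "cmod (R E i i) \<le> c" using \<phi>_le R_le i by (auto simp: c_def)
      have "cmod (\<phi> i E * R E i i * R E i i) \<le> c * c * c"
        unfolding norm_mult using a c by (intro mult_mono) auto
      then have 1: "cmod (\<phi> i E * R E i i * R E i i / of_nat n) \<le> c^3 / real n"
        by (simp add: norm_divide power3_eq_cube divide_right_mono)
      have "cmod (\<phi> i E * R E i i * (S E - s)) \<le> c * c * cmod (S E - s)"
        unfolding norm_mult using a c by (intro mult_mono) auto
      then have 2: "cmod (\<phi> i E * R E i i * (S E - s)) \<le> c\<^sup>2 * cmod (S E - s)"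
        by (simp add: power2_eq_square)
      have 3: "cmod (- (t * \<sigma>\<^sup>2 * X)) = t * \<sigma>\<^sup>2 * cmod X"
        using t_pos \<sigma>_pos by (simp add: norm_mult norm_power)
      show ?thesis
        using 1 2 3 norm_triangle_ineq[of "- (t * \<sigma>\<^sup>2 * X) - \<phi> i E * R E i i * R E i i / of_nat n"
            "\<phi> i E * R E i i * (S E - s)"]
          norm_triangle_ineq4[of "- (t * \<sigma>\<^sup>2 * X)" "\<phi> i E * R E i i * R E i i / of_nat n"]
              by linarith
    qed
    also have "t * \<sigma>\<^sup>2 * cmod X \<le> t * \<sigma>\<^sup>2 * (t * (4 * c\<^sup>2 * (sqrt n * c)
        + real n * (25 * t * c^4)))"
      using t_pos by (intro mult_left_mono X) auto
    also have "\<dots> = (\<sigma>\<^sup>2 * t\<^sup>2) * (4 * c\<^sup>2 * (sqrt n * c) + real n * (25 * t * c^4))"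
      by (simp add: power2_eq_square algebra_simps)
    also have "\<dots> = (4 * c^3 + 25 * c^4 / \<sigma>) / sqrt (real n)"
    proof -
      have "sqrt n / real n = 1 / sqrt n" using n by (simp add: field_simps)
      then show ?thesis
        unfolding t_sq using n \<sigma>_pos
            by (simp add: t_def field_simps power2_eq_square power3_eq_cube)
    qed
    also have "c^3 / real n \<le> c^3 / sqrt (real n)"
    proof (rule divide_left_mono)
      show "sqrt (real n) \<le> real n"
        using n by (intro real_le_lsqrt) (auto simp: power2_eq_square)
    qed (use n c in auto)
    finally show "cmod (- (\<Sum>j\<in>J. t * (\<sigma>\<^sup>2 * Y j E)) - s * \<phi> i E * R E i i)
      \<le> c\<^sup>2 * cmod (S E - s) + (5 * c^3 + 25 * c^4 / \<sigma>) / sqrt (real n)"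
      by (simp add: add_divide_distrib)
  qed (use p in auto)
  also have "\<dots> = c\<^sup>2 * EE (\<lambda>E. cmod (S E - s)) + (5 * c^3 + 25 * c^4 / \<sigma>) / sqrt (real n)"
    unfolding bern_exp_add bern_exp_mult_left bern_exp_const[OF finite_F] ..
  finally show ?thesis .
qed

text \<open>For \<open>l = sqrt n\<close> the exponent of the concentration bound stays bounded:
  there are at most \<open>n^2\<close> edges, and each changes \<open>S\<close> by a multiple of
  \<open>n^(-3/2)\<close>.\<close>

lemma card_F_diff_sq:
  "(sqrt (real n))\<^sup>2 * (real (card F) * (4 * t / (real n * \<eta>\<^sup>2))\<^sup>2) \<le> 16 * (1/\<eta>)^4 / \<sigma>\<^sup>2"
proof -
  have "(sqrt (real n))\<^sup>2 * (real (card F) * (4 * t / (real n * \<eta>\<^sup>2))\<^sup>2)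
      \<le> (sqrt (real n))\<^sup>2 * ((real n)\<^sup>2 * (4 * t / (real n * \<eta>\<^sup>2))\<^sup>2)"
    using card_graph_edges_le[of n] unfolding F_def
    by (intro mult_left_mono mult_right_mono) (auto simp flip: of_nat_power)
  also have "\<dots> = 16 * (1/\<eta>)^4 / \<sigma>\<^sup>2 * (real n * (\<sigma>\<^sup>2 * t\<^sup>2))"
    using n eta_pos \<sigma>_pos by (simp add: field_simps power_mult_distrib power_divide)
  also have "\<dots> = 16 * (1/\<eta>)^4 / \<sigma>\<^sup>2" unfolding t_sq using n by simp
  finally show ?thesis .
qed

lemma bern_exp_Re: "Re (bern_exp p F f) = bern_exp p F (\<lambda>E. Re (f E))"
  by (rule bern_exp_linear[symmetric]) (auto intro!: linearI)

lemma bern_exp_Im: "Im (bern_exp p F f) = bern_exp p F (\<lambda>E. Im (f E))"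
  by (rule bern_exp_linear[symmetric]) (auto intro!: linearI)

lemma S_Re_diff_le: "e \<in> F \<Longrightarrow> E \<subseteq> F \<Longrightarrow> e \<notin> E \<Longrightarrow>
    \<bar>Re (S (insert e E)) - Re (S E)\<bar> \<le> 4 * t / (real n * \<eta>\<^sup>2)"
  using S_diff_le[of e E] abs_Re_le_cmod[of "S (insert e E) - S E"] by simp

lemma S_Im_diff_le: "e \<in> F \<Longrightarrow> E \<subseteq> F \<Longrightarrow> e \<notin> E \<Longrightarrow>
    \<bar>Im (S (insert e E)) - Im (S E)\<bar> \<le> 4 * t / (real n * \<eta>\<^sup>2)"
  using S_diff_le[of e E] abs_Im_le_cmod[of "S (insert e E) - S E"] by simp

lemma expectation_S_dev: "EE (\<lambda>E. cmod (S E - s)) \<le> 4 * exp (16 * (1/\<eta>)^4 / \<sigma>\<^sup>2) / sqrt (real n)"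
proof -
  let ?c = "4 * t / (real n * \<eta>\<^sup>2)"
  have sn: "sqrt (real n) > 0" using n by simp
  have "EE (\<lambda>E. cmod (S E - s)) \<le> EE (\<lambda>E. \<bar>Re (S E) - Re s\<bar> + \<bar>Im (S E) - Im s\<bar>)"
    using p cmod_le[of "S _ - s"] by (intro bern_exp_mono) auto
  also have "\<dots> = EE (\<lambda>E. \<bar>Re (S E) - EE (\<lambda>E. Re (S E))\<bar>) + EE (\<lambda>E. \<bar>Im (S E) - EE (\<lambda>E. Im (S E))\<bar>)"
    unfolding bern_exp_add s_def bern_exp_Re bern_exp_Im ..
  also have "\<dots> \<le> 2 * exp ((sqrt (real n))\<^sup>2 * (real (card F) * ?c\<^sup>2)) / sqrt (real n)
                + 2 * exp ((sqrt (real n))\<^sup>2 * (real (card F) * ?c\<^sup>2)) / sqrt (real n)"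
    using p S_Re_diff_le S_Im_diff_le
    by (intro add_mono bern_exp_abs_dev_le[OF _ _ finite_F _ sn]) auto
  also have "\<dots> \<le> 2 * exp (16 * (1/\<eta>)^4 / \<sigma>\<^sup>2) / sqrt (real n)
      + 2 * exp (16 * (1/\<eta>)^4 / \<sigma>\<^sup>2) / sqrt (real n)"
    using card_F_diff_sq by (intro add_mono divide_right_mono mult_left_mono) auto
  finally show ?thesis by simp
qed

lemma expectation_S_approx:
  "cmod (s - (\<Sum>i<n. EE (\<phi> i)) / of_nat n)
    \<le> (4 * (1/\<eta>)\<^sup>2 * exp (16 * (1/\<eta>)^4 / \<sigma>\<^sup>2) + 5 * (1/\<eta>)^3 + 25 * (1/\<eta>)^4 / \<sigma>) / sqrt (real n)"
  (is "_ \<le> ?K / _")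
proof -
  have "s = (\<Sum>i<n. EE (\<lambda>E. R E i i)) / of_nat n"
    unfolding s_def S_def divide_inverse bern_exp_mult_right bern_exp_sum ..
  then have "s - (\<Sum>i<n. EE (\<phi> i)) / of_nat n = (\<Sum>i<n. EE (\<lambda>E. R E i i) - EE (\<phi> i)) / of_nat n"
    by (simp add: sum_subtractf diff_divide_distrib)
  also have "cmod \<dots> = cmod (\<Sum>i<n. EE (\<lambda>E. R E i i) - EE (\<phi> i)) / real n" by (simp add: norm_divide)
  also have "\<dots> \<le> (\<Sum>i<n. ?K / sqrt (real n)) / real n"
  proof (intro divide_right_mono order_trans[OF norm_sum] sum_mono)
    fix i assume "i \<in> {..<n}"
    then have "cmod (EE (\<lambda>E. R E i i) - EE (\<phi> i))
      \<le> (1/\<eta>)\<^sup>2 * EE (\<lambda>E. cmod (S E - s)) + (5 * (1/\<eta>)^3 + 25 * (1/\<eta>)^4 / \<sigma>) / sqrt (real n)"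
      by (intro expectation_R_diag) auto
    also have "(1/\<eta>)\<^sup>2 * EE (\<lambda>E. cmod (S E - s))
        \<le> (1/\<eta>)\<^sup>2 * (4 * exp (16 * (1/\<eta>)^4 / \<sigma>\<^sup>2) / sqrt (real n))"
      by (intro mult_left_mono expectation_S_dev) auto
    finally show "cmod (EE (\<lambda>E. R E i i) - EE (\<phi> i)) \<le> ?K / sqrt (real n)"
      by (simp add: add_divide_distrib mult_ac)
  qed auto
  also have "\<dots> = ?K / sqrt (real n)" using n by simp
  finally show ?thesis .
qed

text \<open>Characteristic function at \<open>- \<tau>\<close> of one weight
  \<open>t * (a - p)\<close>. The sign fits the integral of
  \<open>exp (\<i> * (w - x) * \<tau>)\<close> over positive \<open>\<tau>\<close>, by which
  \<open>1 / (w - x)\<close> will be expressed.\<close>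

definition "chf \<tau> = of_real p * exp (- (\<i> * of_real (\<tau> * t * (1 - p))))
    + of_real (1 - p) * exp (\<i> * of_real (\<tau> * t * p))"

lemma expectation_exp_D:
  assumes i: "i < n"
  shows "EE (\<lambda>E. exp (- (\<i> * of_real (\<tau> * D E i)))) = chf \<tau> ^ (n - 1)"
proof -
  define J where "J = {..<n} - {i}"
  define star where "star = vedge i ` J"
  \<comment> \<open>\<open>g\<close> is 1 off the star of \<open>i\<close>, so that the product can
    run over all of \<open>F\<close>.\<close>
  define g where "g e b = (if e \<in> star then exp (- (\<i> * of_real (\<tau> * t * (of_bool b - p)))) else
      1)" for e b
  have J: "finite J" by (simp add: J_def)
  have inj: "inj_on (vedge i) J" by (auto simp: inj_on_def vedge_eq_iff)
  have star: "star \<subseteq> F" using i by (auto simp: star_def J_def F_def intro!: vedge_in_graph_edges)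
  have card: "card star = n - 1" unfolding star_def card_image[OF inj] using i by (simp add: J_def)
  have "exp (- (\<i> * of_real (\<tau> * D E i))) = (\<Prod>e\<in>F. g e (e \<in> E))" for E
  proof -
    have "- (\<i> * of_real (\<tau> * D E i))
        = (\<Sum>k\<in>J. - (\<i> * of_real (\<tau> * t * (of_bool (vedge i k \<in> E) - p))))"
      by (simp add: D_def centered_lap_def J_def sum_distrib_left sum_negf mult_ac)
    also have "exp \<dots> = (\<Prod>k\<in>J. g (vedge i k) (vedge i k \<in> E))"
      unfolding exp_sum[OF J] by (intro prod.cong) (auto simp: g_def star_def)
    also have "\<dots> = (\<Prod>e\<in>star. g e (e \<in> E))" by (simp add: star_def prod.reindex[OF inj])
    also have "\<dots> = (\<Prod>e\<in>F. g e (e \<in> E))"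
      using star finite_F by (intro prod.mono_neutral_left) (auto simp: g_def)
    finally show ?thesis .
  qed
  then have "EE (\<lambda>E. exp (- (\<i> * of_real (\<tau> * D E i)))) = EE (\<lambda>E. \<Prod>e\<in>F. g e (e \<in> E))" by simp
  also have "\<dots> = (\<Prod>e\<in>F. p *\<^sub>R g e True + (1 - p) *\<^sub>R g e False)"
    by (rule bern_exp_prod[OF finite_F])
  also have "\<dots> = (\<Prod>e\<in>star. p *\<^sub>R g e True + (1 - p) *\<^sub>R g e False)"
    using star finite_F by (intro prod.mono_neutral_right) (auto simp: g_def scaleR_conv_of_real)
  also have "\<dots> = (\<Prod>e\<in>star. chf \<tau>)"
    by (intro prod.cong) (auto simp: g_def chf_def scaleR_conv_of_real algebra_simps)
  finally show ?thesis by (simp add: card)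
qed

end

subsection \<open>Cauchy transforms determine distributions\<close>

lemma exp_neg_integrable:
  fixes a :: real
  assumes "a > 0"
  shows "set_integrable lborel {0<..} (\<lambda>t. exp (- (a * t)))"
proof -
  have "set_integrable lborel (einterval 0 \<infinity>) (\<lambda>t. exp (- (a * t)))"
  proof (rule interval_integral_FTC_nonneg(1)[where F="\<lambda>t. - exp (- (a * t)) / a" and A="- 1 / a"
      and B=0])
    show "((\<lambda>t. - exp (- (a * t)) / a) has_real_derivative exp (- (a * x))) (at x)" for x
      using assms by (auto intro!: derivative_eq_intros)
    have "((\<lambda>t. - exp (- (a * t)) / a) \<longlongrightarrow> - exp (- (a * 0)) / a) (at_right 0)"
      using assms by (intro tendsto_intros) auto
    then show "(((\<lambda>t. - exp (- (a * t)) / a) \<circ> real_of_ereal) \<longlongrightarrow> - 1 / a) (at_right 0)"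
      by (simp add: zero_ereal_def ereal_tendsto_simps)
    have "((\<lambda>t. - exp (- (a * t)) / a) \<longlongrightarrow> 0) at_top"
      using assms by real_asymp
    then show "(((\<lambda>t. - exp (- (a * t)) / a) \<circ> real_of_ereal) \<longlongrightarrow> 0) (at_left \<infinity>)"
      by (simp add: ereal_tendsto_simps)
  qed auto
  then show ?thesis by (simp add: zero_ereal_def)
qed

text \<open>With \<open>w - x\<close> in place of \<open>w\<close> this separates the spectral
  parameter from the point \<open>x\<close>, which then enters through a pure phase.\<close>

lemma
  assumes "Im w > 0"
  shows iexp_integrable: "set_integrable lborel {0<..} (\<lambda>t. exp (\<i> * w * complex_of_real t))"
    and iexp_integral: "(LBINT t:{0<..}. exp (\<i> * w * complex_of_real t)) = \<i> / w"
proof -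
  have cont: "continuous_on UNIV (\<lambda>t. exp (\<i> * w * complex_of_real t))"
    by (intro continuous_intros)
  show int: "set_integrable lborel {0<..} (\<lambda>t. exp (\<i> * w * complex_of_real t))"
  proof (rule set_integrable_bound[OF exp_neg_integrable[OF assms]])
    show "set_borel_measurable lborel {0<..} (\<lambda>t. exp (\<i> * w * complex_of_real t))"
      unfolding set_borel_measurable_def
      using borel_measurable_continuous_onI[OF cont] by measurable
  qed (auto simp: norm_exp_eq_Re)
  have w: "w \<noteq> 0" using assms by auto
  have "(LBINT t=0..\<infinity>. exp (\<i> * w * complex_of_real t)) = 0 - 1 / (\<i> * w)"
  proof (rule interval_integral_FTC_integrable[where F="\<lambda>t. exp (\<i> * w * complex_of_real t) / (\<i> *
      w)"])
    show "((\<lambda>t. exp (\<i> * w * complex_of_real t) / (\<i> * w)) has_vector_derivative exp (\<i> * w *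
        complex_of_real x)) (at x)" for x
    proof -
      have "((\<lambda>u. exp (\<i> * w * u) / (\<i> * w)) has_field_derivative exp (\<i> * w * of_real x)) (at
          (of_real x))"
        using w by (auto intro!: derivative_eq_intros)
      then show ?thesis by (rule has_vector_derivative_real_field)
    qed
    show "isCont (\<lambda>t. exp (\<i> * w * complex_of_real t)) x" for x by (intro continuous_intros)
    show "set_integrable lborel (einterval 0 \<infinity>) (\<lambda>t. exp (\<i> * w * complex_of_real t))"
      using int by (simp add: zero_ereal_def)
    have "((\<lambda>t. exp (\<i> * w * complex_of_real t) / (\<i> * w)) \<longlongrightarrow> exp (\<i> * w * complex_of_real 0) / (\<i>
        * w)) (at_right 0)"
      using w by (intro tendsto_intros) auto
    then show "(((\<lambda>t. exp (\<i> * w * complex_of_real t) / (\<i> * w)) \<circ> real_of_ereal) \<longlongrightarrow> 1 / (\<i> * w))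
        (at_right 0)"
      by (simp add: zero_ereal_def ereal_tendsto_simps)
    have "((\<lambda>t. exp (- (Im w * t)) / cmod w) \<longlongrightarrow> 0) at_top"
      using assms w by real_asymp
    then have "((\<lambda>t. exp (\<i> * w * complex_of_real t) / (\<i> * w)) \<longlongrightarrow> 0) at_top"
      by (rule Lim_null_comparison[rotated]) (auto simp: norm_divide norm_mult norm_exp_eq_Re)
    then show "(((\<lambda>t. exp (\<i> * w * complex_of_real t) / (\<i> * w)) \<circ> real_of_ereal) \<longlongrightarrow> 0) (at_left \<infinity>)"
      by (simp add: ereal_tendsto_simps)
  qed auto
  moreover have "0 - 1 / (\<i> * w) = \<i> / w" using w by (simp add: divide_simps)
  ultimately show "(LBINT t:{0<..}. exp (\<i> * w * complex_of_real t)) = \<i> / w"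
    by (simp add: interval_lebesgue_integral_0_infty)
qed

text \<open>Lerch's uniqueness theorem through Weierstrass approximation. With
  \<open>u = exp (- t)\<close> the hypotheses say that \<open>f\<close> is orthogonal, for the
  weight \<open>exp (- K t)\<close>, to every polynomial in \<open>u\<close>; approximating
  \<open>u * f (- ln u)\<close> by a polynomial makes the weighted integral of
  \<open>exp (- t) * f^2\<close> arbitrarily small.\<close>

lemma laplace_transform_eq_0:
  fixes f :: "real \<Rightarrow> real"
  assumes cont: "continuous_on UNIV f" and B: "\<And>t. \<bar>f t\<bar> \<le> B"
    and K: "K \<ge> (1::nat)" and zero: "\<And>k. k \<ge> K \<Longrightarrow> (LBINT t:{0<..}. exp (- (real k * t)) * f t) = 0"
    and t: "t > 0"
  shows "f t = 0"
proof -
  have B0: "B \<ge> 0" using B[of 0] by linarith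
  have [measurable]: "f \<in> borel_measurable borel" by (rule borel_measurable_continuous_onI[OF cont])
  have int: "set_integrable lborel {0<..} (\<lambda>t. exp (- (real k * t)) * g t)"
    if "k \<ge> 1" and [measurable]: "g \<in> borel_measurable borel" and "\<And>t. t > 0 \<Longrightarrow> \<bar>g t\<bar> \<le> C" for k g C
  proof (rule set_integrable_bound[where f="\<lambda>t. exp (- (real k * t)) * C"])
    show "set_integrable lborel {0<..} (\<lambda>t. exp (- (real k * t)) * C)"
      using that by (intro set_integrable_mult_left exp_neg_integrable) auto
    show "set_borel_measurable lborel {0<..} (\<lambda>t. exp (- (real k * t)) * g t)"
      unfolding set_borel_measurable_def by measurable
    show "AE x in lborel. x \<in> {0<..} \<longrightarrow> norm (exp (- (real k * x)) * g x)
        \<le> norm (exp (- (real k * x)) * C)"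
    proof (intro AE_I2 impI)
      fix x :: real assume "x \<in> {0<..}"
      then have "\<bar>g x\<bar> \<le> \<bar>C\<bar>" using that(3)[of x] by auto
      then show "norm (exp (- (real k * x)) * g x) \<le> norm (exp (- (real k * x)) * C)"
        by (simp add: abs_mult)
    qed
  qed
  \<comment> \<open>The factor \<open>u\<close> forces continuity at 0, where
    \<open>f (- ln u)\<close> may have no limit.\<close>
  define q where "q u = (if u = 0 then 0 else u * f (- ln u))" for u
  have qcont: "continuous_on {0..1} q"
  proof -
    have "((\<lambda>u. q u) \<longlongrightarrow> q x) (at x within {0..1})" if x: "x \<in> {0..1}" for x
    proof (cases "x = 0")
      case True
      have le: "norm (q u) \<le> \<bar>u\<bar> * B" for u
        unfolding q_def using mult_left_mono[OF B[of "- ln u"], of "\<bar>u\<bar>"] by (auto simp: abs_mult)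
      have "((\<lambda>u. \<bar>u\<bar> * B) \<longlongrightarrow> \<bar>0\<bar> * B) (at 0 within {0..1})" by (intro tendsto_intros)
      then have lim: "((\<lambda>u. \<bar>u\<bar> * B) \<longlongrightarrow> 0) (at 0 within {0..1})" by simp
      have "(q \<longlongrightarrow> 0) (at 0 within {0..1})"
        by (rule Lim_null_comparison[OF always_eventually lim]) (use le in blast)
      moreover have "q 0 = 0" by (simp add: q_def)
      ultimately show ?thesis using True by simp
    next
      case False
      have fc: "isCont f (- ln x)" using cont by (simp add: continuous_on_eq_continuous_at)
      have lc: "isCont (\<lambda>u. - ln u) x" using False by (intro continuous_intros) auto
      have "isCont (\<lambda>u. u * f (- ln u)) x"
        by (intro isCont_mult continuous_ident isCont_o2[where f="\<lambda>u. - ln u" and g=f, OF lc fc])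
      moreover have "\<forall>\<^sub>F u in nhds x. u * f (- ln u) = q u"
        using False by (intro eventually_mono[OF t1_space_nhds[of x 0]]) (auto simp: q_def)
      ultimately have "isCont q x" by (simp add: isCont_cong)
      then show ?thesis unfolding isCont_def by (rule tendsto_within_subset) simp
    qed
    then show ?thesis by (simp add: continuous_on_def)
  qed
  define I where "I = (LBINT t:{0<..}. exp (- (real K * t)) * (exp (- t) * (f t)\<^sup>2))"
  define A where "A = (LBINT t:{0<..}. exp (- (real K * t)) * 1)"
  have q_exp: "q (exp (- t)) = exp (- t) * f t" for t by (simp add: q_def)
  have fsq: "(f t)\<^sup>2 \<le> B\<^sup>2" for t using B[of t] B0 by (simp add: abs_le_square_iff[symmetric])
  have Iint: "set_integrable lborel {0<..} (\<lambda>t. exp (- (real K * t)) * (exp (- t) * (f t)\<^sup>2))"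
  proof (rule int[OF K, where C="B\<^sup>2"])
    show "\<bar>exp (- t) * (f t)\<^sup>2\<bar> \<le> B\<^sup>2" if "t > 0" for t
      using mult_mono[of "exp (- t)" 1 "(f t)\<^sup>2" "B\<^sup>2"] fsq[of t] that by (simp add: abs_mult)
  qed measurable
  have I_le: "I \<le> e * B * A" if e: "e > 0" for e
  proof -
    obtain g where g: "real_polynomial_function g" "\<And>x. x \<in> {0..1} \<Longrightarrow> \<bar>q x - g x\<bar> < e"
      using Stone_Weierstrass_real_polynomial_function[OF _ qcont e] by auto
    obtain a m where am: "g = (\<lambda>x. \<Sum>i\<le>m. a i * x ^ i)"
      using real_polynomial_function_imp_sum[OF g(1)] by auto
    have i1: "set_integrable lborel {0<..} (\<lambda>t. a i * (exp (- (real (K + i) * t)) * f t))" for i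
      using K B by (intro set_integrable_mult_right int) auto
    have gf: "exp (- (real K * t)) * (g (exp (- t)) * f t)
        = (\<Sum>i\<le>m. a i * (exp (- (real (K + i) * t)) * f t))" for t
      unfolding am sum_distrib_left sum_distrib_right
      by (intro sum.cong) (auto simp: exp_of_nat_mult[symmetric] algebra_simps simp flip: exp_add)
    have gint: "set_integrable lborel {0<..} (\<lambda>t. exp (- (real K * t)) * (g (exp (- t)) * f t))"
      using i1 unfolding gf set_integrable_def scaleR_sum_right
      by (intro Bochner_Integration.integrable_sum)
    have g0: "(LBINT t:{0<..}. exp (- (real K * t)) * (g (exp (- t)) * f t)) = 0"
    proof -
      have "(LBINT t:{0<..}. exp (- (real K * t)) * (g (exp (- t)) * f t))
          = (\<Sum>i\<le>m. LBINT t:{0<..}. a i * (exp (- (real (K + i) * t)) * f t))"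
        using i1 unfolding gf set_integrable_def set_lebesgue_integral_def scaleR_sum_right
        by (intro Bochner_Integration.integral_sum)
      also have "\<dots> = (\<Sum>i\<le>m. a i * (LBINT t:{0<..}. exp (- (real (K + i) * t)) * f t))"
        by (simp only: set_integral_mult_right)
      also have "\<dots> = 0" by (intro sum.neutral ballI) (simp only: zero le_add1 mult_zero_right)
      finally show ?thesis .
    qed
    have "I = (LBINT t:{0<..}. exp (- (real K * t)) * (exp (- t) * (f t)\<^sup>2)
                - exp (- (real K * t)) * (g (exp (- t)) * f t))"
      unfolding I_def using Iint gint g0 by (simp add: set_integral_diff)
    also have "\<dots> \<le> (LBINT t:{0<..}. e * B * (exp (- (real K * t)) * 1))"
    proof (rule set_integral_mono)
      show "set_integrable lborel {0<..} (\<lambda>t. e * B * (exp (- (real K * t)) * 1))"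
        by (intro set_integrable_mult_right int[OF K, where C=1]) auto
      fix t :: real assume "t \<in> {0<..}"
      then have "exp (- t) \<in> {0..1}" by auto
      then have "\<bar>q (exp (- t)) - g (exp (- t))\<bar> \<le> e" using g(2) by (simp add: less_imp_le)
      then have "\<bar>(q (exp (- t)) - g (exp (- t))) * f t\<bar> \<le> e * B"
        unfolding abs_mult using B e by (intro mult_mono) auto
      then have "exp (- (real K * t)) * ((q (exp (- t)) - g (exp (- t))) * f t)
          \<le> exp (- (real K * t)) * (e * B)"
        by (intro mult_left_mono) auto
      then show "exp (- (real K * t)) * (exp (- t) * (f t)\<^sup>2) - exp (- (real K * t)) * (g (exp (-
          t)) * f t)
        \<le> e * B * (exp (- (real K * t)) * 1)"
        by (simp add: q_exp power2_eq_square algebra_simps)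
    qed (intro set_integral_diff Iint gint)
    also have "\<dots> = e * B * A" unfolding A_def by simp
    finally show ?thesis .
  qed
  have "I \<le> 0"
  proof (rule field_le_epsilon)
    fix e :: real assume e: "e > 0"
    have A: "A \<ge> 0" unfolding A_def set_lebesgue_integral_def
        by (intro Bochner_Integration.integral_nonneg) auto
    \<comment> \<open>The summand 1 keeps the denominator positive even if
      \<open>B * A = 0\<close>.\<close>
    have "I \<le> e / (B * A + 1) * B * A" using e A B0
        by (intro I_le) (auto intro!: divide_pos_pos add_nonneg_pos)
    also have "\<dots> = e * (B * A / (B * A + 1))" by simp
    also have "\<dots> \<le> e * 1" using e A B0
        by (intro mult_left_mono) (auto simp: divide_le_eq add_nonneg_pos)
    finally show "I \<le> 0 + e" by simp
  qed
  moreover have "0 \<le> I" unfolding I_def set_lebesgue_integral_def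
      by (intro Bochner_Integration.integral_nonneg) auto
  ultimately have "I = 0" by simp
  then have "AE t in lborel. indicator {0<..} t *\<^sub>R (exp (- (real K * t)) * (exp (- t) * (f t)\<^sup>2))
      = 0"
    using Iint unfolding I_def set_lebesgue_integral_def set_integrable_def
    by (subst (asm) integral_nonneg_eq_0_iff_AE) auto
  then have "AE t in lborel. t \<notin> {t. t > 0 \<and> f t \<noteq> 0}" by eventually_elim (auto simp: indicator_def)
  \<comment> \<open>The set where \<open>f\<close> differs from 0 is open and null, hence
    empty.\<close>
  moreover have op: "open {t. t > 0 \<and> f t \<noteq> 0}"
    by (intro open_Collect_conj open_Collect_less open_Collect_neq cont continuous_intros)
  ultimately have "{t. t > 0 \<and> f t \<noteq> 0} \<in> null_sets lborel"
    by (subst AE_iff_null_sets) auto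
  then have "negligible {t. t > 0 \<and> f t \<noteq> 0}"
    by (simp add: negligible_iff_null_sets null_sets_completionI)
  then show ?thesis using open_not_negligible[OF op] t by auto
qed

section \<open>Elementary properties of Cauchy transforms\<close>

context real_distribution
begin

lemma cauchy_kernel_bound: "Im z > 0 \<Longrightarrow> cmod (1 / (z - complex_of_real x)) \<le> 1 / Im z"
  using abs_Im_le_cmod[of "z - complex_of_real x"] by (simp add: norm_divide frac_le)

lemma cauchy_kernel_measurable [measurable]: "(\<lambda>x. 1 / (z - complex_of_real x)) \<in> borel_measurable
    M"
  by measurable

lemma cauchy_kernel_integrable: "Im z > 0 \<Longrightarrow> integrable M (\<lambda>x. 1 / (z - complex_of_real x))"
  by (rule integrable_const_bound[where B="1 / Im z"]) (auto intro!: always_eventually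
      cauchy_kernel_bound)

lemma cauchy_transform_le: "Im z > 0 \<Longrightarrow> cmod (cauchy_transform M z) \<le> 1 / Im z"
proof -
  assume z: "Im z > 0"
  have "cmod (cauchy_transform M z) \<le> (LINT x|M. cmod (1 / (z - complex_of_real x)))"
    unfolding cauchy_transform_def by (rule integral_norm_bound)
  also have "\<dots> \<le> (LINT x|M. 1 / Im z)"
    using z by (intro integral_mono integrable_norm cauchy_kernel_integrable cauchy_kernel_bound)
        auto
  finally show ?thesis using prob_space by simp
qed

lemma Im_cauchy_transform_le: "Im z > 0 \<Longrightarrow> Im (cauchy_transform M z) \<le> 0"
proof -
  assume z: "Im z > 0"
  have "Im (cauchy_transform M z) = (LINT x|M. Im (1 / (z - complex_of_real x)))"
    unfolding cauchy_transform_def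
        by (rule integral_Im[symmetric]) (rule cauchy_kernel_integrable[OF z])
  also have "\<dots> \<le> (LINT x|M. 0)"
    using z by (intro integral_mono integrable_Im cauchy_kernel_integrable) (auto simp: Im_divide
        divide_nonpos_nonneg)
  finally show ?thesis by simp
qed

lemma cauchy_transform_diff:
  assumes "Im z > 0" "Im w > 0"
  shows "cauchy_transform M z - cauchy_transform M w
    = (w - z) * (LINT x|M. 1 / (z - complex_of_real x) * (1 / (w - complex_of_real x)))"
proof -
  have "cauchy_transform M z - cauchy_transform M w
      = (LINT x|M. 1 / (z - complex_of_real x) - 1 / (w - complex_of_real x))"
    unfolding cauchy_transform_def using assms
        by (intro Bochner_Integration.integral_diff[symmetric] cauchy_kernel_integrable)
  also have "\<dots> = (LINT x|M. (w - z) * (1 / (z - complex_of_real x) * (1 / (w - complex_of_real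
      x))))"
  proof (intro Bochner_Integration.integral_cong refl)
    fix x
    have "z - complex_of_real x \<noteq> 0" "w - complex_of_real x \<noteq> 0" using assms
        by (auto simp: complex_eq_iff)
    then show "1 / (z - complex_of_real x) - 1 / (w - complex_of_real x)
        = (w - z) * (1 / (z - complex_of_real x) * (1 / (w - complex_of_real x)))"
      by (simp add: field_simps)
  qed
  also have "\<dots> = (w - z) * (LINT x|M. 1 / (z - complex_of_real x) * (1 / (w - complex_of_real x)))"
    by (rule integral_mult_right_zero)
  finally show ?thesis .
qed

lemma cauchy_transform_lipschitz:
  assumes "Im z > 0" "Im w > 0"
  shows "cmod (cauchy_transform M z - cauchy_transform M w) \<le> cmod (z - w) / (Im z * Im w)"
proof -
  have b: "cmod (1 / (z - complex_of_real x) * (1 / (w - complex_of_real x)))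
      \<le> 1 / Im z * (1 / Im w)" for x
    unfolding norm_mult using assms by (intro mult_mono cauchy_kernel_bound) auto
  have "cmod (LINT x|M. 1 / (z - complex_of_real x) * (1 / (w - complex_of_real x)))
      \<le> (LINT x|M. cmod (1 / (z - complex_of_real x) * (1 / (w - complex_of_real x))))"
    by (rule integral_norm_bound)
  also have "\<dots> \<le> (LINT x|M. 1 / Im z * (1 / Im w))"
  proof (rule integral_mono)
    show "integrable M (\<lambda>x. cmod (1 / (z - complex_of_real x) * (1 / (w - complex_of_real x))))"
      by (rule integrable_const_bound[where B="1 / Im z * (1 / Im w)"]) (use b in auto)
  qed (use b in auto)
  finally have "cmod (LINT x|M. 1 / (z - complex_of_real x) * (1 / (w - complex_of_real x)))
      \<le> 1 / (Im z * Im w)"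
    using prob_space by simp
  then have "cmod (w - z) * cmod (LINT x|M. 1 / (z - complex_of_real x) * (1 / (w -
      complex_of_real x)))
      \<le> cmod (w - z) * (1 / (Im z * Im w))" by (rule mult_left_mono) simp
  then show ?thesis
    unfolding cauchy_transform_diff[OF assms] norm_mult by (simp add: norm_minus_commute)
qed

lemma cauchy_transform_continuous: "continuous_on {z. Im z > 0} (cauchy_transform M)"
proof (rule continuous_on_iff[THEN iffD2], intro ballI allI impI)
  fix z e assume z: "z \<in> {z. Im z > 0}" and e: "(0::real) < e"
  define d where "d = min (Im z / 2) (e * (Im z)\<^sup>2 / 4)"
  have "d > 0" using z e by (auto simp: d_def)
  moreover have "dist (cauchy_transform M w) (cauchy_transform M z) < e"
    if w: "w \<in> {z. Im z > 0}" "dist w z < d" for w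
  proof -
    have "\<bar>Im w - Im z\<bar> \<le> cmod (w - z)" using abs_Im_le_cmod[of "w - z"] by simp
    then have Iw: "Im w \<ge> Im z / 2" using w by (auto simp: d_def dist_norm)
    have "cmod (cauchy_transform M w - cauchy_transform M z) \<le> cmod (w - z) / (Im w * Im z)"
      using w z by (intro cauchy_transform_lipschitz) auto
    also have "\<dots> \<le> (e * (Im z)\<^sup>2 / 4) / (Im z / 2 * Im z)"
      using w z Iw e by (intro frac_le mult_right_mono) (auto simp: d_def dist_norm)
    also have "\<dots> = e / 2" using z by (auto simp: power2_eq_square)
    finally show ?thesis using e by (simp add: dist_norm)
  qed
  ultimately show "\<exists>d>0. \<forall>w\<in>{z. Im z > 0}. dist w z < d
      \<longrightarrow> dist (cauchy_transform M w) (cauchy_transform M z) < e"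
    by blast
qed

text \<open>Fubini, legitimate because of the damping \<open>exp (- Im w * t)\<close>. At
  \<open>w = \<i> * y\<close> the formula is a Laplace transform of the characteristic function on
  the negative half line.\<close>

lemma cauchy_transform_char:
  assumes w: "Im w > 0"
  shows "cauchy_transform M w
      = - \<i> * (LBINT t:{0<..}. exp (\<i> * w * complex_of_real t) * char M (- t))"
proof -
  interpret P: pair_sigma_finite M lborel ..
  define h where "h x t = indicator {0<..} t *\<^sub>R exp (\<i> * (w - complex_of_real x) *
      complex_of_real t)" for x t :: real
  have [measurable]: "case_prod h \<in> borel_measurable (M \<Otimes>\<^sub>M lborel)"
    unfolding h_def case_prod_beta by measurable
  have wx: "Im (w - complex_of_real x) > 0" for x using w by simp
  have hint: "integrable lborel (h x)" for x
    using iexp_integrable[OF wx[of x]] unfolding set_integrable_def h_def .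
  have hnorm: "norm (h x t) = indicator {0<..} t *\<^sub>R exp (- (Im w * t))" for x t
    by (auto simp: h_def norm_exp_eq_Re indicator_def)
  have int: "integrable (M \<Otimes>\<^sub>M lborel) (case_prod h)"
  proof (rule P.Fubini_integrable)
    show "integrable M (\<lambda>x. LINT y|lborel. norm (case (x, y) of (x, xa) \<Rightarrow> h x xa))"
      unfolding prod.case hnorm by simp
    show "AE x in M. integrable lborel (\<lambda>y. case (x, y) of (x, xa) \<Rightarrow> h x xa)"
      using hint by simp
  qed measurable
  have "1 / (w - complex_of_real x) = - \<i> * (LINT t|lborel. h x t)" for x
    using iexp_integral[OF wx[of x]] unfolding set_lebesgue_integral_def h_def by simp
  then have "cauchy_transform M w = (LINT x|M. - \<i> * (LINT t|lborel. h x t))"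
    unfolding cauchy_transform_def by simp
  also have "\<dots> = - \<i> * (LINT x|M. (LINT t|lborel. h x t))" by simp
  also have "(LINT x|M. (LINT t|lborel. h x t)) = (LINT t|lborel. (LINT x|M. h x t))"
    by (rule P.Fubini_integral[OF int, symmetric])
  also have "\<dots> = (LBINT t:{0<..}. exp (\<i> * w * complex_of_real t) * char M (- t))"
    unfolding set_lebesgue_integral_def
  proof (intro Bochner_Integration.integral_cong refl)
    fix t
    have "(LINT x|M. h x t) = (LINT x|M. indicator {0<..} t *\<^sub>R exp (\<i> * w * complex_of_real t) *
        iexp (- t * x))"
      unfolding h_def by (intro Bochner_Integration.integral_cong refl) (simp add: algebra_simps
          exp_diff exp_minus divide_inverse)
    also have "\<dots> = indicator {0<..} t *\<^sub>R exp (\<i> * w * complex_of_real t) * (LINT x|M. iexp (- t *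
        x))"
      by (rule integral_mult_right_zero)
    finally show "(LINT x|M. h x t)
        = indicator {0<..} t *\<^sub>R (exp (\<i> * w * complex_of_real t) * char M (- t))"
      by (simp add: char_def)
  qed
  finally show ?thesis .
qed

lemma iexp_char_integrable:
  assumes "Im w > 0"
  shows "set_integrable lborel {0<..} (\<lambda>t. exp (\<i> * w * complex_of_real t) * char M (- t))"
proof (rule set_integrable_bound[OF exp_neg_integrable[OF assms]])
  have [measurable]: "char M \<in> borel_measurable borel" by (rule char_measurable)
  show "set_borel_measurable lborel {0<..} (\<lambda>t. exp (\<i> * w * complex_of_real t) * char M (- t))"
    unfolding set_borel_measurable_def by measurable
  show "AE t in lborel. t \<in> {0<..} \<longrightarrow> norm (exp (\<i> * w * complex_of_real t) * char M (- t))
      \<le> norm (exp (- (Im w * t)))"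
    using cmod_char_le_1 by (auto simp: norm_mult norm_exp_eq_Re intro: mult_left_le)
qed

end

text \<open>The Laplace uniqueness result works with integer heights, hence the rounding
  \<open>K\<close>. It reaches only the negative half line of the characteristic functions;
  conjugation gives the other half.\<close>

lemma cauchy_transform_unique:
  assumes M: "real_distribution M" and N: "real_distribution N"
    and eq: "\<And>y. y \<ge> Y \<Longrightarrow> cauchy_transform M (\<i> * of_real y) = cauchy_transform N (\<i> * of_real y)"
  shows "M = N"
proof (rule Levy_uniqueness[OF M N], rule ext)
  interpret M: real_distribution M by fact
  interpret N: real_distribution N by fact
  define K where "K = nat \<lceil>max 1 Y\<rceil>"
  have K: "K \<ge> 1" "real K \<ge> Y" unfolding K_def by linarith+
  define g where "g t = char M (- t) - char N (- t)" for t
  have neg_cont: "continuous_on UNIV (\<lambda>t. char L (- t))" if "real_distribution L" for L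
  proof -
    have "continuous_on UNIV (char L)"
      using that by (simp add: continuous_at_imp_continuous_on real_distribution.isCont_char)
    then show ?thesis by (rule continuous_on_compose2) (auto intro!: continuous_intros)
  qed
  from neg_cont[OF M] neg_cont[OF N] have gcont: "continuous_on UNIV g"
    unfolding g_def by (rule continuous_on_diff)
  have gB: "cmod (g t) \<le> 2" for t
    unfolding g_def using norm_triangle_ineq4[of "char M (-t)" "char N (-t)"] M.cmod_char_le_1[of
        "-t"] N.cmod_char_le_1[of "-t"] by linarith
  have e: "exp (\<i> * (\<i> * of_real k) * complex_of_real t) = of_real (exp (- (k * t)))"
      for k t :: real
    by (simp add: exp_of_real[symmetric])
  have gint: "set_integrable lborel {0<..} (\<lambda>t. of_real (exp (- (real k * t))) * g t)"
    and g0: "(LBINT t:{0<..}. of_real (exp (- (real k * t))) * g t) = 0" if "k \<ge> K" for k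
  proof -
    have k: "Im (\<i> * of_real (real k)) > 0" using that K by simp
    note iM = M.iexp_char_integrable[OF k] and iN = N.iexp_char_integrable[OF k]
    have "cauchy_transform M (\<i> * of_real k) = cauchy_transform N (\<i> * of_real k)"
      using that K by (intro eq) auto
    then have "(LBINT t:{0<..}. exp (\<i> * (\<i> * of_real k) * complex_of_real t) * char M (- t))
        = (LBINT t:{0<..}. exp (\<i> * (\<i> * of_real k) * complex_of_real t) * char N (- t))"
      unfolding M.cauchy_transform_char[OF k] N.cauchy_transform_char[OF k] by simp
    then show "(LBINT t:{0<..}. of_real (exp (- (real k * t))) * g t) = 0"
      using set_integral_diff(2)[OF iM iN] unfolding e g_def right_diff_distrib by simp
    show "set_integrable lborel {0<..} (\<lambda>t. of_real (exp (- (real k * t))) * g t)"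
      using set_integral_diff(1)[OF iM iN] unfolding e g_def right_diff_distrib .
  qed
  have "Re (g t) = 0 \<and> Im (g t) = 0" if "t > 0" for t
  proof
    show "Re (g t) = 0"
    proof (rule laplace_transform_eq_0[of "\<lambda>t. Re (g t)" 2 K])
      show "(LBINT t:{0<..}. exp (- (real k * t)) * Re (g t)) = 0" if "k \<ge> K" for k
        using arg_cong[OF g0[OF that], of Re] gint[OF that]
        unfolding set_lebesgue_integral_def set_integrable_def
        by (subst (asm) integral_Re[symmetric]) auto
      show "\<bar>Re (g t)\<bar> \<le> 2" for t using gB[of t] abs_Re_le_cmod[of "g t"] by linarith
    qed (use K that gcont in \<open>auto intro!: continuous_intros\<close>)
    show "Im (g t) = 0"
    proof (rule laplace_transform_eq_0[of "\<lambda>t. Im (g t)" 2 K])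
      show "(LBINT t:{0<..}. exp (- (real k * t)) * Im (g t)) = 0" if "k \<ge> K" for k
        using arg_cong[OF g0[OF that], of Im] gint[OF that]
        unfolding set_lebesgue_integral_def set_integrable_def
        by (subst (asm) integral_Im[symmetric]) auto
      show "\<bar>Im (g t)\<bar> \<le> 2" for t using gB[of t] abs_Im_le_cmod[of "g t"] by linarith
    qed (use K that gcont in \<open>auto intro!: continuous_intros\<close>)
  qed
  then have neg: "char M (- t) = char N (- t)" if "t > 0" for t
    using that by (auto simp: g_def complex_eq_iff)
  fix t :: real
  consider "t < 0" | "t = 0" | "t > 0" by (rule linorder_cases)
  then show "char M t = char N t"
  proof cases
    case 1
    then show ?thesis using neg[of "- t"] by simp
  next
    case 2
    then show ?thesis by (simp add: M.char_zero N.char_zero)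
  next
    case 3
    have "char L (- u) = cnj (char L u)" for L and u :: real
      unfolding char_def by (subst Bochner_Integration.integral_cnj[symmetric]) (simp add: exp_cnj)
    then show ?thesis using neg[OF 3] by (metis complex_cnj_cnj)
  qed
qed

subsection \<open>The semicircle distribution\<close>

text \<open>The roots of \<open>u^2 - z u + 1\<close> have product 1. If both had modulus 1 they
  would be conjugate and \<open>z\<close>, their sum, real.\<close>

lemma zhukovsky_preimage:
  assumes z: "Im z \<noteq> 0"
  shows "\<exists>u. cmod u < 1 \<and> u \<noteq> 0 \<and> z = u + 1 / u"
proof -
  define r where "r = csqrt (z\<^sup>2 - 4)"
  define u1 where "u1 = (z + r) / 2"
  define u2 where "u2 = (z - r) / 2"
  have "r\<^sup>2 = z\<^sup>2 - 4" by (simp add: r_def)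
  then have prod: "u1 * u2 = 1" by (simp add: u1_def u2_def field_simps power2_eq_square)
  have sum: "u1 + u2 = z" by (simp add: u1_def u2_def field_simps)
  have n: "cmod u1 * cmod u2 = 1" using prod by (simp flip: norm_mult)
  have "cmod u1 \<noteq> 1"
  proof
    assume 1: "cmod u1 = 1"
    then have "cnj u1 * u1 = 1" using complex_norm_square[of u1] by (simp add: mult.commute)
    then have "u2 = cnj u1" using prod by (metis mult.commute mult.left_commute mult.right_neutral)
    then show False using sum z by auto
  qed
  then consider "cmod u1 < 1" | "cmod u2 < 1"
    using n by (metis less_linear linorder_neqE_linordered_idom mult_less_cancel_left2
        norm_ge_zero norm_mult prod zero_less_norm_iff mult_zero_left zero_neq_one one_less_mult)
  then show ?thesis
  proof cases
    case 1
    have "u1 \<noteq> 0" using prod by auto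
    moreover from this have "1 / u1 = u2" using prod by (simp add: divide_eq_eq mult.commute)
    ultimately show ?thesis using 1 sum by (intro exI[of _ u1]) auto
  next
    case 2
    have "u2 \<noteq> 0" using prod by auto
    moreover from this have "1 / u2 = u1" using prod by (simp add: divide_eq_eq)
    ultimately show ?thesis using 2 sum by (intro exI[of _ u2]) (auto simp: add.commute)
  qed
qed

text \<open>Primitives from the product-to-sum formula; the general one divides by \<open>k\<close>,
  so \<open>k = 0\<close> is integrated separately.\<close>

lemma integral_sin_sin:
  "((\<lambda>\<theta>. sin \<theta> * sin (real (Suc k) * \<theta>)) has_integral (if k = 0 then pi / 2 else 0)) {0..pi}"
proof (cases "k = 0")
  case True
  have "((\<lambda>\<theta>. sin \<theta> * sin \<theta>) has_integral ((pi / 2 - sin pi * cos pi / 2) - (0 / 2 - sin 0 * cos 0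
      / 2))) {0..pi}"
  proof (rule fundamental_theorem_of_calculus)
    fix x :: real
    have c: "cos x * cos x = 1 - sin x * sin x"
      using sin_cos_squared_add[of x] by (simp add: power2_eq_square eq_diff_eq add.commute)
    have "1 / 2 - (cos x * cos x - sin x * sin x) / 2 = sin x * sin x"
      unfolding c by (simp add: field_simps)
    then have "((\<lambda>\<theta>. \<theta> / 2 - sin \<theta> * cos \<theta> / 2) has_real_derivative sin x * sin x) (at x)"
      by (rule DERIV_cong[rotated]) (auto intro!: derivative_eq_intros)
    then show "((\<lambda>\<theta>. \<theta> / 2 - sin \<theta> * cos \<theta> / 2) has_vector_derivative sin x * sin x) (at x within
        {0..pi})"
      by (simp add: has_real_derivative_iff_has_vector_derivative has_vector_derivative_at_within)
  qed simp
  then show ?thesis using True by simp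
next
  case False
  define F where "F \<theta> = sin (real k * \<theta>) / (2 * real k) - sin (real (k + 2) * \<theta>) / (2 * real (k
      + 2))" for \<theta>
  have "((\<lambda>\<theta>. sin \<theta> * sin (real (Suc k) * \<theta>)) has_integral (F pi - F 0)) {0..pi}"
  proof (rule fundamental_theorem_of_calculus)
    fix x :: real
    have s: "sin x * sin (real (Suc k) * x) = cos (real k * x) / 2 - cos (real (k + 2) * x) / 2"
      using cos_diff[of "real (Suc k) * x" x] cos_add[of "real (Suc k) * x" x]
      by (simp add: algebra_simps)
    have "(F has_real_derivative (cos (real k * x) / 2 - cos (real (k + 2) * x) / 2)) (at x)"
    proof -
      have "((\<lambda>\<theta>. sin (a * \<theta>) / (2 * a)) has_real_derivative cos (a * x) / 2) (at x)" if "a \<noteq> 0"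
          for a
        using that by (auto intro!: derivative_eq_intros)
      from DERIV_diff[OF this[of "real k"] this[of "real (k + 2)"]] False show ?thesis
        unfolding F_def by simp
    qed
    then show "(F has_vector_derivative sin x * sin (real (Suc k) * x)) (at x within {0..pi})"
      unfolding s by (simp add: has_real_derivative_iff_has_vector_derivative
          has_vector_derivative_at_within)
  qed simp
  moreover have "F pi = 0" "F 0 = 0"
    unfolding F_def using sin_npi[of k] sin_npi[of "k + 2"] by simp_all
  ultimately show ?thesis using False by simp
qed

text \<open>Truncated generating function of the Chebyshev polynomials of the second kind,
  multiplied by \<open>sin \<theta>\<close>; the last two terms are the remainder, of order
  \<open>|v|^n\<close> for \<open>|v| < 1\<close>.\<close>

lemma sin_generating_function:
  fixes v :: complex
  shows "(1 - 2 * v * of_real (cos \<theta>) + v\<^sup>2) * (\<Sum>k<n. v ^ k * of_real (sin (real (Suc k) * \<theta>)))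
    = of_real (sin \<theta>) - v ^ n * of_real (sin (real (Suc n) * \<theta>))
        + v ^ Suc n * of_real (sin (real n * \<theta>))"
proof (induction n)
  case (Suc n)
  have "sin (real (Suc (Suc n)) * \<theta>) + sin (real n * \<theta>) = 2 * cos \<theta> * sin (real (Suc n) * \<theta>)"
    using sin_add[of "real (Suc n) * \<theta>" \<theta>] sin_diff[of "real (Suc n) * \<theta>" \<theta>]
        by (simp add: algebra_simps)
  then have s: "complex_of_real (sin (real (Suc (Suc n)) * \<theta>))
      = 2 * of_real (cos \<theta>) * of_real (sin (real (Suc n) * \<theta>)) - of_real (sin (real n * \<theta>))"
    by (metis (no_types, lifting) add_diff_cancel_right' of_real_diff of_real_mult of_real_numeral)
  show ?case
    unfolding sum.lessThan_Suc distrib_left Suc s by (simp add: algebra_simps power2_eq_square)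
qed simp

text \<open>The denominator factors as
  \<open>(1 - v e^(i \<theta>)) (1 - v e^(-i \<theta>))\<close>.\<close>

lemma norm_chebyshev_denominator:
  fixes v :: complex
  assumes "cmod v < 1"
  shows "(1 - cmod v)\<^sup>2 \<le> cmod (1 - 2 * v * of_real (cos \<theta>) + v\<^sup>2)"
proof -
  have "1 - 2 * v * of_real (cos \<theta>) + v\<^sup>2 = (1 - v * cis \<theta>) * (1 - v * cis (- \<theta>))"
    by (simp add: algebra_simps power2_eq_square cis_mult complex_eq_iff)
  moreover have "1 - cmod v \<le> cmod (1 - v * cis a)" for a
    using norm_triangle_ineq2[of 1 "v * cis a"] by (simp add: norm_mult)
  then have "(1 - cmod v) * (1 - cmod v) \<le> cmod (1 - v * cis \<theta>) * cmod (1 - v * cis (- \<theta>))"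
    using assms by (intro mult_mono) auto
  ultimately show ?thesis by (simp add: norm_mult power2_eq_square)
qed

text \<open>The substitution \<open>x = - 2 cos \<theta>\<close>, increasing on
  \<open>[0, pi]\<close>, turns \<open>z - x\<close> into \<open>q \<theta> / u\<close> with
  \<open>v = - u\<close>, the sign coming from that of \<open>x\<close>. Expanding
  \<open>sin \<theta> / q \<theta>\<close> in sines and using their orthogonality leaves the term
  \<open>k = 0\<close>, whose integral is \<open>u\<close>.\<close>

lemma cauchy_transform_semicircle:
  assumes u: "cmod u < 1" "u \<noteq> 0" and z: "Im (u + 1 / u) \<noteq> 0"
  shows "cauchy_transform semicircle_distribution (u + 1 / u) = u"
proof -
  define z where "z = u + 1 / u"
  define f where "f x = of_real (1 / (2 * pi) * sqrt (4 - x\<^sup>2)) * (1 / (z - complex_of_real x))"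
      for x :: real
  have nz: "z - complex_of_real x \<noteq> 0" for x using assms(3) by (auto simp: z_def complex_eq_iff)
  have fcont: "continuous_on {-2..2} f"
    unfolding f_def using nz by (intro continuous_intros) auto
  have "cauchy_transform semicircle_distribution z
      = (LINT x|lborel. (1 / (2 * pi) * sqrt (4 - x\<^sup>2) * indicator {-2..2} x) *\<^sub>R (1 / (z -
          complex_of_real x)))"
    unfolding cauchy_transform_def semicircle_distribution_def
  proof (rule integral_density)
    show "AE x in lborel. 0 \<le> 1 / (2 * pi) * sqrt (4 - x\<^sup>2) * indicator {-2..2::real} x"
    proof (intro AE_I2)
      fix x :: real
      have "0 \<le> 4 - x\<^sup>2" if "x \<in> {-2..2}" using that abs_le_square_iff[of x 2] by auto
      then show "0 \<le> 1 / (2 * pi) * sqrt (4 - x\<^sup>2) * indicator {-2..2} x"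
        by (auto simp: indicator_def)
    qed
  qed measurable
  also have "\<dots> = (LBINT x:{-2..2}. f x)"
    unfolding set_lebesgue_integral_def
    by (intro Bochner_Integration.integral_cong refl) (auto simp: f_def indicator_def
        scaleR_conv_of_real)
  also have "\<dots> = integral {-2..2} f"
    by (intro set_borel_integral_eq_integral borel_integrable_atLeastAtMost' fcont)
  finally have G: "cauchy_transform semicircle_distribution z = integral {-2..2} f" .
  define v where "v = - u"
  define q where "q \<theta> = 1 - 2 * v * of_real (cos \<theta>) + v\<^sup>2" for \<theta> :: real
  define h where "h \<theta> = of_real (2 / pi) * u * of_real (sin \<theta>) * of_real (sin \<theta>) / q \<theta>"
      for \<theta> :: real
  have v: "cmod v < 1" using u by (simp add: v_def)
  have q_le: "(1 - cmod v)\<^sup>2 \<le> cmod (q \<theta>)" for \<theta>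
    unfolding q_def by (rule norm_chebyshev_denominator[OF v])
  have q0: "q \<theta> \<noteq> 0" for \<theta>
  proof -
    have "0 < (1 - cmod v)\<^sup>2" using v by simp
    then show ?thesis using q_le[of \<theta>] by auto
  qed
  have "((\<lambda>\<theta>. (2 * sin \<theta>) *\<^sub>R f (- 2 * cos \<theta>)) has_integral (integral {- 2 * cos 0..- 2 * cos pi}
      f)) {0..pi}"
  proof (rule has_integral_substitution[where c="-2" and d=2])
    show "(\<lambda>\<theta>. - 2 * cos \<theta>) ` {0..pi} \<subseteq> {-2..2}"
    proof (rule image_subsetI)
      show "- 2 * cos \<theta> \<in> {-2..2}" for \<theta> :: real
        using cos_ge_minus_one[of \<theta>] cos_le_one[of \<theta>] unfolding atLeastAtMost_iff by linarith
    qed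
    show "((\<lambda>\<theta>. - 2 * cos \<theta>) has_real_derivative 2 * sin x) (at x within {0..pi})" for x
      by (auto intro!: derivative_eq_intros)
  qed (use fcont in auto)
  then have sub: "((\<lambda>\<theta>. (2 * sin \<theta>) *\<^sub>R f (- 2 * cos \<theta>)) has_integral (integral {-2..2} f)) {0..pi}"
    by simp
  have h: "(h has_integral (integral {-2..2} f)) {0..pi}"
  proof (rule has_integral_eq[OF _ sub])
    fix \<theta> assume "\<theta> \<in> {0..pi}"
    then have "sin \<theta> \<ge> 0" by (auto intro: sin_ge_zero)
    moreover have "4 - (- 2 * cos \<theta>)\<^sup>2 = (2 * sin \<theta>)\<^sup>2"
      by (simp add: power_mult_distrib sin_squared_eq algebra_simps)
    ultimately have sq: "sqrt (4 - (- 2 * cos \<theta>)\<^sup>2) = 2 * sin \<theta>" by (simp only: real_sqrt_abs)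
    have "z - complex_of_real (- 2 * cos \<theta>) = q \<theta> / u"
      using u by (simp add: z_def q_def v_def field_simps power2_eq_square)
    then show "(2 * sin \<theta>) *\<^sub>R f (- 2 * cos \<theta>) = h \<theta>"
      unfolding f_def sq h_def by (simp add: scaleR_conv_of_real field_simps)
  qed
  define P where "P N \<theta>
      = (\<Sum>k<N. of_real (2 / pi) * u * v ^ k * of_real (sin \<theta> * sin (real (Suc k) * \<theta>)))" for N \<theta>
  have P: "(P (Suc N) has_integral u) {0..pi}" for N
  proof -
    have "((\<lambda>\<theta>. of_real (2 / pi) * u * v ^ k * of_real (sin \<theta> * sin (real (Suc k) * \<theta>)))
        has_integral (of_real (2 / pi) * u * v ^ k * of_real (if k
            = 0 then pi / 2 else 0))) {0..pi}" for k
      using has_integral_linear[OF integral_sin_sin bounded_linear_of_real, of k]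
      by (intro has_integral_mult_right) (simp add: o_def)
    then have "(P (Suc N) has_integral (\<Sum>k<Suc N. of_real (2 / pi) * u * v ^ k * of_real (if k
        = 0 then pi / 2 else 0))) {0..pi}"
      unfolding P_def by (intro has_integral_sum) auto
    also have "(\<Sum>k<Suc N. of_real (2 / pi) * u * v ^ k * of_real (if k = 0 then pi / 2 else 0))
        = (\<Sum>k<Suc N. if k = 0 then u else 0)"
      by (intro sum.cong) auto
    also have "\<dots> = u" by simp
    finally show ?thesis .
  qed
  define C where "C = 2 / pi * (2 / (1 - cmod v)\<^sup>2)"
  have diff: "cmod (h \<theta> - P N \<theta>) \<le> C * cmod v ^ N" for N \<theta>
  proof -
    define T where "T = (\<Sum>k<N. v ^ k * of_real (sin (real (Suc k) * \<theta>)))"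
    define r where "r = v ^ N * of_real (sin (real (Suc N) * \<theta>)) - v ^ Suc N * of_real (sin (real
        N * \<theta>))"
    have "q \<theta> * T = of_real (sin \<theta>) - r"
      using sin_generating_function[of v \<theta> N] by (simp add: q_def T_def r_def)
    then have T: "of_real (sin \<theta>) / q \<theta> - T = r / q \<theta>" using q0[of \<theta>] by (simp add: field_simps)
    have "h \<theta> - P N \<theta> = of_real (2 / pi) * u * of_real (sin \<theta>) * (of_real (sin \<theta>) / q \<theta> - T)"
      by (simp add: h_def P_def T_def right_diff_distrib sum_distrib_left mult_ac)
    also have "cmod \<dots> = 2 / pi * cmod u * \<bar>sin \<theta>\<bar> * (cmod r / cmod (q \<theta>))"
      unfolding T by (simp add: norm_mult norm_divide)
    also have "\<dots> \<le> 2 / pi * 1 * 1 * (2 * cmod v ^ N / (1 - cmod v)\<^sup>2)"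
    proof (intro mult_mono frac_le)
      have a: "cmod (v ^ N * of_real (sin (real (Suc N) * \<theta>))) \<le> cmod v ^ N * 1"
        unfolding norm_mult norm_power by (intro mult_left_mono) auto
      have b: "cmod (v ^ Suc N * of_real (sin (real N * \<theta>))) \<le> cmod v ^ N * 1"
        unfolding norm_mult norm_power using v by (intro mult_mono power_decreasing) auto
      show "cmod r \<le> 2 * cmod v ^ N"
        unfolding r_def using norm_triangle_ineq4[of "v ^ N * of_real (sin (real (Suc N) * \<theta>))" "v
            ^ Suc N * of_real (sin (real N * \<theta>))"] a b
        by linarith
    qed (use u v q_le in \<open>auto intro!: divide_nonneg_nonneg\<close>)
    finally show ?thesis by (simp add: C_def mult_ac)
  qed
  \<comment> \<open>The left side does not depend on \<open>N\<close>, so the geometric bound forces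
    it to vanish.\<close>
  have bound: "cmod (integral {-2..2} f - u) \<le> C * cmod v ^ Suc N * pi" for N
  proof -
    have int: "((\<lambda>\<theta>. h \<theta> - P (Suc N) \<theta>) has_integral (integral {-2..2} f - u)) {0..pi}"
      by (intro has_integral_diff h P)
    have "cmod (integral {-2..2} f - u) \<le> C * cmod v ^ Suc N * measure lborel {0..pi}"
      by (rule has_integral_bound_real[OF _ finite.emptyI int diff]) (simp add: C_def)
    then show ?thesis by simp
  qed
  have "(\<lambda>N. C * cmod v ^ Suc N * pi) \<longlonglongrightarrow> C * 0 * pi"
    using v by (intro tendsto_intros LIMSEQ_Suc LIMSEQ_realpow_zero) auto
  then have "(\<lambda>N. C * cmod v ^ Suc N * pi) \<longlonglongrightarrow> 0" by simp
  then have "cmod (integral {-2..2} f - u) \<le> 0"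
    by (rule LIMSEQ_le_const) (use bound in auto)
  then show ?thesis using G by (simp add: z_def)
qed

subsection \<open>Free convolution with the semicircle distribution\<close>

text \<open>The distance 7 is 6, the radius of the fixed point argument for \<open>N\<close>, plus
  1, a bound for \<open>cmod u\<close>. Above height 40 there is room to pass from slope 1 to slope
  2.\<close>

lemma trunc_cone_add_small:
  assumes "cmod (\<zeta> - w) \<le> 7" "w \<in> trunc_cone 1 40"
  shows "\<zeta> \<in> trunc_cone 2 10"
  using assms abs_Re_le_cmod[of "\<zeta> - w"] abs_Im_le_cmod[of "\<zeta> - w"]
  unfolding trunc_cone_def by auto

section \<open>Inverting the Cauchy transform of a law with second moment at most 1\<close>

locale unit_variance_distribution = real_distribution M for M :: "real measure" +
  assumes sq_int: "integrable M (\<lambda>x. x\<^sup>2)" and sq_le: "(LINT x|M. x\<^sup>2) \<le> 1"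
begin

lemma abs_int: "integrable M (\<lambda>x. \<bar>x\<bar>)" and abs_le: "(LINT x|M. \<bar>x\<bar>) \<le> 1"
proof -
  have b: "\<bar>x\<bar> \<le> (1 + x\<^sup>2) / 2" for x :: real
    using zero_le_power2[of "\<bar>x\<bar> - 1"] by (simp add: power2_diff)
  have i: "integrable M (\<lambda>x. (1 + x\<^sup>2) / 2)" using sq_int by simp
  show 1: "integrable M (\<lambda>x. \<bar>x\<bar>)"
    by (rule Bochner_Integration.integrable_bound[OF i]) (use b in \<open>auto simp: abs_le_iff\<close>)
  have "(LINT x|M. \<bar>x\<bar>) \<le> (LINT x|M. (1 + x\<^sup>2) / 2)"
    by (intro integral_mono 1 i b)
  also have "\<dots> = (1 + (LINT x|M. x\<^sup>2)) / 2" using sq_int prob_space by simp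
  finally show "(LINT x|M. \<bar>x\<bar>) \<le> 1" using sq_le by simp
qed

lemma kernel_frac_le: "Im z > 0 \<Longrightarrow> cmod (of_real x / (z - of_real x)) \<le> \<bar>x\<bar> / Im z"
  using abs_Im_le_cmod[of "z - complex_of_real x"] by (simp add: norm_divide frac_le)

lemma kernel_frac_int: "Im z > 0 \<Longrightarrow> integrable M (\<lambda>x. of_real x / (z - of_real x))"
  by (rule Bochner_Integration.integrable_bound[OF integrable_divide[OF abs_int, of "Im z"]])
    (auto intro!: always_eventually order_trans[OF kernel_frac_le])

lemma kernel_frac_integral_le:
  assumes z: "Im z > 0"
  shows "cmod (LINT x|M. of_real x / (z - of_real x)) \<le> 1 / Im z"
proof -
  have "cmod (LINT x|M. of_real x / (z - of_real x))
      \<le> (LINT x|M. cmod (of_real x / (z - of_real x)))"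
    by (rule integral_norm_bound)
  also have "\<dots> \<le> (LINT x|M. \<bar>x\<bar> / Im z)"
    using z by (intro integral_mono integrable_norm kernel_frac_int kernel_frac_le
        integrable_divide abs_int)
  also have "\<dots> = (LINT x|M. \<bar>x\<bar>) / Im z" by simp
  also have "\<dots> \<le> 1 / Im z" using z abs_le by (intro divide_right_mono) auto
  finally show ?thesis .
qed

text \<open>Since \<open>z / (z - x) - 1 = x / (z - x)\<close>, the first absolute moment controls
  the error.\<close>

lemma cauchy_transform_asymp:
  assumes z: "Im z > 0"
  shows "cmod (z * cauchy_transform M z - 1) \<le> 1 / Im z"
proof -
  have "z * cauchy_transform M z - 1 = (LINT x|M. z * (1 / (z - of_real x)) - 1)"
    unfolding cauchy_transform_def using z prob_space
    by (subst Bochner_Integration.integral_diff) (auto intro!: cauchy_kernel_integrable simp del: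
        times_divide_eq_right)
  also have "\<dots> = (LINT x|M. of_real x / (z - of_real x))"
  proof (intro Bochner_Integration.integral_cong refl)
    fix x
    have "z - complex_of_real x \<noteq> 0" using z by (auto simp: complex_eq_iff)
    then show "z * (1 / (z - of_real x)) - 1 = of_real x / (z - complex_of_real x)"
        by (simp add: field_simps)
  qed
  finally show ?thesis using kernel_frac_integral_le[OF z] by simp
qed

text \<open>For distinct \<open>z\<close> and \<open>w\<close>, equality would make the integral of
  \<open>z w / ((z - x) (w - x))\<close> vanish. This integrand is
  \<open>(1 + a x) (1 + b x)\<close>, and height 3 bounds the mean of
  \<open>a x + b x + a x * b x\<close> by \<open>1/3 + 1/3 + 1/9 < 1\<close>.\<close>

lemma cauchy_transform_inj:
  assumes z: "Im z \<ge> 3" and w: "Im w \<ge> 3" and eq: "cauchy_transform M z = cauchy_transform M w"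
  shows "z = w"
proof (rule ccontr)
  assume ne: "z \<noteq> w"
  define a where "a x = of_real x / (z - complex_of_real x)" for x
  define b where "b x = of_real x / (w - complex_of_real x)" for x
  have z0: "Im z > 0" and w0: "Im w > 0" using z w by auto
  have nz: "z - complex_of_real x \<noteq> 0" "w - complex_of_real x \<noteq> 0" for x
    using z0 w0 by (auto simp: complex_eq_iff)
  have ia: "integrable M a" and ib: "integrable M b" unfolding a_def b_def
      using z0 w0 kernel_frac_int by auto
  have ab_le: "cmod (a x * b x) \<le> x\<^sup>2 / 9" for x
  proof -
    have "\<bar>x\<bar> / Im z \<le> \<bar>x\<bar> / 3" "\<bar>x\<bar> / Im w \<le> \<bar>x\<bar> / 3"
      by (rule divide_left_mono; use z w in simp)+
    then have "cmod (a x) \<le> \<bar>x\<bar> / 3" "cmod (b x) \<le> \<bar>x\<bar> / 3"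
      unfolding a_def b_def using kernel_frac_le[OF z0, of x] kernel_frac_le[OF w0, of x]
          by linarith+
    then have "cmod (a x) * cmod (b x) \<le> (\<bar>x\<bar> / 3) * (\<bar>x\<bar> / 3)" by (intro mult_mono) auto
    then show ?thesis by (simp add: norm_mult power2_eq_square flip: abs_mult)
  qed
  have iab: "integrable M (\<lambda>x. a x * b x)"
  proof (rule Bochner_Integration.integrable_bound[OF integrable_divide[OF sq_int, of 9]])
    show "(\<lambda>x. a x * b x) \<in> borel_measurable M" unfolding a_def b_def by measurable
  qed (use ab_le in auto)
  have "cmod (LINT x|M. a x * b x) \<le> (LINT x|M. cmod (a x * b x))" by (rule integral_norm_bound)
  also have "\<dots> \<le> (LINT x|M. x\<^sup>2 / 9)"
    by (intro integral_mono integrable_norm iab ab_le integrable_divide sq_int)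
  also have "\<dots> \<le> 1 / 9" using sq_le by simp
  finally have 3: "cmod (LINT x|M. a x * b x) \<le> 1 / 9" .
  have third: "1 / Im z \<le> 1 / 3" "1 / Im w \<le> 1 / 3"
    by (rule divide_left_mono; use z w in simp)+
  have 1: "cmod (LINT x|M. a x) \<le> 1 / 3"
    unfolding a_def using kernel_frac_integral_le[OF z0] third by linarith
  have 2: "cmod (LINT x|M. b x) \<le> 1 / 3"
    unfolding b_def using kernel_frac_integral_le[OF w0] third by linarith
  have "(LINT x|M. 1 / (z - complex_of_real x) * (1 / (w - complex_of_real x))) = 0"
    using cauchy_transform_diff[OF z0 w0] eq ne by simp
  then have "0 = z * w * (LINT x|M. 1 / (z - complex_of_real x) * (1 / (w - complex_of_real x)))"
      by simp
  also have "\<dots> = (LINT x|M. z * w * (1 / (z - complex_of_real x) * (1 / (w - complex_of_real x))))"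
    by (rule integral_mult_right_zero[symmetric])
  also have "\<dots> = (LINT x|M. 1 + a x + b x + a x * b x)"
  proof (intro Bochner_Integration.integral_cong refl)
    show "z * w * (1 / (z - complex_of_real x) * (1 / (w - complex_of_real x))) = 1 + a x + b x
        + a x * b x" for x
    proof -
      have "z * (1 / (z - complex_of_real x)) = 1 + a x" "w * (1 / (w - complex_of_real x)) = 1
          + b x"
        unfolding a_def b_def using nz[of x] by (simp_all add: field_simps)
      then have "(z * (1 / (z - complex_of_real x))) * (w * (1 / (w - complex_of_real x))) = (1
          + a x) * (1 + b x)"
        by (simp only:)
      then show ?thesis by (simp only: algebra_simps mult_1)
    qed
  qed
  also have "\<dots> = 1 + (LINT x|M. a x) + (LINT x|M. b x) + (LINT x|M. a x * b x)"
    using ia ib iab prob_space by simp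
  finally have "(LINT x|M. a x) + (LINT x|M. b x) + (LINT x|M. a x * b x) = - 1"
    by (simp add: eq_neg_iff_add_eq_0 add_ac)
  then have "1 = cmod ((LINT x|M. a x) + (LINT x|M. b x) + (LINT x|M. a x * b x))" by simp
  also have "\<dots> \<le> 1 / 3 + 1 / 3 + 1 / 9"
    by (intro order_trans[OF norm_triangle_ineq] add_mono 1 2 3)
  finally show False by simp
qed

text \<open>On a cone the quotient \<open>cmod z / Im z\<close> is bounded, so there the reciprocal
  of the transform is a bounded perturbation of the identity.\<close>

lemma cauchy_transform_nz:
  assumes z: "Im z \<ge> 2" shows "cauchy_transform M z \<noteq> 0"
    and "cmod (z - 1 / cauchy_transform M z) \<le> 2 * cmod z / Im z"
proof -
  have b: "cmod (z * cauchy_transform M z - 1) \<le> 1 / Im z" using z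
      by (intro cauchy_transform_asymp) auto
  moreover have "1 / Im z \<le> 1 / 2" using z by (simp add: divide_simps)
  ultimately have "cmod (z * cauchy_transform M z - 1) \<le> 1 / 2" by linarith
  then have lo: "cmod (z * cauchy_transform M z) \<ge> 1 / 2"
    using norm_triangle_ineq3[of "z * cauchy_transform M z" 1] by simp
  then show nz: "cauchy_transform M z \<noteq> 0" by auto
  have z0: "z \<noteq> 0" using z by auto
  have "z - 1 / cauchy_transform M z
      = z * (z * cauchy_transform M z - 1) / (z * cauchy_transform M z)"
    using nz z0 by (simp add: field_simps)
  also have "cmod \<dots> = cmod z * cmod (z * cauchy_transform M z - 1) / cmod (z * cauchy_transform M
      z)"
    by (simp add: norm_mult norm_divide)
  also have "\<dots> \<le> cmod z * (1 / Im z) / (1 / 2)"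
    using b lo z by (intro frac_le mult_left_mono) auto
  finally show "cmod (z - 1 / cauchy_transform M z) \<le> 2 * cmod z / Im z" by (simp add: mult.commute)
qed

text \<open>A preimage of \<open>1 / w\<close> is a fixed point of \<open>H\<close>. In the cone of
  slope 2 one has \<open>cmod \<zeta> <= 3 * Im \<zeta>\<close>, so the perturbation is at most
  \<open>2 * 3 = 6\<close>; \<open>H\<close> maps the ball of radius 6 about \<open>w\<close> into
  itself and Brouwer's theorem applies.\<close>

lemma cauchy_transform_surj:
  assumes w: "w \<in> trunc_cone 1 40"
  shows "\<exists>v. cmod (v - w) \<le> 6 \<and> cauchy_transform M v = 1 / w"
proof -
  have cone: "\<zeta> \<in> trunc_cone 2 10" if "\<zeta> \<in> cball w 6" for \<zeta>
    using that w by (intro trunc_cone_add_small[of _ w]) (auto simp: dist_norm norm_minus_commute)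
  have Imz: "Im \<zeta> > 10" and mod: "cmod \<zeta> \<le> 3 * Im \<zeta>" if "\<zeta> \<in> cball w 6" for \<zeta>
    using cone[OF that] cmod_le[of \<zeta>] by (auto simp: trunc_cone_def)
  define H where "H \<zeta> = w + (\<zeta> - 1 / cauchy_transform M \<zeta>)" for \<zeta>
  have "continuous_on (cball w 6) (cauchy_transform M)"
    by (rule continuous_on_subset[OF cauchy_transform_continuous]) (use Imz in fastforce)
  then have "continuous_on (cball w 6) H"
    unfolding H_def using cauchy_transform_nz(1) Imz by (intro continuous_intros) fastforce+
  moreover have "H \<in> cball w 6 \<rightarrow> cball w 6"
  proof
    fix \<zeta> assume z: "\<zeta> \<in> cball w 6"
    have "cmod (\<zeta> - 1 / cauchy_transform M \<zeta>) \<le> 2 * cmod \<zeta> / Im \<zeta>"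
      using Imz[OF z] by (intro cauchy_transform_nz(2)) auto
    also have "\<dots> \<le> 6" using Imz[OF z] mod[OF z] by (simp add: divide_le_eq)
    finally show "H \<zeta> \<in> cball w 6" by (simp add: H_def dist_norm norm_minus_commute)
  qed
  ultimately obtain v where v: "v \<in> cball w 6" "H v = v"
    using brouwer[of "cball w 6" H] by (auto simp: convex_cball)
  then have "1 / cauchy_transform M v = w" by (simp add: H_def algebra_simps)
  then have "cauchy_transform M v = 1 / w" by (auto simp: field_simps)
  then show ?thesis using v by (auto simp: dist_norm norm_minus_commute)
qed

end

lemma unit_variance_std_normal: "unit_variance_distribution std_normal_distribution"
proof -
  interpret real_distribution std_normal_distribution by (rule real_dist_normal_dist)
  show ?thesis
    by unfold_locales (use std_normal_distribution_even_moments[of 1] in \<open>simp_all add: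
        fact_numeral\<close>)
qed

lemma semicircle_inj: "inj_on (cauchy_transform semicircle_distribution) {z. Im z > 0}"
proof (rule inj_onI)
  fix z w assume zw: "z \<in> {z. Im z > 0}" "w \<in> {z. Im z > 0}"
    and eq: "cauchy_transform semicircle_distribution z
        = cauchy_transform semicircle_distribution w"
  obtain u where u: "cmod u < 1" "u \<noteq> 0" "z = u + 1 / u" using zhukovsky_preimage[of z] zw by auto
  obtain u' where u': "cmod u' < 1" "u' \<noteq> 0" "w = u' + 1 / u'" using zhukovsky_preimage[of w] zw
      by auto
  have "cauchy_transform semicircle_distribution z = u"
    using cauchy_transform_semicircle[OF u(1,2)] zw u(3) by simp
  moreover have "cauchy_transform semicircle_distribution w = u'"
    using cauchy_transform_semicircle[OF u'(1,2)] zw u'(3) by simp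
  ultimately show "z = w" using eq u u' by simp
qed

section \<open>From the Pastur equation to the free convolution\<close>

locale pastur_distribution = \<rho>: real_distribution \<rho> + N: unit_variance_distribution N
  for \<rho> N :: "real measure" +
  assumes pastur: "Im z > 0 \<Longrightarrow> cauchy_transform \<rho> z = cauchy_transform N (z - cauchy_transform \<rho> z)"
begin

text \<open>The Pastur equation passes the question to \<open>N\<close>: both points are shifted by
  the same value \<open>?u\<close>, and \<open>Im ?u <= 0\<close> does not lower their
  height.\<close>

lemma inj_\<rho>:
  assumes "Im z \<ge> 3" "Im w \<ge> 3" "cauchy_transform \<rho> z = cauchy_transform \<rho> w"
  shows "z = w"
proof -
  let ?u = "cauchy_transform \<rho> z"
  have Iu: "Im ?u \<le> 0" by (rule \<rho>.Im_cauchy_transform_le) (use assms(1) in simp)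
  have eq: "cauchy_transform N (z - ?u) = cauchy_transform N (w - ?u)"
  proof -
    have "cauchy_transform \<rho> z = cauchy_transform N (z - cauchy_transform \<rho> z)"
      "cauchy_transform \<rho> w = cauchy_transform N (w - cauchy_transform \<rho> w)"
      by (rule pastur; use assms(1,2) in simp)+
    then show ?thesis using assms(3) by metis
  qed
  have "z - ?u = w - ?u"
    by (rule N.cauchy_transform_inj[OF _ _ eq]) (use Iu assms(1,2) in simp_all)
  then show ?thesis by simp
qed

text \<open>Both \<open>u\<close> and the transform of \<open>\<rho>\<close> at \<open>v + u\<close>
  are fixed points of \<open>s \<mapsto> cauchy_transform N (v + u - s)\<close>, and above height 1
  the Lipschitz bound for \<open>N\<close> is a strict contraction.\<close>

lemma value_\<rho>:
  assumes v: "cauchy_transform N v = u" "Im v > 1" "Im (v + u) > 1"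
  shows "cauchy_transform \<rho> (v + u) = u"
proof (rule ccontr)
  define s where "s = cauchy_transform \<rho> (v + u)"
  assume "cauchy_transform \<rho> (v + u) \<noteq> u"
  then have ne: "cmod (u - s) > 0" by (simp add: s_def)
  have "Im s \<le> 0" unfolding s_def using v by (intro \<rho>.Im_cauchy_transform_le) auto
  then have I: "Im (v + u - s) > 1" using v by simp
  have "s = cauchy_transform N (v + u - s)" unfolding s_def using v by (intro pastur) auto
  then have "cmod (s - u) = cmod (cauchy_transform N (v + u - s) - cauchy_transform N v)"
    using v(1) by metis
  also have "\<dots> \<le> cmod (v + u - s - v) / (Im (v + u - s) * Im v)"
    using v I by (intro N.cauchy_transform_lipschitz) auto
  also have "\<dots> < cmod (u - s) / 1"
  proof -
    have "1 < Im (v + u - s) * Im v" using I v by (intro less_1_mult) auto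
    then show ?thesis using ne by (simp add: divide_less_eq)
  qed
  finally show False by (simp add: norm_minus_commute)
qed

text \<open>The inverse functions at \<open>u\<close> are \<open>u + 1 / u\<close> for the
  semicircle, \<open>v\<close> for \<open>N\<close> and, by \<open>value_\<rho>\<close>,
  \<open>v + u\<close> for \<open>\<rho>\<close>. For \<open>u\<close> in the angle of slope 1 and
  height 40 all three points stay in the cone of slope 2 and height 10, where the transforms are
  injective.\<close>

lemma is_free_convolution_semicircle: "is_free_convolution semicircle_distribution N \<rho>"
proof -
  let ?U = "trunc_cone 2 10" and ?D = "stolz_angle 1 40"
  have pre: "\<exists>v. u + 1 / u \<in> ?U \<and> v \<in> ?U \<and> v + u \<in> ?U
      \<and> cauchy_transform semicircle_distribution (u + 1 / u) = u
      \<and> cauchy_transform N v = u \<and> cauchy_transform \<rho> (v + u) = u" if uD: "u \<in> ?D" for u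
  proof -
    obtain w where w: "w \<in> trunc_cone 1 40" "u = 1 / w" using uD unfolding stolz_angle_def by blast
    have Iw: "Im w > 40" using w by (simp add: trunc_cone_def)
    then have w0: "w \<noteq> 0" by auto
    have "cmod w > 40" using Iw abs_Im_le_cmod[of w] by linarith
    then have u: "cmod u < 1" "u \<noteq> 0" "1 / u = w" unfolding w(2) using w0
        by (simp_all add: norm_divide)
    obtain v where v: "cmod (v - w) \<le> 6" "cauchy_transform N v = 1 / w"
      using N.cauchy_transform_surj[OF w(1)] by auto
    have c1: "u + 1 / u \<in> ?U" using u by (intro trunc_cone_add_small[OF _ w(1)]) auto
    have c2: "v \<in> ?U" using v by (intro trunc_cone_add_small[OF _ w(1)]) auto
    have c3: "v + u \<in> ?U"
      using v u norm_triangle_ineq[of "v - w" u]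
          by (intro trunc_cone_add_small[OF _ w(1)]) (auto simp: algebra_simps)
    have "cauchy_transform semicircle_distribution (u + 1 / u) = u"
      using u c1 by (intro cauchy_transform_semicircle) (auto simp: trunc_cone_def)
    moreover have "cauchy_transform \<rho> (v + u) = u"
      using c2 c3 v w by (intro value_\<rho>) (auto simp: trunc_cone_def)
    ultimately show ?thesis using c1 c2 c3 v w by auto
  qed
  have inj: "inj_on (cauchy_transform semicircle_distribution) ?U" "inj_on (cauchy_transform N) ?U"
      "inj_on (cauchy_transform \<rho>) ?U"
  proof -
    show "inj_on (cauchy_transform semicircle_distribution) ?U"
      by (rule inj_on_subset[OF semicircle_inj]) (auto simp: trunc_cone_def)
    show "inj_on (cauchy_transform N) ?U"
      by (rule inj_onI, rule N.cauchy_transform_inj) (auto simp: trunc_cone_def)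
    show "inj_on (cauchy_transform \<rho>) ?U"
      by (rule inj_onI, rule inj_\<rho>) (auto simp: trunc_cone_def)
  qed
  have "\<forall>\<tau>\<in>{semicircle_distribution, N, \<rho>}. cauchy_invertible \<tau> ?U ?D"
  proof -
    have "u \<in> cauchy_transform \<tau> ` ?U" if "u \<in> ?D" "\<tau> \<in> {semicircle_distribution, N, \<rho>}" for u \<tau>
      using pre[OF that(1)] that(2) by (auto intro: image_eqI[OF sym])
    then show ?thesis unfolding cauchy_invertible_def using inj by auto
  qed
  moreover have "R_transform \<rho> ?U u = R_transform semicircle_distribution ?U u + R_transform N ?U u"
    if uD: "u \<in> ?D" for u
  proof -
    obtain v where v: "u + 1 / u \<in> ?U" "v \<in> ?U" "v
        + u \<in> ?U" "cauchy_transform semicircle_distribution (u + 1 / u) = u"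
      "cauchy_transform N v = u" "cauchy_transform \<rho> (v + u) = u"
      using pre[OF uD] by auto
    have "K_transform semicircle_distribution ?U u = u + 1 / u" "K_transform N ?U u
        = v" "K_transform \<rho> ?U u = v + u"
      unfolding K_transform_def using v by (auto intro!: the_inv_into_f_eq inj)
    then show ?thesis by (simp add: R_transform_def)
  qed
  ultimately show ?thesis
    unfolding is_free_convolution_def using \<rho>.real_distribution_axioms
    by (intro conjI exI[of _ 2] exI[of _ 10] exI[of _ 1] exI[of _ 40]) auto
qed

text \<open>The candidate \<open>\<rho>'\<close> comes with unknown cones, so it is compared with
  \<open>\<rho>\<close> at \<open>\<i> * y\<close> for large \<open>y\<close>. If \<open>u\<close>
  is the transform of \<open>\<rho>\<close> there, then \<open>v\<close>, \<open>1 / u\<close> and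
  \<open>u + 1 / u\<close> lie within distance 6 of \<open>\<i> * y\<close>, hence in any prescribed
  cone; additivity of the R-transforms gives back \<open>\<i> * y\<close> as the inverse of
  \<open>\<rho>'\<close> at \<open>u\<close>.\<close>

lemma free_convolution_unique:
  assumes "is_free_convolution semicircle_distribution N \<rho>'"
  shows "\<rho>' = \<rho>"
proof -
  obtain a b c d where pos: "a > 0" "b > 0" "c > 0" "d > 0"
    and inv: "\<forall>\<tau>\<in>{semicircle_distribution, N, \<rho>'}. cauchy_invertible \<tau> (trunc_cone a b)
        (stolz_angle c d)"
    and R: "\<And>u. u \<in> stolz_angle c d \<Longrightarrow> R_transform \<rho>' (trunc_cone a b) u
        = R_transform semicircle_distribution (trunc_cone a b) u + R_transform N (trunc_cone a b) u"
    and \<rho>': "real_distribution \<rho>'"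
    using assms unfolding is_free_convolution_def by blast
  let ?U = "trunc_cone a b"
  \<comment> \<open>The real part of \<open>\<zeta>\<close> is at most 6, so a height above
    \<open>6 / a'\<close> puts it in the cone of slope \<open>a'\<close>; the height itself may drop
    by 6.\<close>
  have near: "\<zeta> \<in> trunc_cone a' b'" if "a' > 0" "cmod (\<zeta> - \<i> * of_real y) \<le> 6" "y > b' + 6" "y > 6
      + 6 / a'" for \<zeta> y a' b'
  proof -
    have r: "\<bar>Re \<zeta>\<bar> \<le> 6" using abs_Re_le_cmod[of "\<zeta> - \<i> * of_real y"] that by simp
    have i: "\<bar>Im \<zeta> - y\<bar> \<le> 6" using abs_Im_le_cmod[of "\<zeta> - \<i> * of_real y"] that by simp
    have "6 / a' < Im \<zeta>" using i that by linarith
    then have "6 < a' * Im \<zeta>" using that by (simp add: divide_less_eq mult.commute)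
    then show ?thesis using r i that by (auto simp: trunc_cone_def)
  qed
  \<comment> \<open>A sum of positive thresholds dominates each of them.\<close>
  define Y where "Y = 3 + (b + 6) + (d + 6) + (6 + 6 / a) + (6 + 6 / c)"
  have "cauchy_transform \<rho>' (\<i> * of_real y) = cauchy_transform \<rho> (\<i> * of_real y)" if y: "y \<ge> Y"
      for y
  proof -
    have ys: "y > 3" "y > b + 6" "y > d + 6" "y > 6 + 6 / a" "y > 6 + 6 / c"
      using y pos unfolding Y_def by (smt (verit) divide_nonneg_pos)+
    define u where "u = cauchy_transform \<rho> (\<i> * of_real y)"
    define v where "v = \<i> * of_real y - u"
    define w where "w = 1 / u"
    have "cmod u \<le> 1 / y" unfolding u_def using \<rho>.cauchy_transform_le[of "\<i> * of_real y"] ys by simp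
    also have "1 / y < 1" using ys by simp
    finally have u: "cmod u < 1" .
    have Iu: "Im u \<le> 0" unfolding u_def using ys by (intro \<rho>.Im_cauchy_transform_le) auto
    have Nv: "cauchy_transform N v = u"
      unfolding v_def u_def using ys by (intro pastur[symmetric]) auto
    have Iv: "Im v \<ge> y" using Iu by (simp add: v_def)
    have "cmod v \<le> cmod (\<i> * of_real y) + cmod u" unfolding v_def by (rule norm_triangle_ineq4)
    then have vn: "cmod v \<le> 2 * y" using u ys by (simp add: norm_mult)
    have u0: "u \<noteq> 0" using N.cauchy_transform_nz(1)[of v] Nv Iv ys by simp
    have "cmod (v - w) \<le> 2 * cmod v / Im v"
      using N.cauchy_transform_nz(2)[of v] Nv Iv ys by (simp add: w_def)
    also have "\<dots> \<le> 4" using vn Iv ys by (simp add: divide_le_eq)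
    finally have vw: "cmod (v - w) \<le> 4" .
    have vy: "cmod (v - \<i> * of_real y) \<le> 1" using u by (simp add: v_def)
    have wy: "cmod (w - \<i> * of_real y) \<le> 5"
      using norm_triangle_ineq[of "w - v" "v - \<i> * of_real y"] vw vy
          by (simp add: norm_minus_commute)
    have uwy: "cmod (u + w - \<i> * of_real y) \<le> 6"
      using norm_triangle_ineq[of "w - \<i> * of_real y" u] wy u by (simp add: algebra_simps)
    have "w \<in> trunc_cone c d" using wy ys pos by (intro near[of c _ y d]) auto
    then have uD: "u \<in> stolz_angle c d"
      unfolding stolz_angle_def by (rule rev_image_eqI) (simp add: w_def)
    have vU: "v \<in> ?U" using vy ys pos by (intro near[of a _ y b]) auto
    have uwU: "u + 1 / u \<in> ?U" using uwy ys pos unfolding w_def by (intro near[of a _ y b]) auto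
    have "cauchy_transform semicircle_distribution (u + 1 / u) = u"
      using u u0 uwU pos by (intro cauchy_transform_semicircle) (auto simp: trunc_cone_def)
    then have "K_transform semicircle_distribution ?U u = u + 1 / u" "K_transform N ?U u = v"
      unfolding K_transform_def using inv uwU vU Nv
      by (auto simp: cauchy_invertible_def intro!: the_inv_into_f_eq)
    \<comment> \<open>The terms \<open>1 / u\<close> cancel and leave
      \<open>u + v = \<i> * y\<close>.\<close>
    then have "K_transform \<rho>' ?U u = \<i> * of_real y"
      using R[OF uD] by (simp add: R_transform_def v_def)
    moreover have "cauchy_transform \<rho>' (K_transform \<rho>' ?U u) = u"
      unfolding K_transform_def using inv uD
          by (intro f_the_inv_into_f) (auto simp: cauchy_invertible_def)
    ultimately show ?thesis by (simp add: u_def)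
  qed
  then show ?thesis by (rule cauchy_transform_unique[OF \<rho>' \<rho>.real_distribution_axioms])
qed

theorem free_convolution_semicircle_eq: "semicircle_distribution \<boxplus> N = \<rho>"
  unfolding free_convolution_def
  using is_free_convolution_semicircle free_convolution_unique by (rule the_equality)

end

subsection \<open>Gaussian limit of the degrees\<close>

text \<open>The function \<open>chf\<close> with \<open>t\<close> absorbed in the argument. It
  stands outside the locale because \<open>n\<close> varies in the limit theorem.\<close>

definition bern_char :: "real \<Rightarrow> real \<Rightarrow> complex" where
  "bern_char p a = of_real p * exp (- (\<i> * of_real (a * (1 - p))))
      + of_real (1 - p) * exp (\<i> * of_real (a * p))"

lemma norm_bern_char_le:
  assumes "0 \<le> p" "p \<le> 1"
  shows "cmod (bern_char p a) \<le> 1"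
proof -
  have "cmod (bern_char p a) \<le> \<bar>p\<bar> + \<bar>1 - p\<bar>"
    unfolding bern_char_def by (rule order_trans[OF norm_triangle_ineq]) (simp add: norm_mult
        norm_exp_eq_Re del: of_real_diff)
  then show ?thesis using assms by simp
qed

lemma continuous_bern_char: "continuous_on UNIV (\<lambda>\<tau>. bern_char p (\<tau> * t))"
  unfolding bern_char_def by (intro continuous_intros)

text \<open>Mean zero removes the first order terms, and the cubic Taylor errors of the two
  exponentials are averaged with weights \<open>p\<close> and \<open>1 - p\<close>.\<close>

lemma bern_char_approx:
  assumes p: "0 \<le> p" "p \<le> 1"
  shows "cmod (bern_char p a - of_real (1 - p * (1 - p) * a\<^sup>2 / 2)) \<le> \<bar>a\<bar> ^ 3"
proof -
  define T where "T x = 1 + \<i> * of_real x - of_real (x\<^sup>2 / 2)" for x :: real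
  have T: "cmod (iexp x - T x) \<le> \<bar>x\<bar> ^ 3" for x
  proof -
    have "T x = (\<Sum>k\<le>2. (\<i> * of_real x) ^ k / fact k)"
    proof -
      have "(\<Sum>k\<le>2. f k) = f 0 + f 1 + f 2" for f :: "nat \<Rightarrow> complex" by (simp add: numeral_2_eq_2)
      then show ?thesis by (simp add: T_def power_mult_distrib)
    qed
    then have "cmod (iexp x - T x) \<le> \<bar>x\<bar> ^ Suc 2 / fact (Suc 2)"
      using iexp_approx1[of x 2] by simp
    also have "\<dots> = \<bar>x\<bar> ^ 3 / 6" by (simp add: fact_numeral numeral_3_eq_3 numeral_2_eq_2)
    also have "\<dots> \<le> \<bar>x\<bar> ^ 3" by simp
    finally show ?thesis .
  qed
  have c: "\<bar>a * q\<bar> ^ 3 \<le> \<bar>a\<bar> ^ 3" if "0 \<le> q" "q \<le> 1" for q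
    using that by (intro power_mono) (auto simp: abs_mult intro: mult_left_le)
  have "bern_char p a - of_real (1 - p * (1 - p) * a\<^sup>2 / 2)
      = of_real p * (iexp (- (a * (1 - p))) - T (- (a * (1 - p))))
          + of_real (1 - p) * (iexp (a * p) - T (a * p))"
    unfolding bern_char_def T_def by (simp add: field_simps power2_eq_square)
  also have "cmod \<dots> \<le> p * \<bar>a\<bar> ^ 3 + (1 - p) * \<bar>a\<bar> ^ 3"
  proof (rule order_trans[OF norm_triangle_ineq], rule add_mono)
    show "cmod (of_real p * (iexp (- (a * (1 - p))) - T (- (a * (1 - p))))) \<le> p * \<bar>a\<bar> ^ 3"
      using p T[of "- (a * (1 - p))"] c[of "1 - p"] unfolding norm_mult
      by (intro mult_mono order_trans[OF T]) auto
    show "cmod (of_real (1 - p) * (iexp (a * p) - T (a * p))) \<le> (1 - p) * \<bar>a\<bar> ^ 3"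
      using p T[of "a * p"] c[of p] unfolding norm_mult
      by (intro mult_mono order_trans[OF T]) (auto simp del: of_real_diff)
  qed
  finally show ?thesis by (simp add: algebra_simps)
qed

text \<open>For numbers of modulus at most 1, \<open>m\<close>-th powers differ by at most
  \<open>m\<close> times the difference of the bases. This reduces the claim to the real sequence
  \<open>(1 - \<tau>^2 / (2 n))^(n - 1)\<close>, with an error of order
  \<open>n * n^(-3/2)\<close>.\<close>

lemma bern_char_power_tendsto:
  assumes p: "0 < p" "p < 1" and \<sigma>: "\<sigma> = sqrt (p * (1 - p))"
  shows "(\<lambda>n. bern_char p (\<tau> * (1 / (\<sigma> * sqrt (real n)))) ^ (n - 1)) \<longlonglongrightarrow> of_real (exp (- (\<tau>\<^sup>2) / 2))"
proof -
  have s: "\<sigma> > 0" "\<sigma>\<^sup>2 = p * (1 - p)" using p by (auto simp: \<sigma>)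
  define x where "x n = 1 - \<tau>\<^sup>2 / 2 / real n" for n :: nat
  have lim1: "(\<lambda>n. x n ^ (n - 1)) \<longlonglongrightarrow> exp (- (\<tau>\<^sup>2) / 2)"
  proof -
    have x1: "x \<longlonglongrightarrow> 1" unfolding x_def by real_asymp
    have "(\<lambda>n. (1 + (- (\<tau>\<^sup>2) / 2) / real n) ^ n) \<longlonglongrightarrow> exp (- (\<tau>\<^sup>2) / 2)"
      by (rule tendsto_exp_limit_sequentially)
    then have "(\<lambda>n. x n ^ n) \<longlonglongrightarrow> exp (- (\<tau>\<^sup>2) / 2)" by (simp add: x_def)
    \<comment> \<open>The exponent is \<open>n - 1\<close>, one edge for each other vertex; dividing
      by \<open>x n\<close>, which tends to 1, adjusts the usual limit.\<close>
    from tendsto_divide[OF this x1] have "(\<lambda>n. x n ^ n / x n) \<longlonglongrightarrow> exp (- (\<tau>\<^sup>2) / 2)" by simp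
    moreover have "\<forall>\<^sub>F n in sequentially. 0 < x n" using order_tendstoD(1)[OF x1, of 0] by simp
    then have "\<forall>\<^sub>F n in sequentially. x n ^ n / x n = x n ^ (n - 1)"
      using eventually_gt_at_top[of 0]
      by eventually_elim (simp add: power_diff)
    ultimately show ?thesis by (rule Lim_transform_eventually)
  qed
  define y where "y n = bern_char p (\<tau> * (1 / (\<sigma> * sqrt (real n))))" for n
  have diff: "cmod (y n ^ (n - 1) - of_real (x n) ^ (n - 1)) \<le> \<bar>\<tau> / \<sigma>\<bar> ^ 3 / sqrt (real n)"
    if n: "n \<ge> 1" "real n \<ge> \<tau>\<^sup>2" for n
  proof -
    \<comment> \<open>The condition \<open>n >= \<tau>^2\<close> places \<open>x n\<close> in
      \<open>[-1, 1]\<close>, as the comparison of powers requires.\<close>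
    have "\<tau>\<^sup>2 / 2 / real n \<le> 1" using n by (simp add: divide_le_eq)
    then have x: "\<bar>x n\<bar> \<le> 1" by (simp add: x_def abs_le_iff)
    have "p * (1 - p) * (\<tau> * (1 / (\<sigma> * sqrt (real n))))\<^sup>2 / 2 = \<tau>\<^sup>2 / 2 / real n"
      using s n by (simp add: power_mult_distrib power_divide s(2)[symmetric])
    then have xn: "x n = 1 - p * (1 - p) * (\<tau> * (1 / (\<sigma> * sqrt (real n))))\<^sup>2 / 2"
        by (simp add: x_def)
    have "cmod (y n ^ (n - 1) - of_real (x n) ^ (n - 1))
        \<le> real (n - 1) * cmod (y n - of_real (x n))"
      using x p by (intro norm_power_diff) (auto simp: y_def norm_bern_char_le)
    also have "\<dots> \<le> real n * \<bar>\<tau> * (1 / (\<sigma> * sqrt (real n)))\<bar> ^ 3"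
      unfolding y_def xn using p by (intro mult_mono bern_char_approx) auto
    also have "\<dots> = \<bar>\<tau> / \<sigma>\<bar> ^ 3 * (real n * (1 / sqrt (real n)) ^ 3)"
      using s by (simp add: abs_mult power_mult_distrib power_divide)
    also have "real n * (1 / sqrt (real n)) ^ 3 = 1 / sqrt (real n)"
      using n by (simp add: power3_eq_cube field_simps)
    finally show ?thesis by simp
  qed
  have "(\<lambda>n. y n ^ (n - 1) - of_real (x n) ^ (n - 1)) \<longlonglongrightarrow> 0"
  proof (rule Lim_null_comparison)
    show "\<forall>\<^sub>F n in sequentially. cmod (y n ^ (n - 1) - of_real (x n) ^ (n - 1))
        \<le> \<bar>\<tau> / \<sigma>\<bar> ^ 3 / sqrt (real n)"
      using eventually_ge_at_top[of "max 1 (nat \<lceil>\<tau>\<^sup>2\<rceil>)"]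
      by eventually_elim (rule diff; linarith)
    show "(\<lambda>n. \<bar>\<tau> / \<sigma>\<bar> ^ 3 / sqrt (real n)) \<longlonglongrightarrow> 0" by real_asymp
  qed
  moreover have "(\<lambda>n. of_real (x n) ^ (n - 1) :: complex) \<longlonglongrightarrow> of_real (exp (- (\<tau>\<^sup>2) / 2))"
    using tendsto_of_real[OF lim1, where 'a=complex] by simp
  ultimately have "(\<lambda>n. (y n ^ (n - 1) - of_real (x n) ^ (n - 1)) + of_real (x n) ^ (n - 1)) \<longlonglongrightarrow> 0
      + of_real (exp (- (\<tau>\<^sup>2) / 2))"
    by (rule tendsto_add)
  then show ?thesis by (simp add: y_def)
qed

section \<open>Diagonal expectations against the standard normal law\<close>

context lap_resolvent
begin

lemma chf_eq: "chf \<tau> = bern_char p (\<tau> * t)"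
  by (simp add: chf_def bern_char_def)

lemma chf_le: "cmod (chf \<tau> ^ k) \<le> 1"
  unfolding chf_eq norm_power using p by (intro power_le_one norm_bern_char_le) auto

lemma chf_measurable [measurable]: "chf \<in> borel_measurable borel"
  unfolding chf_eq[abs_def] by (intro borel_measurable_continuous_onI continuous_bern_char)

text \<open>As an integral of phases, \<open>\<phi> i\<close> becomes linear in the exponentials of
  \<open>D E i\<close>, whose expectation factorizes over the edges at \<open>i\<close>.\<close>

lemma expectation_phi:
  assumes i: "i < n"
  shows "EE (\<phi> i) = - \<i> * (LBINT \<tau>:{0<..}. exp (\<i> * (z - s) * of_real \<tau>) * chf \<tau> ^ (n - 1))"
proof -
  have pos: "Im (z - s - of_real x) > 0" for x using denom_Im[of x] eta_pos by linarith
  have "\<phi> i E = - \<i> * (LBINT \<tau>:{0<..}. exp (\<i> * (z - s - of_real (D E i)) * of_real \<tau>))" for E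
    unfolding iexp_integral[OF pos] by (simp add: \<phi>_def)
  then have "EE (\<phi> i) = EE (\<lambda>E. - \<i> * (LBINT \<tau>:{0<..}. exp (\<i> * (z - s - of_real (D E i)) *
      of_real \<tau>)))"
    by (intro bern_exp_cong)
  also have "\<dots> = - \<i> * (LBINT \<tau>:{0<..}. EE (\<lambda>E. exp (\<i> * (z - s - of_real (D E i)) * of_real \<tau>)))"
    unfolding bern_exp_mult_left by (subst bern_exp_set_integral[OF iexp_integrable[OF pos]]) simp
  also have "(\<lambda>\<tau>. EE (\<lambda>E. exp (\<i> * (z - s - of_real (D E i)) * of_real \<tau>)))
      = (\<lambda>\<tau>. exp (\<i> * (z - s) * of_real \<tau>) * chf \<tau> ^ (n - 1))"
  proof
    fix \<tau>
    have "exp (\<i> * (z - s - of_real (D E i)) * of_real \<tau>)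
        = exp (\<i> * (z - s) * of_real \<tau>) * exp (- (\<i> * of_real (\<tau> * D E i)))" for E
      by (simp add: algebra_simps flip: exp_add)
    then show "EE (\<lambda>E. exp (\<i> * (z - s - of_real (D E i)) * of_real \<tau>))
        = exp (\<i> * (z - s) * of_real \<tau>) * chf \<tau> ^ (n - 1)"
      by (simp only: bern_exp_mult_left expectation_exp_D[OF i])
  qed
  finally show ?thesis .
qed

text \<open>The weight involves \<open>\<eta>\<close> and not \<open>s\<close>. The bound is
  therefore insensitive to the way \<open>s\<close> changes with \<open>n\<close>, and dominated
  convergence can send it to 0.\<close>

definition "clt_error = (LBINT \<tau>:{0<..}. exp (- (\<eta> * \<tau>)) * cmod (chf \<tau> ^ (n - 1) - of_real (exp (-
    (\<tau>\<^sup>2) / 2))))"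

lemma expectation_phi_normal:
  assumes i: "i < n"
  shows "cmod (EE (\<phi> i) - cauchy_transform std_normal_distribution (z - s)) \<le> clt_error"
proof -
  interpret N: real_distribution std_normal_distribution by (rule real_dist_normal_dist)
  let ?g = "\<lambda>\<tau>::real. complex_of_real (exp (- (\<tau>\<^sup>2) / 2))"
  have w: "Im (z - s) \<ge> \<eta>" using denom_Im[of 0] by simp
  then have w0: "Im (z - s) > 0" using eta_pos by linarith
  have intN: "set_integrable lborel {0<..} (\<lambda>\<tau>. exp (\<i> * (z - s) * of_real \<tau>) * ?g \<tau>)"
    using N.iexp_char_integrable[OF w0] by (simp add: char_std_normal_distribution)
  have GN: "cauchy_transform std_normal_distribution (z - s)
      = - \<i> * (LBINT \<tau>:{0<..}. exp (\<i> * (z - s) * of_real \<tau>) * ?g \<tau>)"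
    unfolding N.cauchy_transform_char[OF w0] by (simp add: char_std_normal_distribution)
  have int1: "set_integrable lborel {0<..} (\<lambda>\<tau>. exp (\<i> * (z - s) * of_real \<tau>) * chf \<tau> ^ (n - 1))"
  proof (rule set_integrable_bound[OF exp_neg_integrable[OF w0]])
    show "set_borel_measurable lborel {0<..} (\<lambda>\<tau>. exp (\<i> * (z - s) * of_real \<tau>) * chf \<tau> ^ (n - 1))"
      unfolding set_borel_measurable_def by measurable
    show "AE \<tau> in lborel. \<tau> \<in> {0<..} \<longrightarrow> norm (exp (\<i> * (z - s) * of_real \<tau>) * chf \<tau> ^ (n - 1))
        \<le> norm (exp (- (Im (z - s) * \<tau>)))"
    proof (intro AE_I2 impI)
      fix \<tau> :: real
      show "norm (exp (\<i> * (z - s) * of_real \<tau>) * chf \<tau> ^ (n - 1))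
          \<le> norm (exp (- (Im (z - s) * \<tau>)))"
      proof -
        have "cmod (exp (\<i> * (z - s) * of_real \<tau>)) = exp (- (Im (z - s) * \<tau>))"
          by (simp add: norm_exp_eq_Re algebra_simps)
        then show ?thesis
          using mult_left_le[OF chf_le[of \<tau> "n - 1"], of "exp (- (Im (z - s) * \<tau>))"]
          unfolding norm_mult by simp
      qed
    qed
  qed
  have int2: "set_integrable lborel {0<..} (\<lambda>\<tau>. exp (- (\<eta> * \<tau>)) * cmod (chf \<tau> ^ (n - 1) - ?g \<tau>))"
  proof (rule set_integrable_bound[OF set_integrable_mult_right[where a=2, OF
      exp_neg_integrable[OF eta_pos]]])
    show "set_borel_measurable lborel {0<..} (\<lambda>\<tau>. exp (- (\<eta> * \<tau>)) * cmod (chf \<tau> ^ (n - 1) - ?g \<tau>))"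
      unfolding set_borel_measurable_def by measurable
    show "AE \<tau> in lborel. \<tau> \<in> {0<..} \<longrightarrow> norm (exp (- (\<eta> * \<tau>)) * cmod (chf \<tau> ^ (n - 1) - ?g \<tau>))
        \<le> norm (2 * exp (- (\<eta> * \<tau>)))"
    proof (intro AE_I2 impI)
      fix \<tau> :: real
      have "cmod (?g \<tau>) \<le> 1" by simp
      then have "cmod (chf \<tau> ^ (n - 1) - ?g \<tau>) \<le> 2"
        using norm_triangle_ineq4[of "chf \<tau> ^ (n - 1)" "?g \<tau>"] chf_le[of \<tau> "n - 1"] by linarith
      from mult_left_mono[OF this, of "exp (- (\<eta> * \<tau>))"]
      show "norm (exp (- (\<eta> * \<tau>)) * cmod (chf \<tau> ^ (n - 1) - ?g \<tau>)) \<le> norm (2 * exp (- (\<eta> * \<tau>)))"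
        by (simp add: abs_mult)
    qed
  qed
  let ?h = "\<lambda>\<tau>. exp (\<i> * (z - s) * of_real \<tau>) * chf \<tau> ^ (n - 1) - exp (\<i> * (z - s) * of_real \<tau>) *
      ?g \<tau>"
  have "EE (\<phi> i) - cauchy_transform std_normal_distribution (z - s) = - \<i> * (LBINT \<tau>:{0<..}. ?h \<tau>)"
    unfolding expectation_phi[OF i] GN
    by (subst set_integral_diff(2)[OF int1 intN]) (rule right_diff_distrib[symmetric])
  then have "cmod (EE (\<phi> i) - cauchy_transform std_normal_distribution (z - s))
      = cmod (LBINT \<tau>:{0<..}. ?h \<tau>)"
    by (simp add: norm_mult)
  also have "\<dots> \<le> (LBINT \<tau>:{0<..}. cmod (?h \<tau>))"
    by (rule set_integral_norm_bound[OF set_integral_diff(1)[OF int1 intN]])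
  also have "\<dots> \<le> clt_error"
    unfolding clt_error_def
  proof (rule set_integral_mono)
    show "set_integrable lborel {0<..} (\<lambda>\<tau>. cmod (?h \<tau>))"
      using set_integral_diff(1)[OF int1 intN] by (rule set_integrable_norm)
    fix \<tau> :: real assume "\<tau> \<in> {0<..}"
    then have "Im (z - s) * \<tau> \<ge> \<eta> * \<tau>" using w by (intro mult_right_mono) auto
    then have e: "cmod (exp (\<i> * (z - s) * of_real \<tau>)) \<le> exp (- (\<eta> * \<tau>))"
      unfolding norm_exp_eq_Re by (simp add: algebra_simps)
    have "?h \<tau> = exp (\<i> * (z - s) * of_real \<tau>) * (chf \<tau> ^ (n - 1) - ?g \<tau>)"
        by (simp only: right_diff_distrib)
    then show "cmod (?h \<tau>) \<le> exp (- (\<eta> * \<tau>)) * cmod (chf \<tau> ^ (n - 1) - ?g \<tau>)"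
      using mult_right_mono[OF e norm_ge_zero] by (simp only: norm_mult)
  qed (rule int2)
  finally show ?thesis .
qed

lemma s_pastur_error:
  "cmod (s - cauchy_transform std_normal_distribution (z - s))
    \<le> (4 * (1/\<eta>)\<^sup>2 * exp (16 * (1/\<eta>)^4 / \<sigma>\<^sup>2) + 5 * (1/\<eta>)^3 + 25 * (1/\<eta>)^4 / \<sigma>) / sqrt (real n)
        + clt_error"
proof -
  let ?G = "cauchy_transform std_normal_distribution (z - s)"
  have "(\<Sum>i<n. EE (\<phi> i)) / of_nat n - ?G = (\<Sum>i<n. EE (\<phi> i) - ?G) / of_nat n"
    using n by (simp add: sum_subtractf diff_divide_distrib)
  also have "cmod \<dots> = cmod (\<Sum>i<n. EE (\<phi> i) - ?G) / real n" by (simp add: norm_divide)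
  also have "\<dots> \<le> (\<Sum>i<n. clt_error) / real n"
    by (intro divide_right_mono order_trans[OF norm_sum] sum_mono expectation_phi_normal) auto
  also have "\<dots> = clt_error" using n by simp
  finally show ?thesis
    using expectation_S_approx norm_triangle_ineq[of "s - (\<Sum>i<n. EE (\<phi> i)) / of_nat n" "(\<Sum>i<n. EE
        (\<phi> i)) / of_nat n - ?G"]
    by simp
qed

end

lemma mean_resolvent_pastur:
  assumes p: "0 < p" "p < 1" and \<sigma>: "\<sigma> = sqrt (p * (1 - p))" and z: "Im z > 0"
  defines "s \<equiv> \<lambda>n. lap_resolvent.s p \<sigma> n z"
  shows "(\<lambda>n. s n - cauchy_transform std_normal_distribution (z - s n)) \<longlonglongrightarrow> 0"
proof -
  define K where "K = 4 * (1/Im z)\<^sup>2 * exp (16 * (1/Im z)^4 / \<sigma>\<^sup>2) + 5 * (1/Im z)^3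
      + 25 * (1/Im z)^4 / \<sigma>"
  define g where "g n \<tau> = bern_char p (\<tau> * (1 / (\<sigma> * sqrt (real n)))) ^ (n - 1)" for n \<tau>
  define c where "c n = (LBINT \<tau>:{0<..}. exp (- (Im z * \<tau>)) * cmod (g n \<tau> - of_real (exp (- (\<tau>\<^sup>2)
      / 2))))" for n
  have [measurable]: "g n \<in> borel_measurable borel" for n
    unfolding g_def by (intro borel_measurable_power borel_measurable_continuous_onI
        continuous_bern_char)
  have g_le: "cmod (g n \<tau>) \<le> 1" for n \<tau>
    unfolding g_def norm_power using p by (intro power_le_one norm_bern_char_le) auto
  have c0: "c \<longlonglongrightarrow> 0"
  proof -
    have "c \<longlonglongrightarrow> integral\<^sup>L lborel (\<lambda>_::real. 0::real)"
      unfolding c_def[abs_def] set_lebesgue_integral_def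
    proof (rule Bochner_Integration.integral_dominated_convergence[
          where w="\<lambda>\<tau>. indicator {0<..} \<tau> *\<^sub>R (2 * exp (- (Im z * \<tau>)))"])
      show "integrable lborel (\<lambda>\<tau>. indicator {0<..} \<tau> *\<^sub>R (2 * exp (- (Im z * \<tau>))))"
        using set_integrable_mult_right[where a=2, OF exp_neg_integrable[OF z]]
            unfolding set_integrable_def .
      show "AE \<tau> in lborel. (\<lambda>n. indicat_real {0<..} \<tau> *\<^sub>R (exp (- (Im z * \<tau>)) * cmod (g n \<tau> -
          of_real (exp (- (\<tau>\<^sup>2) / 2))))) \<longlonglongrightarrow> 0"
      proof (intro AE_I2)
        fix \<tau> :: real
        have "(\<lambda>n. g n \<tau>) \<longlonglongrightarrow> of_real (exp (- (\<tau>\<^sup>2) / 2))"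
          unfolding g_def by (rule bern_char_power_tendsto[OF p \<sigma>])
        then have "(\<lambda>n. cmod (g n \<tau> - of_real (exp (- (\<tau>\<^sup>2) / 2)))) \<longlonglongrightarrow> 0"
          by (simp add: LIM_zero tendsto_norm_zero)
        then have "(\<lambda>n. indicat_real {0<..} \<tau> *\<^sub>R (exp (- (Im z * \<tau>)) * cmod (g n \<tau> - of_real (exp
            (- (\<tau>\<^sup>2) / 2)))))
            \<longlonglongrightarrow> indicat_real {0<..} \<tau> *\<^sub>R (exp (- (Im z * \<tau>)) * 0)"
          by (intro tendsto_intros)
        then show "(\<lambda>n. indicat_real {0<..} \<tau> *\<^sub>R (exp (- (Im z * \<tau>)) * cmod (g n \<tau> - of_real (exp
            (- (\<tau>\<^sup>2) / 2))))) \<longlonglongrightarrow> 0"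
          by simp
      qed
      show "AE \<tau> in lborel. norm (indicat_real {0<..} \<tau> *\<^sub>R (exp (- (Im z * \<tau>)) * cmod (g n \<tau> -
          of_real (exp (- (\<tau>\<^sup>2) / 2)))))
          \<le> indicat_real {0<..} \<tau> *\<^sub>R (2 * exp (- (Im z * \<tau>)))" for n
      proof (intro AE_I2)
        fix \<tau> :: real
        have "cmod (complex_of_real (exp (- (\<tau>\<^sup>2) / 2))) \<le> 1" by simp
        then have "cmod (g n \<tau> - of_real (exp (- (\<tau>\<^sup>2) / 2))) \<le> 2"
          using norm_triangle_ineq4[of "g n \<tau>" "of_real (exp (- (\<tau>\<^sup>2) / 2))"] g_le[of n \<tau>]
              by linarith
        from mult_left_mono[OF this, of "exp (- (Im z * \<tau>))"]
        show "norm (indicat_real {0<..} \<tau> *\<^sub>R (exp (- (Im z * \<tau>)) * cmod (g n \<tau> - of_real (exp (-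
            (\<tau>\<^sup>2) / 2)))))
          \<le> indicat_real {0<..} \<tau> *\<^sub>R (2 * exp (- (Im z * \<tau>)))"
          by (simp add: indicator_def abs_mult)
      qed
    qed measurable
    then show ?thesis by simp
  qed
  show ?thesis
  proof (rule Lim_null_comparison)
    show "\<forall>\<^sub>F n in sequentially. cmod (s n - cauchy_transform std_normal_distribution (z - s n))
        \<le> K / sqrt (real n) + c n"
      using eventually_ge_at_top[of 1]
    proof eventually_elim
      case (elim n)
      interpret L: lap_resolvent p \<sigma> n z using p \<sigma> z elim by unfold_locales
      have "L.clt_error = c n"
        unfolding L.clt_error_def c_def g_def L.chf_eq L.t_def L.\<eta>_def ..
      then show ?case using L.s_pastur_error unfolding s_def K_def L.\<eta>_def by simp
    qed
    have "(\<lambda>n. K / sqrt (real n)) \<longlonglongrightarrow> 0" by real_asymp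
    from tendsto_add[OF this c0] show "(\<lambda>n. K / sqrt (real n) + c n) \<longlonglongrightarrow> 0" by simp
  qed
qed

subsection \<open>Weak convergence from the Pastur equation\<close>

lemma (in real_distribution) ex_interval_prob_gt:
  assumes "\<epsilon> > 0"
  shows "\<exists>k::nat. measure M {- real k<..real k} > 1 - \<epsilon>"
proof -
  have "(\<lambda>k. measure M {- real k<..real k}) \<longlonglongrightarrow> measure M (\<Union>k. {- real k<..real k})"
    by (rule finite_Lim_measure_incseq) (auto simp: incseq_def)
  also have "(\<Union>k. {- real k<..real k}) = UNIV"
  proof -
    have "x \<in> (\<Union>k. {- real k<..real k})" for x :: real
    proof -
      obtain k :: nat where "\<bar>x\<bar> < real k" using reals_Archimedean2 by blast
      then show ?thesis by (intro UN_I[of k]) auto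
    qed
    then show ?thesis by auto
  qed
  finally have "(\<lambda>k. measure M {- real k<..real k}) \<longlonglongrightarrow> 1" using prob_space by simp
  from order_tendstoD(1)[OF this, of "1 - \<epsilon>"] assms show ?thesis
    by (auto simp: eventually_sequentially)
qed

text \<open>\<open>tight\<close> asks for one interval for all \<open>n\<close>; the finitely many
  initial laws are absorbed by enlarging the interval.\<close>

lemma tightI_eventually:
  assumes \<mu>: "\<And>n. real_distribution (\<mu> n)"
    and ev: "\<And>\<epsilon>. \<epsilon> > 0 \<Longrightarrow> \<exists>k::nat. \<forall>\<^sub>F n in sequentially. measure (\<mu> n) {- real k<..real k} > 1 - \<epsilon>"
  shows "tight \<mu>"
  unfolding tight_def
proof (intro conjI allI impI \<mu>)
  fix \<epsilon> :: real assume \<epsilon>: "\<epsilon> > 0"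
  obtain k N where kN: "\<And>n. n \<ge> N \<Longrightarrow> measure (\<mu> n) {- real k<..real k} > 1 - \<epsilon>"
    using ev[OF \<epsilon>] by (auto simp: eventually_sequentially)
  have "\<exists>f. \<forall>n. measure (\<mu> n) {- real (f n)<..real (f n)} > 1 - \<epsilon>"
    using real_distribution.ex_interval_prob_gt[OF \<mu> \<epsilon>] by (intro choice allI)
  then obtain f :: "nat \<Rightarrow> nat" where f: "\<And>n. measure (\<mu> n) {- real (f n)<..real (f n)} > 1 - \<epsilon>"
      by blast
  define K where "K = Suc (k + (\<Sum>n<N. f n))"
  have "measure (\<mu> n) {- real K<..real K} > 1 - \<epsilon>" for n
  proof -
    interpret real_distribution "\<mu> n" by (rule \<mu>)
    have mono: "measure (\<mu> n) {- real j<..real j} \<le> measure (\<mu> n) {- real K<..real K}" if "j \<le> K"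
        for j
      using that by (intro finite_measure_mono) auto
    show ?thesis
    proof (cases "n \<ge> N")
      case True
      then show ?thesis using kN[OF True] mono[of k] by (auto simp: K_def)
    next
      case False
      then have "f n \<le> (\<Sum>n<N. f n)" by (intro member_le_sum) auto
      then show ?thesis using f[of n] mono[of "f n"] by (auto simp: K_def)
    qed
  qed
  moreover have "0 < K" by (simp add: K_def)
  then have "- real K < real K" by simp
  ultimately show "\<exists>a b. a < b \<and> (\<forall>n. 1 - \<epsilon> < measure (\<mu> n) {a<..b})" by blast
qed

text \<open>At \<open>z = \<i> * y\<close> the real part of 1 minus \<open>z\<close> times the
  transform is the mean of \<open>x^2 / (x^2 + y^2)\<close>, which is at least 1/2 outside the
  interval.\<close>

lemma (in real_distribution) prob_le_cauchy_transform:
  assumes y: "y > 0"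
  shows "1 - measure M {- y<..y}
      \<le> 2 * cmod (1 - \<i> * of_real y * cauchy_transform M (\<i> * of_real y))"
proof -
  let ?z = "\<i> * complex_of_real y"
  define h where "h x = 1 - ?z * (1 / (?z - complex_of_real x))" for x :: real
  have hi: "integrable M h"
    unfolding h_def using y
    by (intro Bochner_Integration.integrable_diff integrable_mult_right cauchy_kernel_integrable)
        auto
  have Re: "Re (h x) = x\<^sup>2 / (x\<^sup>2 + y\<^sup>2)" for x
  proof -
    have nz: "x\<^sup>2 + y\<^sup>2 \<noteq> 0" using y by (simp add: sum_power2_eq_zero_iff)
    have "Re (h x) = 1 - y\<^sup>2 / (x\<^sup>2 + y\<^sup>2)"
      by (simp add: h_def Re_divide Im_divide power2_eq_square)
    then show ?thesis using nz by (simp add: field_simps)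
  qed
  have "measure M (- {- y<..y}) = (LINT x|M. indicat_real (- {- y<..y}) x)" by simp
  also have "\<dots> \<le> (LINT x|M. 2 * Re (h x))"
  proof (rule integral_mono)
    show "integrable M (\<lambda>x. 2 * Re (h x))" using hi by simp
    show "indicat_real (- {- y<..y}) x \<le> 2 * Re (h x)" for x
    proof (cases "x \<in> {- y<..y}")
      case False
      then have "y\<^sup>2 \<le> x\<^sup>2" using y abs_le_square_iff[of y x] by auto
      moreover have "x\<^sup>2 + y\<^sup>2 > 0" using y by (simp add: sum_power2_gt_zero_iff)
      ultimately show ?thesis using False unfolding Re by (simp add: field_simps)
    qed (simp add: Re)
    show "integrable M (indicat_real (- {- y<..y}))"
      by (rule integrable_const_bound[where B=1]) (auto simp: indicator_def)
  qed
  also have "\<dots> = 2 * Re (LINT x|M. h x)" using hi by (simp add: integral_Re)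
  also have "(LINT x|M. h x) = 1 - ?z * cauchy_transform M ?z"
    unfolding h_def cauchy_transform_def using y prob_space
    by (subst Bochner_Integration.integral_diff)
      (auto intro!: integrable_mult_right cauchy_kernel_integrable simp del: times_divide_eq_right)
  finally have "measure M (- {- y<..y}) \<le> 2 * Re (1 - ?z * cauchy_transform M ?z)" .
  also have "\<dots> \<le> 2 * cmod (1 - ?z * cauchy_transform M ?z)"
    by (intro mult_left_mono complex_Re_le_cmod) simp
  finally show ?thesis using prob_compl[of "{- y<..y}"] by (simp add: Compl_eq_Diff_UNIV)
qed

text \<open>The kernels are bounded and continuous in \<open>x\<close>, so the transforms converge
  at each point of \<open>D\<close>; continuity in \<open>z\<close> extends the equation from the
  dense set. A dense set suits almost sure statements, since it can be chosen countable.\<close>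

lemma pastur_subsequence_limit:
  assumes \<mu>: "\<And>n. real_distribution (\<mu> n)" and \<nu>: "real_distribution \<nu>" and conv: "weak_conv_m \<mu> \<nu>"
    and N: "unit_variance_distribution N"
    and dense: "\<And>X. open X \<Longrightarrow> X \<noteq> {} \<Longrightarrow> \<exists>z\<in>D. z \<in> X"
    and lim: "\<And>z. z \<in> D \<Longrightarrow> Im z > 0 \<Longrightarrow>
      (\<lambda>n. cauchy_transform (\<mu> n) z - cauchy_transform N (z - cauchy_transform (\<mu> n) z)) \<longlonglongrightarrow> 0"
  shows "pastur_distribution \<nu> N"
proof -
  interpret \<nu>: real_distribution \<nu> by fact
  interpret N: unit_variance_distribution N by fact
  interpret m: real_distribution "\<mu> n" for n by fact
  let ?H = "{z. Im z > 0}"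
  let ?d = "\<lambda>z. cauchy_transform \<nu> z - cauchy_transform N (z - cauchy_transform \<nu> z)"
  have upper: "z - cauchy_transform \<nu> z \<in> ?H" if "z \<in> ?H" for z
    using \<nu>.Im_cauchy_transform_le[of z] that by simp
  have onD: "?d z = 0" if z: "z \<in> D" "Im z > 0" for z
  proof -
    have nz: "z - complex_of_real x \<noteq> 0" for x using z by (auto simp: complex_eq_iff)
    have "(\<lambda>n. cauchy_transform (\<mu> n) z) \<longlonglongrightarrow> cauchy_transform \<nu> z"
      unfolding cauchy_transform_def
    proof (rule weak_conv_imp_integral_bdd_continuous_conv[OF \<mu> \<nu> conv])
      show "isCont (\<lambda>x. 1 / (z - complex_of_real x)) x" for x using nz by (intro continuous_intros)
      show "norm (1 / (z - complex_of_real x)) \<le> 1 / Im z" for x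
        by (rule \<nu>.cauchy_kernel_bound[OF z(2)])
    qed
    moreover have "isCont (cauchy_transform N) (z - cauchy_transform \<nu> z)"
      using N.cauchy_transform_continuous upper[of z] z
      by (auto simp: continuous_on_eq_continuous_at open_halfspace_Im_gt)
    ultimately have "(\<lambda>n. cauchy_transform (\<mu> n) z - cauchy_transform N (z - cauchy_transform (\<mu>
        n) z)) \<longlonglongrightarrow> ?d z"
      by (intro tendsto_intros isCont_tendsto_compose[where g="cauchy_transform N"])
    then show ?thesis using LIMSEQ_unique lim[OF z] by blast
  qed
  have cont: "continuous_on ?H ?d"
    by (intro continuous_intros \<nu>.cauchy_transform_continuous
        continuous_on_compose2[OF N.cauchy_transform_continuous]) (use upper in auto)
  have "?d z = 0" if z: "Im z > 0" for z
  proof (rule ccontr)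
    assume "?d z \<noteq> 0"
    define X where "X = {z \<in> ?H. ?d z \<in> - {0}}"
    have "open X" unfolding X_def
      using continuous_open_preimage[OF cont open_halfspace_Im_gt open_Compl[OF
          closed_singleton[of 0]]] by (simp add: vimage_def Int_def)
    moreover have "X \<noteq> {}" using z \<open>?d z \<noteq> 0\<close> by (auto simp: X_def)
    ultimately obtain w where "w \<in> D" "w \<in> X" using dense by blast
    then show False using onD[of w] by (auto simp: X_def)
  qed
  then show ?thesis by unfold_locales auto
qed

lemma pastur_weak_convergence:
  assumes \<mu>: "\<And>n. real_distribution (\<mu> n)"
    and N: "unit_variance_distribution N"
    and dense: "\<And>X. open X \<Longrightarrow> X \<noteq> {} \<Longrightarrow> \<exists>z\<in>D. z \<in> X" and D: "\<And>k::nat. \<i> * of_nat k \<in> D"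
    and lim: "\<And>z. z \<in> D \<Longrightarrow> Im z > 0 \<Longrightarrow>
      (\<lambda>n. cauchy_transform (\<mu> n) z - cauchy_transform N (z - cauchy_transform (\<mu> n) z)) \<longlonglongrightarrow> 0"
  shows "weak_conv_m \<mu> (semicircle_distribution \<boxplus> N)"
proof -
  interpret N: unit_variance_distribution N by fact
  interpret m: real_distribution "\<mu> n" for n by fact
  have tight: "tight \<mu>"
  proof (rule tightI_eventually[OF \<mu>])
    fix \<epsilon> :: real assume \<epsilon>: "\<epsilon> > 0"
    \<comment> \<open>Three errors of size \<open>1 / y\<close>, doubled by
      \<open>prob_le_cauchy_transform\<close>, explain the 6.\<close>
    obtain k :: nat where k: "max 1 (6 / \<epsilon>) < real k" using reals_Archimedean2 by blast
    define y where "y = real k"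
    have y: "y > 1" "6 / \<epsilon> < y" using k by (auto simp: y_def)
    let ?z = "\<i> * complex_of_real y"
    have "(\<lambda>n. cauchy_transform (\<mu> n) ?z - cauchy_transform N (?z - cauchy_transform (\<mu> n) ?z)) \<longlonglongrightarrow> 0"
      using D[of k] y by (intro lim) (auto simp: y_def)
    then have "\<forall>\<^sub>F n in sequentially. dist (cauchy_transform (\<mu> n) ?z - cauchy_transform N (?z -
        cauchy_transform (\<mu> n) ?z)) 0 < 1 / y\<^sup>2"
      by (rule tendstoD) (use y in simp)
    then have "\<forall>\<^sub>F n in sequentially. measure (\<mu> n) {- real k<..real k} > 1 - \<epsilon>"
    proof eventually_elim
      case (elim n)
      define g where "g = cauchy_transform (\<mu> n) ?z"
      define v where "v = ?z - g"
      have g: "cmod g \<le> 1 / y" "Im g \<le> 0"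
        unfolding g_def using m.cauchy_transform_le[of ?z n] m.Im_cauchy_transform_le[of ?z n] y
            by auto
      have Iv: "Im v \<ge> y" using g by (simp add: v_def)
      define G where "G = cauchy_transform N v"
      have "cmod (v * G - 1) \<le> 1 / Im v" unfolding G_def using Iv y
          by (intro N.cauchy_transform_asymp) auto
      also have "\<dots> \<le> 1 / y" using Iv y by (intro divide_left_mono) auto
      finally have 1: "cmod (v * G - 1) \<le> 1 / y" .
      have "cmod G \<le> 1 / Im v" unfolding G_def using Iv y by (intro N.cauchy_transform_le) auto
      also have "\<dots> \<le> 1" using Iv y by simp
      finally have "cmod g * cmod G \<le> 1 / y * 1" using g y by (intro mult_mono) auto
      then have 2: "cmod (g * G) \<le> 1 / y" by (simp add: norm_mult)
      have "cmod (g - G) \<le> 1 / y\<^sup>2" using elim by (simp add: g_def G_def v_def)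
      then have "cmod (?z * (g - G)) \<le> y * (1 / y\<^sup>2)"
        unfolding norm_mult using y by (intro mult_mono) (auto simp: norm_mult)
      then have 3: "cmod (?z * (g - G)) \<le> 1 / y" using y by (simp add: power2_eq_square)
      \<comment> \<open>With \<open>?z = v + g\<close> the three terms are the error in the Pastur
        equation, the asymptotics of \<open>N\<close> at \<open>v\<close>, and a product in which
        \<open>g\<close> is small.\<close>
      have "1 - ?z * g = - (?z * (g - G) + ((v * G - 1) + g * G))"
          by (simp add: v_def algebra_simps)
      then have "cmod (1 - ?z * g) = cmod (?z * (g - G) + ((v * G - 1) + g * G))"
          by (simp only: norm_minus_cancel)
      also have "\<dots> \<le> 1 / y + (1 / y + 1 / y)"
        by (intro order_trans[OF norm_triangle_ineq] add_mono 1 2 3)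
      finally have "2 * cmod (1 - ?z * g) \<le> 6 / y" by simp
      then have "1 - measure (\<mu> n) {- y<..y} \<le> 6 / y"
        using m.prob_le_cauchy_transform[of y n] y by (simp add: g_def)
      also have "6 / y < \<epsilon>" using y \<epsilon> by (simp add: field_simps)
      finally show ?case by (simp add: y_def)
    qed
    then show "\<exists>k::nat. \<forall>\<^sub>F n in sequentially. measure (\<mu> n) {- real k<..real k} > 1 - \<epsilon>" by blast
  qed
  have sub: "\<nu> = semicircle_distribution \<boxplus> N"
    if r: "strict_mono r" and \<nu>: "real_distribution \<nu>" "weak_conv_m (\<mu> \<circ> r) \<nu>" for r \<nu>
  proof -
    have "pastur_distribution \<nu> N"
    proof (rule pastur_subsequence_limit[OF _ \<nu> N dense])
      show "real_distribution ((\<mu> \<circ> r) n)" for n using \<mu> by simp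
      show "(\<lambda>n. cauchy_transform ((\<mu> \<circ> r) n) z - cauchy_transform N (z - cauchy_transform ((\<mu> \<circ>
          r) n) z)) \<longlonglongrightarrow> 0"
        if "z \<in> D" "Im z > 0" for z
        using LIMSEQ_subseq_LIMSEQ[OF lim[OF that] r] by (simp add: o_def)
    qed
    then show ?thesis by (rule pastur_distribution.free_convolution_semicircle_eq[symmetric])
  qed
  \<comment> \<open>A first limit point shows that the free convolution exists and is a probability
    law, which the subsequence criterion presupposes.\<close>
  obtain r \<nu> where r: "strict_mono r" "real_distribution \<nu>" "weak_conv_m (\<mu> \<circ> id \<circ> r) \<nu>"
    using tight_imp_convergent_subsubsequence[OF tight strict_mono_id] by blast
  then have "\<nu> = semicircle_distribution \<boxplus> N" by (intro sub) auto
  with r have real: "real_distribution (semicircle_distribution \<boxplus> N)" by simp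
  show ?thesis
    by (rule tight_subseq_weak_converge[OF \<mu> real tight]) (use sub in blast)
qed

subsection \<open>Almost sure concentration\<close>

lemma
  assumes M: "prob_space M" and G: "erdos_renyi M n p G" and E: "E \<subseteq> graph_edges n"
  shows erdos_renyi_eq_sets: "{\<omega> \<in> space M. G \<omega> = E} \<in> sets M"
    and erdos_renyi_eq_prob: "measure M {\<omega> \<in> space M. G \<omega> = E} = (\<Prod>e\<in>graph_edges n.
        if e \<in> E then p else 1 - p)"
proof -
  interpret prob_space M by fact
  define A where "A e = {\<omega> \<in> space M. e \<in> G \<omega>}" for e
  define B where "B e = (if e \<in> E then A e else space M - A e)" for e
  have sub: "G \<omega> \<subseteq> graph_edges n" if "\<omega> \<in> space M" for \<omega> using G that
      by (auto simp: erdos_renyi_def)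
  have indep: "indep_events A (graph_edges n)" and pA: "\<And>e. e \<in> graph_edges n \<Longrightarrow> prob (A e) = p"
    using G unfolding erdos_renyi_def A_def[abs_def] by auto
  have A: "A e \<in> events" if "e \<in> graph_edges n" for e
    using indep that unfolding indep_events_def by auto
  then have B: "B e \<in> events" if "e \<in> graph_edges n" for e using that by (auto simp: B_def)
  have eq: "{\<omega> \<in> space M. G \<omega> = E} = space M \<inter> (\<Inter>e\<in>graph_edges n. B e)"
  proof -
    have "G \<omega> = E \<longleftrightarrow> (\<forall>e\<in>graph_edges n. \<omega> \<in> B e)" if w: "\<omega> \<in> space M" for \<omega>
    proof -
      have "\<omega> \<in> B e \<longleftrightarrow> (e \<in> E \<longleftrightarrow> e \<in> G \<omega>)" for e using w by (simp add: B_def A_def)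
      then show ?thesis using sub[OF w] E by blast
    qed
    then show ?thesis by blast
  qed
  show "{\<omega> \<in> space M. G \<omega> = E} \<in> sets M"
    unfolding eq using B finite_graph_edges by (cases "graph_edges n
        = {}") (auto intro!: sets.Int sets.finite_INT)
  have pB: "prob (B e) = (if e \<in> E then p else 1 - p)" if "e \<in> graph_edges n" for e
    using that A pA by (auto simp: B_def prob_compl)
  show "measure M {\<omega> \<in> space M. G \<omega> = E} = (\<Prod>e\<in>graph_edges n. if e \<in> E then p else 1 - p)"
  proof (cases "graph_edges n = {}")
    \<comment> \<open>There are no edges when \<open>n <= 1\<close>, and an intersection over the
      empty family is not confined to \<open>space M\<close>.\<close>
    case True
    then show ?thesis unfolding eq by (simp add: prob_space)
  next
    case False
    \<comment> \<open>Passing to the generated sigma-algebras extends independence from the events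
      to their complements.\<close>
    have "indep_sets (\<lambda>e. sigma_sets (space M) {A e}) (graph_edges n)"
      using indep unfolding indep_events_def_alt
          by (rule indep_sets_sigma) (simp add: Int_stable_def)
    moreover have "\<forall>e\<in>graph_edges n. B e \<in> sigma_sets (space M) {A e}"
      by (auto simp: B_def intro!: sigma_sets.Basic sigma_sets.Compl)
    ultimately have "prob (\<Inter>e\<in>graph_edges n. B e) = (\<Prod>e\<in>graph_edges n. prob (B e))"
      using False finite_graph_edges by (intro indep_setsD) auto
    moreover have "space M \<inter> (\<Inter>e\<in>graph_edges n. B e) = (\<Inter>e\<in>graph_edges n. B e)"
      using False B sets.sets_into_space by blast
    ultimately show ?thesis unfolding eq by (simp add: pB)
  qed
qed

text \<open>The bridge to finite sums: the graph takes finitely many values, each an event, so every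
  property \<open>P\<close> of it is measurable.\<close>

lemma
  assumes M: "prob_space M" and G: "erdos_renyi M n p G"
  shows erdos_renyi_sets: "{\<omega> \<in> space M. P (G \<omega>)} \<in> sets M"
    and erdos_renyi_prob: "measure M {\<omega> \<in> space M. P (G \<omega>)}
        = bern_exp p (graph_edges n) (\<lambda>E. of_bool (P E))"
proof -
  interpret prob_space M by fact
  let ?I = "{E \<in> Pow (graph_edges n). P E}"
  have fin: "finite ?I" using finite_graph_edges by simp
  have eq: "{\<omega> \<in> space M. P (G \<omega>)} = (\<Union>E\<in>?I. {\<omega> \<in> space M. G \<omega> = E})"
    using G by (auto simp: erdos_renyi_def)
  have sets: "{\<omega> \<in> space M. G \<omega> = E} \<in> sets M" if "E \<in> ?I" for E
    using that by (intro erdos_renyi_eq_sets[OF M G]) auto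
  show "{\<omega> \<in> space M. P (G \<omega>)} \<in> sets M" unfolding eq using fin sets by (intro sets.finite_UN) auto
  have "prob {\<omega> \<in> space M. P (G \<omega>)} = (\<Sum>E\<in>?I. prob {\<omega> \<in> space M. G \<omega> = E})"
    unfolding eq using fin sets
        by (intro finite_measure_finite_Union) (auto simp: disjoint_family_on_def)
  also have "\<dots> = (\<Sum>E\<in>?I. \<Prod>e\<in>graph_edges n. if e \<in> E then p else 1 - p)"
    by (intro sum.cong refl erdos_renyi_eq_prob[OF M G]) auto
  also have "\<dots> = bern_exp p (graph_edges n) (\<lambda>E. of_bool (P E))"
    unfolding bern_exp_def using finite_graph_edges
    by (intro sum.mono_neutral_cong_left) auto
  finally show "prob {\<omega> \<in> space M. P (G \<omega>)} = bern_exp p (graph_edges n) (\<lambda>E. of_bool (P E))" .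
qed

text \<open>The graphs for different \<open>n\<close> may depend on each other in any way, so the
  proof goes through Borel-Cantelli. The hypothesis with \<open>C\<close> is shaped for
  \<open>l = sqrt n\<close> in the tail bound.\<close>

lemma erdos_renyi_AE_concentration:
  fixes f :: "nat \<Rightarrow> nat set set \<Rightarrow> real"
  assumes M: "prob_space M" and p: "0 \<le> p" "p \<le> 1"
    and G: "\<And>n. n \<ge> 1 \<Longrightarrow> erdos_renyi M n p (G n)"
    and diff: "\<And>n e E. n \<ge> 1 \<Longrightarrow> e \<in> graph_edges n \<Longrightarrow> E \<subseteq> graph_edges n \<Longrightarrow> e \<notin> E \<Longrightarrow>
      \<bar>f n (insert e E) - f n E\<bar> \<le> c n"
    and c: "\<And>n. n \<ge> 1 \<Longrightarrow> real n * (real (card (graph_edges n)) * (c n)\<^sup>2) \<le> C"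
  shows "AE \<omega> in M. (\<lambda>n. f n (G n \<omega>) - bern_exp p (graph_edges n) (f n)) \<longlonglongrightarrow> 0"
proof -
  interpret prob_space M by fact
  define m where "m n = bern_exp p (graph_edges n) (f n)" for n
  have "AE \<omega> in M. \<forall>\<^sub>F n in sequentially. \<bar>f n (G n \<omega>) - m n\<bar> < \<epsilon>" if \<epsilon>: "\<epsilon> > 0" for \<epsilon>
  proof -
    \<comment> \<open>The law of the graph is assumed from \<open>n = 1\<close> on; an empty event
      at 0 leaves the limit unchanged.\<close>
    define A where "A n = (if n = 0 then {} else {\<omega> \<in> space M. \<epsilon> \<le> \<bar>f n (G n \<omega>) - m n\<bar>})" for n
    have A: "A n \<in> events" for n
      unfolding A_def using erdos_renyi_sets[OF M G, where P="\<lambda>E. \<epsilon> \<le> \<bar>f n E - m n\<bar>"] by auto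
    have le: "prob (A n) \<le> 2 * exp C * exp (- (sqrt (real n) * \<epsilon>))" for n
    proof (cases "n = 0")
      case False
      then have n: "n \<ge> 1" by simp
      have "prob (A n) = bern_exp p (graph_edges n) (\<lambda>E. of_bool (\<epsilon> \<le> \<bar>f n E - m n\<bar>))"
        unfolding A_def using False erdos_renyi_prob[OF M G[OF n], where P="\<lambda>E. \<epsilon>
            \<le> \<bar>f n E - m n\<bar>"] by simp
      also have "\<dots> \<le> 2 * exp ((sqrt (real n))\<^sup>2 * (real (card (graph_edges n)) * (c n)\<^sup>2)) * exp
          (- (sqrt (real n) * \<epsilon>))"
        unfolding m_def using False n
        by (intro bern_exp_tail_le[OF p finite_graph_edges diff[OF n]]) auto
      also have "\<dots> \<le> 2 * exp C * exp (- (sqrt (real n) * \<epsilon>))"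
        using c[OF n] by (intro mult_right_mono mult_left_mono) auto
      finally show ?thesis .
    qed (simp add: A_def)
    have "summable (\<lambda>n. 2 * exp C * exp (- (sqrt (real n) * \<epsilon>)))"
    proof (rule summable_mult, rule summable_comparison_test_bigo)
      show "summable (\<lambda>n. norm (1 / real n ^ 2))"
        using inverse_power_summable[of 2, where 'a=real] by (simp add: divide_inverse)
      show "(\<lambda>n. exp (- (sqrt (real n) * \<epsilon>))) \<in> O(\<lambda>n. 1 / real n ^ 2)" using \<epsilon> by real_asymp
    qed
    then have "summable (\<lambda>n. prob (A n))"
      by (rule summable_comparison_test[rotated]) (use le in auto)
    then have "AE \<omega> in M. \<forall>\<^sub>F n in sequentially. \<omega> \<in> space M - A n"
      by (intro borel_cantelli_AE1 A) (auto simp: emeasure_eq_measure)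
    then show ?thesis
    proof (eventually_elim)
      case (elim \<omega>)
      from elim eventually_gt_at_top[of 0] show ?case
        by eventually_elim (auto simp: A_def not_le)
    qed
  qed
  \<comment> \<open>Countably many tolerances leave a single null set.\<close>
  then have "AE \<omega> in M. \<forall>k. \<forall>\<^sub>F n in sequentially. \<bar>f n (G n \<omega>) - m n\<bar> < 1 / real (Suc k)"
    unfolding AE_all_countable by simp
  then show ?thesis
  proof eventually_elim
    case (elim \<omega>)
    show ?case
    proof (rule tendstoI)
      fix e :: real assume "e > 0"
      then obtain k where k: "1 / real (Suc k) < e" using nat_approx_posE by blast
      from elim have "\<forall>\<^sub>F n in sequentially. \<bar>f n (G n \<omega>) - m n\<bar> < 1 / real (Suc k)" by blast
      then show "\<forall>\<^sub>F n in sequentially. dist (f n (G n \<omega>) - bern_exp p (graph_edges n) (f n)) 0 < e"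
        by eventually_elim (use k in \<open>auto simp: m_def\<close>)
    qed
  qed
qed

section \<open>Almost sure limits of the resolvent trace and of the mean diagonal entry\<close>

context lap_resolvent
begin

text \<open>The scalar \<open>tr A / n\<close> that separates \<open>A\<close> from the scaled
  \<open>L1_mat\<close>.\<close>

definition "trace_D E = (\<Sum>i<n. D E i) / real n"

lemma trace_D_diff:
  assumes "e \<in> F" "e \<notin> E"
  shows "\<bar>trace_D (insert e E) - trace_D E\<bar> \<le> 2 * t / real n"
proof -
  obtain a b where ab: "a < n" "b < n" "a \<noteq> b" and e: "e = vedge a b"
    using assms graph_edgesE unfolding F_def by metis
  have E: "E - {e} = E" using assms by auto
  have "(\<Sum>i<n. D (insert e E) i - D E i) = (\<Sum>i<n. t * (of_bool (i = a) - of_bool (i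
      = b)) * (of_bool (i = a) - of_bool (i = b)))"
    unfolding D_def using centered_lap_insert[OF ab, of _ _ p t E]
        by (intro sum.cong) (auto simp: e[symmetric] E)
  also have "\<dots> = (\<Sum>i<n. (if i = a then t else 0) + (if i = b then t else 0))"
    using ab by (intro sum.cong) auto
  also have "\<dots> = 2 * t" using ab by (simp add: sum.distrib)
  finally have "trace_D (insert e E) - trace_D E = 2 * t / real n"
    by (simp add: trace_D_def sum_subtractf diff_divide_distrib[symmetric])
  then show ?thesis using t_pos by simp
qed

lemma expectation_trace_D: "EE trace_D = 0"
proof -
  \<comment> \<open>Integration by parts against a constant: the difference quotient is 0.\<close>
  have 0: "EE (\<lambda>E. of_bool (e \<in> E) - p) = 0" if "e \<in> F" for e
    using bern_exp_by_parts[OF finite_F that, of p "\<lambda>_. 1::real"] finite_F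
        by (simp add: bern_exp_const)
  have "EE (\<lambda>E. D E i) = 0" if i: "i < n" for i
  proof -
    have "EE (\<lambda>E. D E i) = t * (\<Sum>k\<in>{..<n} - {i}. EE (\<lambda>E. of_bool (vedge i k \<in> E) - p))"
      unfolding D_def centered_lap_def by (simp add: bern_exp_mult_left bern_exp_sum)
    also have "(\<Sum>k\<in>{..<n} - {i}. EE (\<lambda>E. of_bool (vedge i k \<in> E) - p)) = 0"
      using i by (intro sum.neutral ballI 0) (auto simp: F_def intro!: vedge_in_graph_edges)
    finally show ?thesis by simp
  qed
  then show ?thesis
    unfolding trace_D_def divide_inverse bern_exp_mult_right bern_exp_sum by simp
qed

end

lemma erdos_renyi_AE_resolvent:
  assumes M: "prob_space M" and p: "0 < p" "p < 1" and \<sigma>: "\<sigma> = sqrt (p * (1 - p))"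
    and G: "\<And>n. n \<ge> 1 \<Longrightarrow> erdos_renyi M n p (G n)" and z: "Im z > 0"
  shows "AE \<omega> in M. (\<lambda>n. lap_resolvent.S p \<sigma> n z (G n \<omega>) - lap_resolvent.s p \<sigma> n z) \<longlonglongrightarrow> 0"
proof -
  have loc: "lap_resolvent p \<sigma> n z" if "n \<ge> 1" for n using p \<sigma> z that by unfold_locales
  define c where "c n = 4 * lap_resolvent.t \<sigma> n / (real n * (Im z)\<^sup>2)" for n
  have c: "real n * (real (card (graph_edges n)) * (c n)\<^sup>2) \<le> 16 * (1/Im z)^4 / \<sigma>\<^sup>2" if "n \<ge> 1"
      for n
  proof -
    interpret lap_resolvent p \<sigma> n z by (rule loc[OF that])
    show ?thesis using card_F_diff_sq unfolding c_def F_def \<eta>_def by simp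
  qed
  have "AE \<omega> in M. (\<lambda>n. Re (lap_resolvent.S p \<sigma> n z (G n \<omega>)) - bern_exp p (graph_edges n) (\<lambda>E. Re
      (lap_resolvent.S p \<sigma> n z E))) \<longlonglongrightarrow> 0"
  proof (rule erdos_renyi_AE_concentration[OF M _ _ G _ c])
    show "\<bar>Re (lap_resolvent.S p \<sigma> n z (insert e E)) - Re (lap_resolvent.S p \<sigma> n z E)\<bar> \<le> c n"
      if "n \<ge> 1" "e \<in> graph_edges n" "E \<subseteq> graph_edges n" "e \<notin> E" for n e E
    proof -
      interpret lap_resolvent p \<sigma> n z by (rule loc[OF that(1)])
      show ?thesis using S_Re_diff_le[of e E] that unfolding c_def F_def \<eta>_def by simp
    qed
  qed (use p in auto)
  moreover have "AE \<omega> in M. (\<lambda>n. Im (lap_resolvent.S p \<sigma> n z (G n \<omega>)) - bern_exp p (graph_edges n)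
      (\<lambda>E. Im (lap_resolvent.S p \<sigma> n z E))) \<longlonglongrightarrow> 0"
  proof (rule erdos_renyi_AE_concentration[OF M _ _ G _ c])
    show "\<bar>Im (lap_resolvent.S p \<sigma> n z (insert e E)) - Im (lap_resolvent.S p \<sigma> n z E)\<bar> \<le> c n"
      if "n \<ge> 1" "e \<in> graph_edges n" "E \<subseteq> graph_edges n" "e \<notin> E" for n e E
    proof -
      interpret lap_resolvent p \<sigma> n z by (rule loc[OF that(1)])
      show ?thesis using S_Im_diff_le[of e E] that unfolding c_def F_def \<eta>_def by simp
    qed
  qed (use p in auto)
  ultimately show ?thesis
  proof eventually_elim
    case (elim \<omega>)
    let ?d = "\<lambda>n. lap_resolvent.S p \<sigma> n z (G n \<omega>) - lap_resolvent.s p \<sigma> n z"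
    have parts: "bern_exp p (graph_edges n) (\<lambda>E. Re (lap_resolvent.S p \<sigma> n z E))
        = Re (lap_resolvent.s p \<sigma> n z)"
      "bern_exp p (graph_edges n) (\<lambda>E. Im (lap_resolvent.S p \<sigma> n z E))
          = Im (lap_resolvent.s p \<sigma> n z)"
      if "n \<ge> 1" for n
    proof -
      interpret lap_resolvent p \<sigma> n z by (rule loc[OF that])
      show "bern_exp p (graph_edges n) (\<lambda>E. Re (S E))
          = Re s" "bern_exp p (graph_edges n) (\<lambda>E. Im (S E)) = Im s"
        using bern_exp_Re[of S] bern_exp_Im[of S] by (simp_all add: s_def F_def)
    qed
    have "(\<lambda>n. Re (?d n)) \<longlonglongrightarrow> 0"
      by (rule Lim_transform_eventually[OF elim(1)], rule eventually_mono[OF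
          eventually_ge_at_top[of 1]]) (simp add: parts)
    moreover have "(\<lambda>n. Im (?d n)) \<longlonglongrightarrow> 0"
      by (rule Lim_transform_eventually[OF elim(2)], rule eventually_mono[OF
          eventually_ge_at_top[of 1]]) (simp add: parts)
    ultimately show ?case by (simp add: tendsto_complex_iff)
  qed
qed

lemma erdos_renyi_AE_trace:
  assumes M: "prob_space M" and p: "0 < p" "p < 1" and \<sigma>: "\<sigma> = sqrt (p * (1 - p))"
    and G: "\<And>n. n \<ge> 1 \<Longrightarrow> erdos_renyi M n p (G n)"
  shows "AE \<omega> in M. (\<lambda>n. lap_resolvent.trace_D p \<sigma> n (G n \<omega>)) \<longlonglongrightarrow> 0"
proof -
  \<comment> \<open>\<open>\<i>\<close> is a point of the upper half plane at which to instantiate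
    the locale.\<close>
  have loc: "lap_resolvent p \<sigma> n \<i>" if "n \<ge> 1" for n using p \<sigma> that by unfold_locales auto
  have "AE \<omega> in M. (\<lambda>n. lap_resolvent.trace_D p \<sigma> n (G n \<omega>) - bern_exp p (graph_edges n)
      (lap_resolvent.trace_D p \<sigma> n)) \<longlonglongrightarrow> 0"
  proof (rule erdos_renyi_AE_concentration[where c="\<lambda>n. 2 * lap_resolvent.t \<sigma> n / real n"
      and C="4 / \<sigma>\<^sup>2", OF M _ _ G])
    fix n :: nat assume n: "n \<ge> 1"
    interpret lap_resolvent p \<sigma> n \<i> by (rule loc[OF n])
    show "\<bar>trace_D (insert e E) - trace_D E\<bar> \<le> 2 * t / real n" if "e \<in> graph_edges n" "e \<notin> E"
        for e E
      using that by (intro trace_D_diff) (auto simp: F_def)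
    have "real n * (real (card (graph_edges n)) * (2 * t / real n)\<^sup>2)
        \<le> real n * ((real n)\<^sup>2 * (2 * t / real n)\<^sup>2)"
      using card_graph_edges_le[of n]
          by (intro mult_left_mono mult_right_mono) (auto simp flip: of_nat_power)
    also have "\<dots> = 4 / \<sigma>\<^sup>2 * (real n * (\<sigma>\<^sup>2 * t\<^sup>2))"
      using n \<sigma>_pos by (simp add: power_mult_distrib power_divide)
    also have "\<dots> = 4 / \<sigma>\<^sup>2" unfolding t_sq using n by simp
    finally show "real n * (real (card (graph_edges n)) * (2 * t / real n)\<^sup>2) \<le> 4 / \<sigma>\<^sup>2" .
  qed (use p in auto)
  then show ?thesis
  proof eventually_elim
    case (elim \<omega>)
    show ?case
    proof (rule Lim_transform_eventually[OF elim], rule eventually_mono[OF eventually_ge_at_top[of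
        1]])
      fix n :: nat assume n: "1 \<le> n"
      interpret lap_resolvent p \<sigma> n \<i> by (rule loc[OF n])
      show "trace_D (G n \<omega>) - bern_exp p (graph_edges n) trace_D = trace_D (G n \<omega>)"
        using expectation_trace_D by (simp add: F_def)
    qed
  qed
qed

subsection \<open>Spectrum of the shifted Laplacian\<close>

lemma sum_offdiagonal_symmetric:
  fixes f :: "nat \<Rightarrow> nat \<Rightarrow> real"
  assumes sym: "\<And>i k. f i k = f k i"
  shows "(\<Sum>i<n. \<Sum>k\<in>{..<n} - {i}. f i k) = 2 * (\<Sum>j<n. \<Sum>i<j. f i j)"
proof (induction n)
  case (Suc n)
  have "(\<Sum>i<Suc n. \<Sum>k\<in>{..<Suc n} - {i}. f i k)
      = (\<Sum>i<n. \<Sum>k\<in>{..<Suc n} - {i}. f i k) + (\<Sum>k\<in>{..<Suc n} - {n}. f n k)" by simp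
  also have "(\<Sum>i<n. \<Sum>k\<in>{..<Suc n} - {i}. f i k) = (\<Sum>i<n. (\<Sum>k\<in>{..<n} - {i}. f i k) + f i n)"
  proof (intro sum.cong refl)
    fix i assume "i \<in> {..<n}"
    then have "{..<Suc n} - {i} = insert n ({..<n} - {i})" by auto
    then show "(\<Sum>k\<in>{..<Suc n} - {i}. f i k) = (\<Sum>k\<in>{..<n} - {i}. f i k) + f i n" by simp
  qed
  also have "\<dots> = 2 * (\<Sum>j<n. \<Sum>i<j. f i j) + (\<Sum>i<n. f i n)" by (simp add: sum.distrib Suc)
  also have "{..<Suc n} - {n} = {..<n}" by auto
  also have "(\<Sum>k\<in>{..<n}. f n k) = (\<Sum>i<n. f i n)" by (intro sum.cong refl sym)
  finally show ?case by simp
qed simp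

lemma degree_eq_sum:
  assumes E: "E \<subseteq> graph_edges n" and i: "i < n"
  shows "real (card {e \<in> E. Suc i \<in> e}) = (\<Sum>k\<in>{..<n} - {i}. of_bool (vedge i k \<in> E))"
proof -
  have "{e \<in> E. Suc i \<in> e} = vedge i ` {k \<in> {..<n} - {i}. vedge i k \<in> E}"
  proof (intro equalityI subsetI)
    fix e assume e: "e \<in> {e \<in> E. Suc i \<in> e}"
    then obtain a b where ab: "a < n" "b < n" "a \<noteq> b" "e = vedge a b" using E graph_edgesE by blast
    with e consider "i = a" | "i = b" by (auto simp: vedge_def)
    then show "e \<in> vedge i ` {k \<in> {..<n} - {i}. vedge i k \<in> E}"
    proof cases
      case 1
      then show ?thesis using ab e by (intro image_eqI[of _ _ b]) auto
    next
      case 2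
      then show ?thesis using ab e by (intro image_eqI[of _ _ a]) (auto simp: vedge_commute)
    qed
  qed (auto simp: vedge_def)
  moreover have "inj_on (vedge i) {k \<in> {..<n} - {i}. vedge i k \<in> E}"
      by (auto simp: inj_on_def vedge_eq_iff)
  ultimately have "card {e \<in> E. Suc i \<in> e} = card {k \<in> {..<n} - {i}. vedge i k \<in> E}"
      by (simp add: card_image)
  also have "\<dots> = card (({..<n} - {i}) \<inter> {k. vedge i k \<in> E})" by (rule arg_cong[of _ _ card]) auto
  finally show ?thesis by (simp add: sum_of_bool_eq)
qed

text \<open>Subtracting \<open>2 |E| / n\<close>, the mean degree, amounts to removing the mean of
  the diagonal, and in this difference the centering constant \<open>(n - 1) p\<close> drops out.
  Off the diagonal the term \<open>p (J - I)\<close> supplies the centering.\<close>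

lemma scaled_L1_mat_entry:
  assumes E: "E \<subseteq> graph_edges n" and ij: "i < n" "j < n"
  shows "(t \<cdot>\<^sub>m L1_mat n p E) $$ (i,j)
    = centered_lap p t n E i j - (if i = j then (\<Sum>k<n. centered_lap p t n E k k) / real n else 0)"
proof (cases "i = j")
  case False
  then show ?thesis using ij
    by (simp add: L1_mat_def laplacian_mat_def degree_mat_def adj_mat_def ones_mat_def
        centered_lap_def vedge_def)
next
  case True
  define a where "a i k = (of_bool (vedge i k \<in> E) :: real)" for i k
  define d where "d i = (\<Sum>k\<in>{..<n} - {i}. a i k)" for i
  define q where "q = real (n - 1) * p"
  have lap: "centered_lap p t n E k k = t * (d k - q)" if "k < n" for k
    using that by (simp add: centered_lap_def d_def a_def q_def sum_subtractf)
  have "(\<Sum>k<n. d k) = 2 * (\<Sum>j<n. \<Sum>i<j. a i j)"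
    unfolding d_def by (rule sum_offdiagonal_symmetric) (simp add: a_def vedge_commute)
  also have "(\<Sum>j<n. \<Sum>i<j. a i j) = (\<Sum>j<n. \<Sum>i<j. adj_mat n E $$ (i,j))"
    by (intro sum.cong refl) (auto simp: a_def adj_mat_def vedge_def)
  finally have sd: "(\<Sum>k<n. d k) = 2 * (\<Sum>j<n. \<Sum>i<j. adj_mat n E $$ (i,j))" .
  have "(\<Sum>k<n. centered_lap p t n E k k) = (\<Sum>k<n. t * (d k - q))"
    using lap by (intro sum.cong) auto
  also have "\<dots> = t * ((\<Sum>k<n. d k) - real n * (q))"
    by (simp add: sum_distrib_left[symmetric] sum_subtractf)
  finally have "(\<Sum>k<n. centered_lap p t n E k k) / real n = t * ((\<Sum>k<n. d k) / real n - q)"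
    using ij by (simp add: field_simps)
  moreover have "adj_mat n E $$ (i,i) = 0"
    using E ij by (auto simp: adj_mat_def graph_edges_def)
  moreover have "degree_mat n E $$ (i,i) = d i"
    using ij degree_eq_sum[OF E ij(1)] by (simp add: degree_mat_def d_def a_def)
  moreover have "(t \<cdot>\<^sub>m L1_mat n p E) $$ (i,i)
      = t * (degree_mat n E $$ (i,i) - adj_mat n E $$ (i,i) - 2 * (\<Sum>j<n. \<Sum>i<j. adj_mat n E $$
          (i,j)) / real n)"
    using ij by (simp add: L1_mat_def laplacian_mat_def ones_mat_def degree_mat_def adj_mat_def)
  ultimately show ?thesis
    using True ij lap[of i] by (simp add: sd algebra_simps)
qed

text \<open>The resolvent identity turns the shift into \<open>\<epsilon>\<close> times a pairing of
  a row of \<open>R\<close> with a column of \<open>R'\<close>, both bounded by the Ward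
  identity.\<close>

lemma resolvent_trace_shift:
  assumes sym: "\<And>i j. i < n \<Longrightarrow> j < n \<Longrightarrow> A i j = A j i" and z: "Im z > 0"
    and A': "\<And>i j. i < n \<Longrightarrow> j < n \<Longrightarrow> A' i j = A i j - (if i = j then \<epsilon> else 0)"
    and R: "is_resolvent n A z R" and R': "is_resolvent n A' z R'"
  shows "cmod ((\<Sum>k<n. R' k k) - (\<Sum>k<n. R k k)) \<le> real n * \<bar>\<epsilon>\<bar> / (Im z)\<^sup>2"
proof -
  have sym': "A' i j = A' j i" if "i < n" "j < n" for i j using A' sym that by auto
  have one: "cmod (R' k k - R k k) \<le> \<bar>\<epsilon>\<bar> / (Im z)\<^sup>2" if k: "k < n" for k
  proof -
    have "R' k k - R k k = (\<Sum>i<n. \<Sum>j<n. R k i * of_real (A' i j - A i j) * R' j k)"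
      using resolvent_identity[OF R R' k k] by simp
    also have "\<dots> = (\<Sum>i<n. \<Sum>j<n. if j = i then - \<epsilon> * (R k i * R' i k) else 0)"
      by (intro sum.cong refl) (auto simp: A')
    also have "\<dots> = - \<epsilon> * (\<Sum>i<n. R k i * R' i k)" by (simp add: sum_distrib_left sum_negf)
    finally have "cmod (R' k k - R k k) = \<bar>\<epsilon>\<bar> * cmod (\<Sum>i<n. R k i * R' i k)"
        by (simp add: norm_mult)
    also have "cmod (\<Sum>i<n. R k i * R' i k) \<le> (\<Sum>i<n. ((cmod (R k i))\<^sup>2 + (cmod (R' i k))\<^sup>2) / 2)"
    proof (intro order_trans[OF norm_sum] sum_mono)
      show "cmod (R k i * R' i k) \<le> ((cmod (R k i))\<^sup>2 + (cmod (R' i k))\<^sup>2) / 2" for i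
        using sum_squares_bound[of "cmod (R k i)" "cmod (R' i k)"] by (simp add: norm_mult)
    qed
    also have "\<dots> \<le> 1 / (Im z)\<^sup>2"
      using resolvent_row_sq[OF sym R z k] resolvent_col_sq[OF sym' R' z k]
      by (simp add: sum_divide_distrib[symmetric] sum.distrib)
    finally show ?thesis by (simp add: mult_left_mono)
  qed
  have "cmod ((\<Sum>k<n. R' k k) - (\<Sum>k<n. R k k)) \<le> (\<Sum>k<n. \<bar>\<epsilon>\<bar> / (Im z)\<^sup>2)"
    unfolding sum_subtractf[symmetric] by (intro order_trans[OF norm_sum] sum_mono one) auto
  then show ?thesis by simp
qed

text \<open>The uniform law on positions, not on values, so that a repeated eigenvalue keeps its
  multiplicity.\<close>

definition empirical :: "real list \<Rightarrow> real measure" where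
  "empirical xs = distr (uniform_count_measure {..<length xs}) borel (\<lambda>i. xs ! i)"

lemma empirical_measurable: "(\<lambda>i. xs ! i) \<in> measurable (uniform_count_measure {..<length xs}) borel"
  by (simp add: uniform_count_measure_def)

lemma real_distribution_empirical:
  assumes "xs \<noteq> []" shows "real_distribution (empirical xs)"
proof -
  interpret prob_space "uniform_count_measure {..<length xs}"
    using assms by (intro prob_space_uniform_count_measure) auto
  have "prob_space (empirical xs)"
    unfolding empirical_def by (rule prob_space_distr[OF empirical_measurable])
  then show ?thesis
    unfolding real_distribution_def real_distribution_axioms_def by (simp add: empirical_def)
qed

lemma cdf_empirical:
  assumes "xs \<noteq> []"
  shows "cdf (empirical xs) x = real (size {#l \<in># mset xs. l \<le> x#}) / real (length xs)"
proof -
  let ?J = "{i. i < length xs \<and> xs ! i \<le> x}"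
  have "cdf (empirical xs) x = measure (uniform_count_measure {..<length xs}) ?J"
    unfolding cdf_def empirical_def
    by (subst measure_distr[OF empirical_measurable])
      (auto simp: space_uniform_count_measure intro!: arg_cong[where f="measure _"])
  also have "\<dots> = real (card ?J) / real (length xs)"
    unfolding measure_def by (subst emeasure_uniform_count_measure) auto
  also have "card ?J = length (filter (\<lambda>l. l \<le> x) xs)" by (simp add: length_filter_conv_card)
  finally show ?thesis by (simp flip: mset_filter)
qed

lemma cauchy_transform_empirical:
  "cauchy_transform (empirical xs) z = (\<Sum>x\<leftarrow>xs. 1 / (z - of_real x)) / of_nat (length xs)"
proof -
  have [measurable]: "(\<lambda>x. 1 / (z - complex_of_real x)) \<in> borel_measurable borel" by measurable
  have "cauchy_transform (empirical xs) z
      = (LINT i|uniform_count_measure {..<length xs}. 1 / (z - complex_of_real (xs ! i)))"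
    unfolding cauchy_transform_def empirical_def
        by (subst integral_distr[OF empirical_measurable]) auto
  also have "\<dots> = (\<Sum>i<length xs. (1 / real (length xs)) *\<^sub>R (1 / (z - complex_of_real (xs ! i))))"
    unfolding uniform_count_measure_def by (subst lebesgue_integral_point_measure_finite) auto
  also have "\<dots> = (\<Sum>i<length xs. 1 / (z - complex_of_real (xs ! i))) / of_nat (length xs)"
    by (simp add: scaleR_conv_of_real sum_divide_distrib mult.commute)
  also have "(\<Sum>i<length xs. 1 / (z - complex_of_real (xs ! i))) = (\<Sum>x\<leftarrow>xs. 1 / (z - of_real x))"
    by (simp add: sum_list_sum_nth atLeast0LessThan)
  finally show ?thesis .
qed

text \<open>One list serves all \<open>z\<close>, so a single measure carries both the spectral
  distribution function and the transforms. The error is the effect of the shift by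
  \<open>trace_D\<close>.\<close>

lemma scaled_L1_mat_spectrum:
  assumes p: "0 < p" "p < 1" and \<sigma>: "\<sigma> = sqrt (p * (1 - p))" and n: "n \<ge> 1"
      and E: "E \<subseteq> graph_edges n"
  shows "\<exists>xs. length xs = n \<and> esd ((1 / (\<sigma> * sqrt (real n))) \<cdot>\<^sub>m L1_mat n p E)
      = cdf (empirical xs) \<and>
    (\<forall>z. Im z > 0 \<longrightarrow> cmod (cauchy_transform (empirical xs) z - lap_resolvent.S p \<sigma> n z E)
       \<le> \<bar>lap_resolvent.trace_D p \<sigma> n E\<bar> / (Im z)\<^sup>2)"
proof -
  define t where "t = 1 / (\<sigma> * sqrt (real n))"
  define B where "B = t \<cdot>\<^sub>m L1_mat n p E"
  define \<epsilon> where "\<epsilon> = (\<Sum>k<n. centered_lap p t n E k k) / real n"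
  have B: "B \<in> carrier_mat n n"
    by (simp add: B_def L1_mat_def laplacian_mat_def degree_mat_def adj_mat_def ones_mat_def
        carrier_matI)
  have entry: "B $$ (i,j) = centered_lap p t n E i j - (if i = j then \<epsilon> else 0)" if "i < n" "j
      < n" for i j
    unfolding B_def \<epsilon>_def by (rule scaled_L1_mat_entry[OF E that])
  have symB: "B $$ (i,j) = B $$ (j,i)" if "i < n" "j < n" for i j
    using entry that centered_lap_sym[of p t n E i j] by auto
  obtain xs where xs: "length xs = n" "proots (char_poly B) = mset xs"
    and tr: "\<And>z R. Im z > 0 \<Longrightarrow> is_resolvent n (\<lambda>i j. B $$ (i,j)) z R \<Longrightarrow>
      (\<Sum>i<n. R i i) = (\<Sum>x\<leftarrow>xs. 1 / (z - of_real x))"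
    using symmetric_mat_spectrum[OF B symB] by blast
  have ne: "xs \<noteq> []" using xs n by auto
  have "esd B = cdf (empirical xs)"
    using B xs by (auto simp: esd_def cdf_empirical[OF ne])
  moreover have "cmod (cauchy_transform (empirical xs) z - lap_resolvent.S p \<sigma> n z E)
       \<le> \<bar>lap_resolvent.trace_D p \<sigma> n E\<bar> / (Im z)\<^sup>2" if z: "Im z > 0" for z
  proof -
    interpret L: lap_resolvent p \<sigma> n z using p \<sigma> n z by unfold_locales
    have t: "L.t = t" by (simp add: t_def L.t_def)
    have eps: "L.trace_D E = \<epsilon>" by (simp add: L.trace_D_def L.D_def \<epsilon>_def t)
    obtain R' where R': "is_resolvent n (\<lambda>i j. B $$ (i,j)) z R'"
      using ex_resolvent[of n "\<lambda>i j. B $$ (i,j)" z] symB z by auto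
    have "cmod ((\<Sum>k<n. R' k k) - (\<Sum>k<n. L.R E k k)) \<le> real n * \<bar>\<epsilon>\<bar> / (Im z)\<^sup>2"
      using entry by (intro resolvent_trace_shift[OF centered_lap_sym z _ L.resolvent_R R']) (auto
          simp: t)
    moreover have "cauchy_transform (empirical xs) z - L.S E
        = ((\<Sum>k<n. R' k k) - (\<Sum>k<n. L.R E k k)) / of_nat n"
      unfolding cauchy_transform_empirical tr[OF z R', symmetric] L.S_def xs
          by (simp add: diff_divide_distrib)
    ultimately have "cmod (cauchy_transform (empirical xs) z - L.S E)
        \<le> real n * \<bar>\<epsilon>\<bar> / (Im z)\<^sup>2 / real n"
      by (simp only: norm_divide norm_of_nat) (intro divide_right_mono, auto)
    then show ?thesis using n unfolding eps by simp
  qed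
  ultimately show ?thesis unfolding B_def t_def using xs by blast
qed

theorem theorem3:
  fixes M :: "'w measure" and G :: "nat \<Rightarrow> 'w \<Rightarrow> nat set set" and p \<sigma> :: real
  assumes "prob_space M"
    and "0 < p" and "p < 1" and "\<sigma> = sqrt (p * (1 - p))"
    and "\<And>n. n \<ge> 1 \<Longrightarrow> erdos_renyi M n p (G n)"
  shows "AE \<omega> in M.
    weak_conv (\<lambda>n. esd ((1 / (\<sigma> * sqrt (real n))) \<cdot>\<^sub>m L1_mat n p (G n \<omega>)))
      (cdf (semicircle_distribution \<boxplus> std_normal_distribution))"
proof -
  note p = assms(2,3) and \<sigma> = assms(4) and G = assms(5)
  interpret N: unit_variance_distribution std_normal_distribution by (rule unit_variance_std_normal)
  \<comment> \<open>Countability lets the exceptional null sets of the points \<open>z\<close> be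
    united.\<close>
  obtain D0 :: "complex set" where D0: "countable D0" "\<And>X. open X \<Longrightarrow> X \<noteq> {} \<Longrightarrow> \<exists>d\<in>D0. d \<in> X"
    using countable_dense_setE by metis
  \<comment> \<open>The points \<open>\<i> * k\<close> are added for the tightness argument.\<close>
  define D where "D = (D0 \<union> range (\<lambda>k::nat. \<i> * of_nat k)) \<inter> {z. Im z > 0}"
  have "countable D" using D0(1) unfolding D_def by auto
  then have "AE \<omega> in M. \<forall>z\<in>D. (\<lambda>n. lap_resolvent.S p \<sigma> n z (G n \<omega>) - lap_resolvent.s p \<sigma> n z) \<longlonglongrightarrow> 0"
    using erdos_renyi_AE_resolvent[OF assms] by (subst AE_ball_countable) (auto simp: D_def)
  moreover have "AE \<omega> in M. (\<lambda>n. lap_resolvent.trace_D p \<sigma> n (G n \<omega>)) \<longlonglongrightarrow> 0"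
    by (rule erdos_renyi_AE_trace[OF assms])
  ultimately show ?thesis
    using AE_space
  proof eventually_elim
    case (elim \<omega>)
    let ?esd = "\<lambda>n. esd ((1 / (\<sigma> * sqrt (real n))) \<cdot>\<^sub>m L1_mat n p (G n \<omega>))"
    have "\<forall>n. \<exists>\<mu>. real_distribution \<mu> \<and> (n \<ge> 1 \<longrightarrow> ?esd n = cdf \<mu> \<and>
        (\<forall>z. Im z > 0 \<longrightarrow> cmod (cauchy_transform \<mu> z - lap_resolvent.S p \<sigma> n z (G n \<omega>))
            \<le> \<bar>lap_resolvent.trace_D p \<sigma> n (G n \<omega>)\<bar> / (Im z)\<^sup>2))"
    proof
      fix n :: nat
      show "\<exists>\<mu>. real_distribution \<mu> \<and> (n \<ge> 1 \<longrightarrow> ?esd n = cdf \<mu> \<and>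
        (\<forall>z. Im z > 0 \<longrightarrow> cmod (cauchy_transform \<mu> z - lap_resolvent.S p \<sigma> n z (G n \<omega>))
            \<le> \<bar>lap_resolvent.trace_D p \<sigma> n (G n \<omega>)\<bar> / (Im z)\<^sup>2))"
      proof (cases "n \<ge> 1")
        case True
        have E: "G n \<omega> \<subseteq> graph_edges n" using G[OF True] elim(3) by (auto simp: erdos_renyi_def)
        obtain xs where "length xs = n" "?esd n = cdf (empirical xs)"
          "\<forall>z. Im z > 0 \<longrightarrow> cmod (cauchy_transform (empirical xs) z - lap_resolvent.S p \<sigma> n z (G n \<omega>))
            \<le> \<bar>lap_resolvent.trace_D p \<sigma> n (G n \<omega>)\<bar> / (Im z)\<^sup>2"
          using scaled_L1_mat_spectrum[OF p \<sigma> True E] by blast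
        moreover have "real_distribution (empirical xs)"
          using True \<open>length xs = n\<close> by (intro real_distribution_empirical) auto
        ultimately show ?thesis by blast
      next
        \<comment> \<open>For \<open>n = 0\<close> any law serves; the limit does not see
          it.\<close>
        case False
        then show ?thesis using N.real_distribution_axioms by blast
      qed
    qed
    then obtain \<mu> where \<mu>: "\<And>n. real_distribution (\<mu> n)" and esd: "\<And>n. n \<ge> 1 \<Longrightarrow> ?esd n = cdf (\<mu> n)"
      and near: "\<And>n z. n \<ge> 1 \<Longrightarrow> Im z > 0
          \<Longrightarrow> cmod (cauchy_transform (\<mu> n) z - lap_resolvent.S p \<sigma> n z (G n \<omega>))
            \<le> \<bar>lap_resolvent.trace_D p \<sigma> n (G n \<omega>)\<bar> / (Im z)\<^sup>2"
      unfolding choice_iff by blast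
    have lim: "(\<lambda>n. cauchy_transform (\<mu> n) z - cauchy_transform std_normal_distribution (z -
        cauchy_transform (\<mu> n) z)) \<longlonglongrightarrow> 0"
      if zD: "z \<in> D0 \<union> range (\<lambda>k::nat. \<i> * of_nat k)" and z: "Im z > 0" for z
    proof -
      define g where "g n = cauchy_transform (\<mu> n) z" for n
      define s where "s n = lap_resolvent.s p \<sigma> n z" for n
      define S where "S n = lap_resolvent.S p \<sigma> n z (G n \<omega>)" for n
      let ?N = "cauchy_transform std_normal_distribution"
      have "(\<lambda>n. \<bar>lap_resolvent.trace_D p \<sigma> n (G n \<omega>)\<bar> / (Im z)\<^sup>2) \<longlonglongrightarrow> \<bar>0\<bar> / (Im z)\<^sup>2"
        using z by (intro tendsto_intros elim(2)) auto
      then have "(\<lambda>n. \<bar>lap_resolvent.trace_D p \<sigma> n (G n \<omega>)\<bar> / (Im z)\<^sup>2) \<longlonglongrightarrow> 0" by simp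
      moreover have "\<forall>\<^sub>F n in sequentially. norm (g n - S n)
          \<le> \<bar>lap_resolvent.trace_D p \<sigma> n (G n \<omega>)\<bar> / (Im z)\<^sup>2"
        using eventually_ge_at_top[of 1] by eventually_elim (auto simp: g_def S_def intro: near z)
      ultimately have "(\<lambda>n. g n - S n) \<longlonglongrightarrow> 0" by (rule Lim_null_comparison[rotated])
      moreover have "(\<lambda>n. S n - s n) \<longlonglongrightarrow> 0"
        unfolding S_def s_def using elim(1) zD z by (auto simp: D_def)
      ultimately have "(\<lambda>n. (g n - S n) + (S n - s n)) \<longlonglongrightarrow> 0 + 0" by (rule tendsto_add)
      then have gs: "(\<lambda>n. g n - s n) \<longlonglongrightarrow> 0" by simp
      have sN: "(\<lambda>n. s n - ?N (z - s n)) \<longlonglongrightarrow> 0"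
        unfolding s_def by (rule mean_resolvent_pastur[OF p \<sigma> z])
      \<comment> \<open>Both \<open>s n\<close> and \<open>g n\<close> have imaginary part at most
        0, so exchanging them inside the transform costs at most the factor
        \<open>1 / (Im z)^2\<close>.\<close>
      have "(\<lambda>n. ?N (z - s n) - ?N (z - g n)) \<longlonglongrightarrow> 0"
      proof (rule Lim_null_comparison)
        show "\<forall>\<^sub>F n in sequentially. norm (?N (z - s n) - ?N (z - g n))
            \<le> cmod (g n - s n) / (Im z * Im z)"
          using eventually_ge_at_top[of 1]
        proof eventually_elim
          case (elim n)
          interpret L: lap_resolvent p \<sigma> n z using p \<sigma> z elim by unfold_locales
          have Is: "Im (s n) \<le> 0" unfolding s_def by (rule L.Im_s_le)
          have Ig: "Im (g n) \<le> 0" unfolding g_def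
              by (rule real_distribution.Im_cauchy_transform_le[OF \<mu> z])
          have "cmod (?N (z - s n) - ?N (z - g n))
              \<le> cmod (z - s n - (z - g n)) / (Im (z - s n) * Im (z - g n))"
            using z Is Ig by (intro N.cauchy_transform_lipschitz) auto
          also have "\<dots> \<le> cmod (z - s n - (z - g n)) / (Im z * Im z)"
            using z Is Ig by (intro divide_left_mono mult_mono mult_pos_pos) auto
          finally show ?case by simp
        qed
        have "(\<lambda>n. cmod (g n - s n) / (Im z * Im z)) \<longlonglongrightarrow> 0 / (Im z * Im z)"
          using z by (intro tendsto_divide tendsto_norm_zero gs tendsto_const) auto
        then show "(\<lambda>n. cmod (g n - s n) / (Im z * Im z)) \<longlonglongrightarrow> 0" by simp
      qed
      from tendsto_add[OF tendsto_add[OF gs sN] this] show ?thesis by (simp add: g_def)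
    qed
    have "weak_conv_m \<mu> (semicircle_distribution \<boxplus> std_normal_distribution)"
    proof (rule pastur_weak_convergence[OF \<mu> unit_variance_std_normal _ _ lim])
      show "\<exists>z\<in>D0 \<union> range (\<lambda>k::nat. \<i> * of_nat k). z \<in> X" if "open X" "X \<noteq> {}" for X
        using D0(2)[OF that] by blast
    qed auto
    then show ?case
      unfolding weak_conv_m_def weak_conv_def
    proof (intro allI impI)
      fix x assume conv: "\<forall>x. isCont (cdf (semicircle_distribution \<boxplus> std_normal_distribution)) x \<longrightarrow>
          (\<lambda>n. cdf (\<mu> n) x) \<longlonglongrightarrow> cdf (semicircle_distribution \<boxplus> std_normal_distribution) x"
        and x: "isCont (cdf (semicircle_distribution \<boxplus> std_normal_distribution)) x"
      have "\<forall>\<^sub>F n in sequentially. cdf (\<mu> n) x = ?esd n x"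
        using eventually_ge_at_top[of 1] by eventually_elim (simp add: esd)
      then show "(\<lambda>n. ?esd n x) \<longlonglongrightarrow> cdf (semicircle_distribution \<boxplus> std_normal_distribution) x"
        using conv x by (blast intro: Lim_transform_eventually)
    qed
  qed
qed

end
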